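(* On convex compact subsets $K$ of $\mathbb C^2$ let $$\phi(K)=\int_{\xi\in\mathbb CP^1}vol_2(Pr_\xi K)\,d\xi,\qquad \psi(K)=\int_{F\in LGr_2}vol_2(Pr_F(K))\,dF .$$ Then $$\phi+2\psi=V_2.$$
   Context: $\mathbb C^2\cong\mathbb R^4$ carries its standard Hermitian (Euclidean) metric. $\mathbb CP^1$ is the set of complex lines through $0$ in $\mathbb C^2$, and $LGr_2$ is the Grassmannian of Lagrangian linear subspaces of $\mathbb C^2$ (real 2-dimensional subspaces on which the imaginary part of the Hermitian form vanishes); $d\xi$ and $dF$ are the $U(2)$-invariant (Haar) measures normalized to have total mass $1$. $Pr_E$ is the orthogonal projection onto the real 2-dimensional subspace $E$, and $vol_2$ is 2-dimensional Lebesgue measure in $E$. $V_2$ is the second intrinsic volume on convex compact subsets of $\mathbb R^4$, normalized so that $V_2(K)=vol_2(K)$ for every convex compact set $K$ contained in a real 2-dimensional plane; equivalently, $vol_4(K+\varepsilon D)=\sum_{i=0}^4\varepsilon^{4-i}vol_{4-i}(D_{4-i})V_i(K)$ for all $\varepsilon\ge0$, where $D$ is the unit ball of $\mathbb R^4$ and $D_j$ the unit ball of $\mathbb R^j$. *)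

theory Defs
  imports "HOL-Analysis.Analysis" "HOL-Probability.Probability_Measure"
begin

definition orth_proj :: "'a::euclidean_space set \<Rightarrow> 'a \<Rightarrow> 'a" where
  "orth_proj E x = (THE y. y \<in> E \<and> (\<forall>z\<in>E. orthogonal (x - y) z))"

lemma orth_proj_eqI:
  assumes "subspace E" "y \<in> E" "\<And>z. z \<in> E \<Longrightarrow> orthogonal (x - y) z"
  shows "orth_proj E x = y"
  unfolding orth_proj_def
proof (rule the_equality)
  fix w assume w: "w \<in> E \<and> (\<forall>z\<in>E. orthogonal (x - w) z)"
  then have "w - y \<in> E" using assms by (simp add: subspace_diff)
  then have "(x - y) \<bullet> (w - y) = 0" "(x - w) \<bullet> (w - y) = 0"
    using w assms(3) by (auto simp: orthogonal_def)
  then have "(w - y) \<bullet> (w - y) = 0" by (simp add: inner_diff_left)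
  then show "w = y" by simp
qed (use assms in auto)

lemma orth_proj_props:
  assumes "subspace E"
  shows "orth_proj E x \<in> E" "z \<in> E \<Longrightarrow> orthogonal (x - orth_proj E x) z"
proof -
  obtain y w where yw: "y \<in> span E" "\<And>z. z \<in> span E \<Longrightarrow> orthogonal w z" "x = y + w"
    using orthogonal_subspace_decomp_exists[of E x] by blast
  moreover have "span E = E" using assms by (simp add: span_eq_iff)
  ultimately have "y \<in> E" "\<And>z. z \<in> E \<Longrightarrow> orthogonal (x - y) z" by auto
  then show "orth_proj E x \<in> E" "z \<in> E \<Longrightarrow> orthogonal (x - orth_proj E x) z"
    using orth_proj_eqI[OF assms] by auto
qed

lemma bounded_linear_orth_proj:
  assumes "subspace E"
  shows "bounded_linear (orth_proj E)"
proof -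
  have "linear (orth_proj E)"
  proof (rule linearI)
    fix x y
    show "orth_proj E (x + y) = orth_proj E x + orth_proj E y"
      using orth_proj_props[OF assms, where x=x] orth_proj_props[OF assms, where x=y]
      by (intro orth_proj_eqI[OF assms] subspace_add[OF assms])
         (simp_all add: orthogonal_def inner_diff_left inner_add_left)
  next
    fix c :: real and x
    show "orth_proj E (c *\<^sub>R x) = c *\<^sub>R orth_proj E x"
      using orth_proj_props[OF assms, where x=x]
      by (intro orth_proj_eqI[OF assms] subspace_scale[OF assms])
         (simp_all add: orthogonal_def inner_diff_left)
  qed
  then show ?thesis by (simp add: linear_conv_bounded_linear)
qed

text \<open>
  Two-dimensional Lebesgue measure in a two-dimensional real subspace \<open>E\<close>, transported
  from \<open>\<real>\<^sup>2\<close> by a linear isometry onto \<open>E\<close>. Any two such isometries differ by an orthogonal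
  transformation of \<open>\<real>\<^sup>2\<close>, so the choice does not matter.
\<close>

definition vol2_in :: "'a::euclidean_space set \<Rightarrow> 'a set \<Rightarrow> real" where
  "vol2_in E A = measure lebesgue
     ((SOME f :: real^2 \<Rightarrow> 'a. linear f \<and> (\<forall>x. norm (f x) = norm x) \<and> range f = E) -` A)"

text \<open>
  \<open>V\<^sub>i(K)\<close> is read off from the Steiner formula
  \<open>vol\<^sub>n(K + \<epsilon>D) = \<Sum>\<^sub>i \<epsilon>\<^bsup>n-i\<^esup> vol\<^bsub>n-i\<^esub>(D\<^bsub>n-i\<^esub>) V\<^sub>i(K)\<close>, \<open>0 \<le> i \<le> n = DIM('a)\<close>;
  the requirement that \<open>V\<^sub>i = 0\<close> for \<open>i > n\<close> only serves to make the sequence unique.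
\<close>

definition intrinsic_volumes :: "'a::euclidean_space set \<Rightarrow> nat \<Rightarrow> real" where
  "intrinsic_volumes K = (THE V.
     (\<forall>i>DIM('a). V i = 0) \<and>
     (\<forall>\<epsilon>\<ge>0. measure lebesgue {x + \<epsilon> *\<^sub>R y |x y. x \<in> K \<and> y \<in> cball 0 1} =
        (\<Sum>i\<le>DIM('a). \<epsilon> ^ (DIM('a) - i) * unit_ball_vol (real (DIM('a) - i)) * V i)))"

text \<open>
  The library's real inner product on \<^typ>\<open>complex^2\<close> is the real part of \<open>hermitian\<close>,
  i.e. the standard Euclidean one on \<open>\<real>\<^sup>4\<close>. The unqualified \<^const>\<open>subspace\<close> and \<^const>\<open>dim\<close>
  are real notions, the ones prefixed with \<open>vec\<close> are complex.
\<close>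

definition hermitian :: "complex^2 \<Rightarrow> complex^2 \<Rightarrow> complex" where
  "hermitian x y = (\<Sum>i\<in>UNIV. x $ i * cnj (y $ i))"

definition CP1 :: "(complex^2) set set" where
  "CP1 = {E. vec.subspace E \<and> vec.dim E = 1}"

definition LGr2 :: "(complex^2) set set" where
  "LGr2 = {F. subspace F \<and> dim F = 2 \<and> (\<forall>x\<in>F. \<forall>y\<in>F. Im (hermitian x y) = 0)}"

definition U2 :: "(complex^2^2) set" where
  "U2 = {A. \<forall>x y. hermitian (A *v x) (A *v y) = hermitian x y}"

text \<open>
  The Borel sigma-algebra of a set \<open>X\<close> of real subspaces, where \<open>X\<close> carries the usual topology of
  a Grassmannian, induced by the embedding \<open>E \<mapsto> Pr\<^sub>E\<close> into the normed space of linear operators.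
\<close>

definition subspaces_borel :: "'a::euclidean_space set set \<Rightarrow> 'a set measure" where
  "subspaces_borel X = vimage_algebra X (\<lambda>E. Blinfun (orth_proj E)) borel"

definition haar :: "(complex^2) set set \<Rightarrow> (complex^2) set measure" where
  "haar X = (THE M. sets M = sets (subspaces_borel X) \<and> prob_space M \<and>
     (\<forall>A\<in>U2. distr M M (\<lambda>E. (*v) A ` E) = M))"

definition phi :: "(complex^2) set \<Rightarrow> real" where
  "phi K = (\<integral>\<xi>. vol2_in \<xi> (orth_proj \<xi> ` K) \<partial>haar CP1)"

definition psi :: "(complex^2) set \<Rightarrow> real" where
  "psi K = (\<integral>F. vol2_in F (orth_proj F ` K) \<partial>haar LGr2)"

end

theory Submission
  imports Defs "HOL-Real_Asymp.Real_Asymp"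
begin

text \<open>
  Identify \<open>\<complex>\<^sup>2\<close> with the quaternions. Left multiplication by a unit imaginary quaternion
  \<open>l = aI + bJ + cK\<close> is an orthogonal complex structure on \<open>\<real>\<^sup>4\<close>, the given one being \<open>I\<close>. Write
  \<open>\<Gamma>\<^sub>l(K)\<close> for the mean area of the projections of \<open>K\<close> to the complex lines \<open>span {y, ly}\<close> of \<open>l\<close>.
  Then \<open>\<phi> = \<Gamma>\<^sub>I\<close>, and as the Lagrangian planes are the lines of the structures \<open>l\<close> orthogonal to \<open>I\<close>,
  \<open>\<psi>\<close> is the mean of \<open>\<Gamma>\<^sub>l\<close> over this circle.

  The heart of the proof is that \<open>l \<mapsto> \<Gamma>\<^sub>l(K)\<close> is the restriction to the sphere of a quadratic form.
  If \<open>K\<close> is the convex hull of finitely many points \<open>p\<close>, let \<open>u(x) = ln (\<Sum>p. exp (p \<bullet> x))\<close>. On any plane \<open>E\<close> the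
  gradient of \<open>u\<close> restricted to \<open>E\<close> is a diffeomorphism onto the interior of the projection of \<open>K\<close>, so the
  area of this projection is the integral over \<open>E\<close> of the Hessian determinant of the restriction. Since
  every nonzero \<open>x\<close> lies on exactly one line of \<open>l\<close>, averaging over these lines gives an integral
  over \<open>\<complex>\<^sup>2\<close> of the determinant of the Hessian on \<open>span {x, lx}\<close>, with a weight depending
  on \<open>|x|\<close> only; and this determinant is a quadratic form in \<open>l\<close>. General bodies are increasing limits of
  polytopes. Therefore \<open>2\<psi> = \<Gamma>\<^sub>J + \<Gamma>\<^sub>K\<close>, and \<open>\<phi> + 2\<psi> = \<Gamma>\<^sub>I + \<Gamma>\<^sub>J + \<Gamma>\<^sub>K\<close> is the
  trace \<open>\<Theta>(K)\<close> of the form. The lemmas behind this are \<open>vol_convex_hull_gibbs\<close>, \<open>line_avg_coords_hull\<close>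
  and \<open>sum_line_avg_cong\<close>.

  It remains to see that \<open>\<Theta> = V\<^sub>2\<close>. For a sum \<open>Z\<close> of segments \<open>[0, v\<^sub>i]\<close> the volume of \<open>K + tZ\<close> is a
  polynomial in \<open>t\<close>, because \<open>K + [0, sv]\<close> grows linearly in \<open>s\<close>. Its coefficient of \<open>t\<^sup>2\<close>
  is a sum over pairs \<open>i < j\<close>, each pair contributing \<open>|v\<^sub>i \<and> v\<^sub>j|\<close> times the area of the projection of \<open>K\<close> along
  \<open>v\<^sub>i\<close> and \<open>v\<^sub>j\<close>. Zonotopes approximate the ball; in the limit this gives Steiner's formula, and the
  coefficient tends to \<open>\<pi> V\<^sub>2(K)\<close>. The limit is the same for every rotated copy of \<open>Z\<close>, so it
  may be averaged over rotations. The orthogonal complement of \<open>span {v\<^sub>i, v\<^sub>j}\<close> is a line of some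
  structure \<open>l\<close>. Right multiplications by quaternions turn its contribution into a multiple of \<open>\<Gamma>\<^sub>l(K)\<close>,
  and the left multiplications from the tetrahedral group, which act on \<open>l\<close> by rotations, turn
  that into a multiple of \<open>\<Theta>(K)\<close>. So \<open>V\<^sub>2\<close> is a constant multiple of \<open>\<Theta>\<close>, and evaluating on the unit
  ball determines the constant (lemma \<open>intrinsic_volume_2_eq_Theta\<close>).

  The Haar measures are defined by a uniqueness property. They are identified with the laws of explicit
  random planes by averaging an invariant measure over a random unitary map (lemma \<open>haar_eqI\<close>).
\<close>

section \<open>Isometries and volume\<close>

text \<open>
  Preimages of boxes are boxes with permuted side lengths, and boxes determine Lebesgue measure.
\<close>
lemma lborel_distr_basis_map:
  fixes f :: "'a::euclidean_space \<Rightarrow> 'b::euclidean_space"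
  assumes "linear f" "bij_betw f Basis Basis"
  shows "distr lborel borel f = lborel"
proof (rule lborel_eqI[symmetric])
  have lin: "f x = (\<Sum>b\<in>Basis. (x \<bullet> b) *\<^sub>R f b)" for x
    by (subst euclidean_representation[symmetric, of x])
       (simp only: linear_sum[OF assms(1)] linear_scale[OF assms(1)])
  have inj: "f b = f b' \<longleftrightarrow> b = b'" if "b \<in> Basis" "b' \<in> Basis" for b b'
    using assms(2) that by (auto simp: bij_betw_def inj_on_def)
  have fB: "f b \<in> Basis" if "b \<in> Basis" for b
    using assms(2) that by (auto simp: bij_betw_def)
  have coord: "f x \<bullet> f b = x \<bullet> b" if b: "b \<in> Basis" for x b
  proof -
    have "f x \<bullet> f b = (\<Sum>c\<in>Basis. (x \<bullet> c) * (f c \<bullet> f b))"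
      by (subst lin) (simp add: inner_sum_left)
    also have "\<dots> = (\<Sum>c\<in>Basis. if c = b then x \<bullet> c else 0)"
      using b by (intro sum.cong refl) (auto simp: inner_Basis fB inj)
    finally show ?thesis using b by simp
  qed
  have [measurable]: "f \<in> borel_measurable borel"
    using assms(1) by (intro borel_measurable_continuous_onI linear_continuous_on)
       (simp add: linear_conv_bounded_linear)
  fix l u :: 'b assume lu: "\<And>b. b \<in> Basis \<Longrightarrow> l \<bullet> b \<le> u \<bullet> b"
  define g where "g l = (\<Sum>b\<in>Basis. (l \<bullet> f b) *\<^sub>R b)" for l :: 'b
  have "f -` box l u = box (g l) (g u)"
  proof -
    have "x \<in> f -` box l u \<longleftrightarrow> (\<forall>c\<in>f ` Basis. l \<bullet> c < f x \<bullet> c \<and> f x \<bullet> c < u \<bullet> c)" for x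
      using assms(2) by (simp add: mem_box bij_betw_def)
    then show ?thesis by (auto simp: mem_box coord g_def)
  qed
  moreover have "(\<Prod>b\<in>Basis. (g u - g l) \<bullet> b) = (\<Prod>b\<in>Basis. (u - l) \<bullet> f b)"
    by (intro prod.cong) (auto simp: g_def inner_diff_left)
  moreover have "\<dots> = (\<Prod>b\<in>Basis. (u - l) \<bullet> b)"
    using prod.reindex_bij_betw[OF assms(2), of "\<lambda>c. (u - l) \<bullet> c"] by simp
  ultimately show "emeasure (distr lborel borel f) (box l u) = (\<Prod>b\<in>Basis. (u - l) \<bullet> b)"
    using lu fB by (auto simp: emeasure_distr emeasure_lborel_box_eq g_def)
qed simp

lemma lborel_distr_orthogonal_vec:
  fixes f :: "real^'n::{finite,wellorder} \<Rightarrow> real^'n::_"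
  assumes "orthogonal_transformation f"
  shows "distr lborel borel f = lborel"
proof (rule lborel_eqI[symmetric])
  have lin: "linear f" using assms orthogonal_transformation_linear by blast
  have [measurable]: "f \<in> borel_measurable borel"
    using lin by (intro borel_measurable_continuous_onI linear_continuous_on)
       (simp add: linear_conv_bounded_linear)
  fix l u :: "real^'n::{finite,wellorder}" assume lu: "\<And>b. b \<in> Basis \<Longrightarrow> l \<bullet> b \<le> u \<bullet> b"
  have bij: "bij f" using assms orthogonal_transformation_bij by blast
  have orth: "orthogonal_transformation (inv f)"
    using assms orthogonal_transformation_inv by blast
  have eq: "f -` box l u = inv f ` box l u"
    using bij by (simp add: bij_vimage_eq_inv_image)
  have lm: "inv f ` box l u \<in> lmeasurable" "measure lebesgue (inv f ` box l u) = measure lebesgue (box l u)"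
    using measurable_orthogonal_image[OF orth] measure_orthogonal_image[OF orth] by auto
  have "emeasure lborel (f -` box l u) = emeasure lebesgue (f -` box l u)"
    using measurable_sets[of f borel borel "box l u"] by simp
  also have "\<dots> = ennreal (measure lebesgue (box l u))"
    using lm by (simp add: eq emeasure_eq_measure2 fmeasurableD2)
  also have "\<dots> = emeasure lborel (box l u)"
    by (simp add: emeasure_eq_measure2)
  finally show "emeasure (distr lborel borel f) (box l u) = (\<Prod>b\<in>Basis. (u - l) \<bullet> b)"
    using lu by (simp add: emeasure_distr emeasure_lborel_box_eq)
qed simp

text \<open>
  This transports results about \<open>real^'n\<close> to other Euclidean spaces of the same dimension.
\<close>
lemma exists_isometry_from_vec:
  assumes "DIM('a::euclidean_space) = CARD('n::finite)"
  obtains f :: "real^'n::finite \<Rightarrow> 'a::euclidean_space" and g :: "'a \<Rightarrow> real^'n" where "linear f" "linear g" "\<And>x. norm (f x) = norm x"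
    "\<And>x. norm (g x) = norm x"
    "\<And>x. f (g x) = x" "\<And>x. g (f x) = x" "distr lborel borel f = lborel" "distr lborel borel g = lborel"
proof -
  have "card (Basis :: (real^'n) set) = card (Basis :: 'a set)" using assms by simp
  then obtain h where h: "bij_betw h (Basis :: (real^'n) set) (Basis :: 'a set)"
    using finite_Basis finite_same_card_bij by metis
  define h' where "h' = inv_into Basis h"
  have h': "bij_betw h' (Basis :: 'a set) (Basis :: (real^'n) set)"
    using h bij_betw_inv_into h'_def by blast
  have hh: "h' (h b) = b" if "b \<in> Basis" for b
    using h that by (simp add: h'_def bij_betw_inv_into_left)
  have hh2: "h (h' b) = b" if "b \<in> Basis" for b
    using h that by (simp add: h'_def bij_betw_inv_into_right)
  define f where "f x = (\<Sum>b\<in>Basis. (x \<bullet> b) *\<^sub>R h b)" for x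
  define g where "g x = (\<Sum>b\<in>Basis. (x \<bullet> b) *\<^sub>R h' b)" for x
  have linf: "linear f" unfolding f_def
    by (intro linear_compose_sum ballI linearI) (auto simp: inner_add_left scaleR_add_left)
  have ling: "linear g" unfolding g_def
    by (intro linear_compose_sum ballI linearI) (auto simp: inner_add_left scaleR_add_left)
  have fb: "f b = h b" if "b \<in> Basis" for b
  proof -
    have "f b = (\<Sum>c\<in>Basis. if c = b then h c else 0)"
      unfolding f_def using that by (intro sum.cong refl) (auto simp: inner_Basis)
    then show ?thesis using that by simp
  qed
  have gb: "g b = h' b" if "b \<in> Basis" for b
  proof -
    have "g b = (\<Sum>c\<in>Basis. if c = b then h' c else 0)"
      unfolding g_def using that by (intro sum.cong refl) (auto simp: inner_Basis)
    then show ?thesis using that by simp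
  qed
  have hB: "h b \<in> Basis" if "b \<in> Basis" for b using h that by (auto simp: bij_betw_def)
  have h'B: "h' b \<in> Basis" if "b \<in> Basis" for b using h' that by (auto simp: bij_betw_def)
  have gf: "g (f x) = x" for x
  proof -
    have "g (f x) = (\<Sum>b\<in>Basis. (x \<bullet> b) *\<^sub>R b)"
      unfolding f_def by (simp add: linear_sum[OF ling] linear_scale[OF ling] gb hB hh)
    then show ?thesis by (simp add: euclidean_representation)
  qed
  have fg: "f (g x) = x" for x
  proof -
    have "f (g x) = (\<Sum>b\<in>Basis. (x \<bullet> b) *\<^sub>R b)"
      unfolding g_def by (simp add: linear_sum[OF linf] linear_scale[OF linf] fb h'B hh2)
    then show ?thesis by (simp add: euclidean_representation)
  qed
  have inn: "f x \<bullet> f y = x \<bullet> y" for x y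
  proof -
    have "f x \<bullet> f y = (\<Sum>b\<in>Basis. \<Sum>c\<in>Basis. (x \<bullet> b) * (y \<bullet> c) * (h b \<bullet> h c))"
      unfolding f_def by (subst sum.swap) (simp add: inner_sum_left inner_sum_right sum_distrib_left mult_ac)
    also have "\<dots> = (\<Sum>b\<in>Basis. \<Sum>c\<in>Basis. if b = c then (x \<bullet> b) * (y \<bullet> b) else 0)"
      using h by (intro sum.cong refl) (auto simp: inner_Basis hB bij_betw_def inj_on_def)
    also have "\<dots> = x \<bullet> y"
      by (subst (3) euclidean_inner) simp
    finally show ?thesis .
  qed
  have nf: "norm (f x) = norm x" for x by (simp add: norm_eq_sqrt_inner inn)
  have ng: "norm (g x) = norm x" for x using nf[of "g x"] by (simp add: fg)
  have "bij_betw f Basis Basis" using h fb by (subst bij_betw_cong[of _ f h]) auto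
  then have df: "distr lborel borel f = lborel" by (rule lborel_distr_basis_map[OF linf])
  have "bij_betw g Basis Basis" using h' gb by (subst bij_betw_cong[of _ g h']) auto
  then have dg: "distr lborel borel g = lborel" by (rule lborel_distr_basis_map[OF ling])
  show ?thesis
    by (rule that[OF linf ling nf ng fg gf df dg])
qed

lemma linear_borel_measurable:
  fixes f :: "'a::euclidean_space \<Rightarrow> 'b::real_normed_vector"
  assumes "linear f" shows "f \<in> borel_measurable borel"
  using assms by (intro borel_measurable_continuous_onI linear_continuous_on)
       (simp add: linear_conv_bounded_linear)

text \<open>
  Conjugating by coordinate isometries reduces the claim to an orthogonal transformation of \<open>real^'n\<close>.
\<close>
lemma lborel_distr_isometry:
  fixes T :: "'a::euclidean_space \<Rightarrow> 'b::euclidean_space"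
  assumes T: "linear T" "\<And>x. norm (T x) = norm x"
    and dim: "DIM('a) = CARD('n::{finite,wellorder})" "DIM('b) = CARD('n)"
  shows "distr lborel borel T = lborel"
proof -
  obtain f :: "real^'n::{finite,wellorder} \<Rightarrow> 'a" and g :: "'a \<Rightarrow> real^'n::{finite,wellorder}" where fg: "linear f" "linear g" "\<And>x. norm (f x) = norm x"
    "\<And>x. norm (g x) = norm x"
    "\<And>x. f (g x) = x" "\<And>x. g (f x) = x" "distr lborel borel f = lborel" "distr lborel borel g = lborel"
    using exists_isometry_from_vec[OF dim(1)] by metis
 obtain f' :: "real^'n::{finite,wellorder} \<Rightarrow> 'b" and g' :: "'b \<Rightarrow> real^'n::{finite,wellorder}" where fg': "linear f'" "linear g'" "\<And>x. norm (f' x) = norm x"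
    "\<And>x. norm (g' x) = norm x"
    "\<And>x. f' (g' x) = x" "\<And>x. g' (f' x) = x" "distr lborel borel f' = lborel" "distr lborel borel g' = lborel"
    using exists_isometry_from_vec[OF dim(2)] by metis
  define h where "h = g' \<circ> T \<circ> f"
  have "linear h" unfolding h_def
    by (intro linear_compose fg fg' T)
  then have h: "orthogonal_transformation h"
    by (simp add: orthogonal_transformation h_def fg fg' T)
  note [measurable] = linear_borel_measurable[OF fg(1)] linear_borel_measurable[OF fg(2)]
     linear_borel_measurable[OF fg'(1)] linear_borel_measurable[OF fg'(2)]
     linear_borel_measurable[OF \<open>linear h\<close>] linear_borel_measurable[OF T(1)]
  have "T = f' \<circ> h \<circ> g" by (auto simp: h_def fg fg')
  then have "distr lborel borel T = distr (distr (distr lborel borel g) borel h) borel f'"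
    by (simp add: distr_distr o_assoc)
  also have "\<dots> = lborel" by (simp add: fg lborel_distr_orthogonal_vec[OF h] fg')
  finally show ?thesis .
qed

text \<open>
  Dividing \<open>T\<close> by \<open>r\<close> leaves an isometry, and a homothety of ratio \<open>r\<close> contributes the factor \<open>r\<^sup>4\<close>. This
  is the only change of variables in dimension four that is needed.
\<close>
lemma nn_integral_similarity:
  fixes T :: "'a::euclidean_space \<Rightarrow> 'b::euclidean_space"
  assumes T: "linear T" "\<And>x. norm (T x) = r * norm x" "r > 0"
    and dim: "DIM('a) = 4" "DIM('b) = 4"
    and [measurable]: "f \<in> borel_measurable borel"
  shows "(\<integral>\<^sup>+x. f x \<partial>lborel) = ennreal (r ^ 4) * (\<integral>\<^sup>+x. f (T x) \<partial>lborel)"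
proof -
  define U where "U x = (1 / r) *\<^sub>R T x" for x
  have U: "linear U" unfolding U_def[abs_def] using T(1)
    by (intro linear_compose_scale_right)
  have "distr lborel borel U = lborel"
    using U T(2,3) by (intro lborel_distr_isometry[where 'n=4]) (auto simp: U_def dim)
  note [measurable] = linear_borel_measurable[OF U] linear_borel_measurable[OF T(1)]
  have TU: "T x = 0 + r *\<^sub>R U x" for x using T(3) by (simp add: U_def)
  have "(\<integral>\<^sup>+x. f x \<partial>lborel) = (\<integral>\<^sup>+x. ennreal (r^4) * f (0 + r *\<^sub>R x) \<partial>(lborel :: 'b measure))"
    by (subst lborel_affine[of r 0]) (use T(3) in \<open>simp_all add: nn_integral_density nn_integral_distr dim\<close>)
  also have "\<dots> = ennreal (r ^ 4) * (\<integral>\<^sup>+x. f (0 + r *\<^sub>R x) \<partial>(lborel :: 'b measure))"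
    by (intro nn_integral_cmult) simp
  also have "(\<integral>\<^sup>+x. f (0 + r *\<^sub>R x) \<partial>(lborel :: 'b measure)) = (\<integral>\<^sup>+x. f (0 + r *\<^sub>R x) \<partial>(distr lborel borel U))"
    by (simp add: \<open>distr lborel borel U = lborel\<close>)
  also have "\<dots> = (\<integral>\<^sup>+x. f (T x) \<partial>lborel)"
    unfolding TU by (subst nn_integral_distr) simp_all
  finally show ?thesis .
qed

section \<open>Volume of a body plus a zonotope\<close>

abbreviation vol :: "'a::euclidean_space set \<Rightarrow> real" where
  "vol \<equiv> measure lebesgue"

definition seg :: "'a::real_vector \<Rightarrow> 'a set" where
  "seg v = closed_segment 0 v"

definition zonotope :: "'a::real_vector list \<Rightarrow> 'a set" where
  "zonotope vs = sum_list (map seg vs)"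

lemma zonotope_Nil [simp]: "zonotope [] = {0}"
  and zonotope_Cons [simp]: "zonotope (v # vs) = seg v + zonotope vs"
  by (auto simp: zonotope_def set_zero)

lemma mem_seg_iff: "x \<in> seg v \<longleftrightarrow> (\<exists>t. 0 \<le> t \<and> t \<le> 1 \<and> x = t *\<^sub>R v)"
  by (auto simp: seg_def closed_segment_def)

lemma mem_seg_scaleR_iff:
  assumes "s \<ge> 0"
  shows "x \<in> seg (s *\<^sub>R v) \<longleftrightarrow> (\<exists>t. 0 \<le> t \<and> t \<le> s \<and> x = t *\<^sub>R v)"
proof
  assume "x \<in> seg (s *\<^sub>R v)"
  then obtain t where "0 \<le> t" "t \<le> 1" "x = t *\<^sub>R (s *\<^sub>R v)" by (auto simp: mem_seg_iff)
  then show "\<exists>t. 0 \<le> t \<and> t \<le> s \<and> x = t *\<^sub>R v"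
    using assms by (intro exI[of _ "t * s"]) (auto simp: mult_left_le_one_le)
next
  assume "\<exists>t. 0 \<le> t \<and> t \<le> s \<and> x = t *\<^sub>R v"
  then obtain t where t: "0 \<le> t" "t \<le> s" "x = t *\<^sub>R v" by auto
  show "x \<in> seg (s *\<^sub>R v)"
  proof (cases "s = 0")
    case True with t show ?thesis by (auto simp: mem_seg_iff)
  next
    case False
    with t assms show ?thesis
      unfolding mem_seg_iff by (intro exI[of _ "t / s"]) (auto simp: field_simps)
  qed
qed

lemma zero_in_seg [simp]: "0 \<in> seg v"
  by (simp add: seg_def)

lemma compact_seg [simp]: "compact (seg (v::'a::real_normed_vector))"
  and convex_seg [simp]: "convex (seg v)"
  by (auto simp: seg_def compact_segment)

lemma compact_set_plus:
  fixes A B :: "'a::real_normed_vector set"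
  assumes "compact A" "compact B" shows "compact (A + B)"
proof -
  have "A + B = {x + y | x y. x \<in> A \<and> y \<in> B}" by (auto simp: set_plus_def)
  then show ?thesis using compact_sums[OF assms] by simp
qed

lemma compact_zonotope [simp]: "compact (zonotope (vs :: 'a::real_normed_vector list))"
  and convex_zonotope [simp]: "convex (zonotope vs)"
  by (induction vs) (auto simp: compact_set_plus convex_set_plus)

lemma vol_mono: "compact A \<Longrightarrow> compact B \<Longrightarrow> A \<subseteq> B \<Longrightarrow> vol A \<le> vol B"
  by (intro measure_mono_fmeasurable) (auto simp: lmeasurable_compact fmeasurableD)

lemma vol_plus_singleton: "vol (A + {c}) = vol A"
proof -
  have "A + {c} = (+) c ` A" by (auto simp: set_plus_def add.commute)
  then show ?thesis by (simp only: measure_translation)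
qed

text \<open>
  On every line parallel to \<open>v\<close> the body is an interval, so \<open>K + [0, sv]\<close> and its
  translated neighbour overlap exactly in a translate of \<open>K\<close>.
\<close>
lemma vol_plus_seg_add:
  fixes K :: "'a::euclidean_space set"
  assumes K: "compact K" "convex K" and st: "s \<ge> 0" "t \<ge> 0"
  shows "vol (K + seg ((s + t) *\<^sub>R v)) = vol (K + seg (s *\<^sub>R v)) + vol (K + seg (t *\<^sub>R v)) - vol K"
proof -
  let ?A = "K + seg (s *\<^sub>R v)" and ?B = "K + seg (t *\<^sub>R v) + {s *\<^sub>R v}"
  have un: "K + seg ((s + t) *\<^sub>R v) = ?A \<union> ?B"
  proof (intro equalityI subsetI)
    fix x assume "x \<in> K + seg ((s + t) *\<^sub>R v)"
    then obtain k r where kr: "k \<in> K" "0 \<le> r" "r \<le> s + t" "x = k + r *\<^sub>R v"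
      using st by (auto simp: set_plus_def mem_seg_scaleR_iff)
    show "x \<in> ?A \<union> ?B"
    proof (cases "r \<le> s")
      case True
      then have "r *\<^sub>R v \<in> seg (s *\<^sub>R v)" using kr st by (auto simp: mem_seg_scaleR_iff)
      then show ?thesis using kr by blast
    next
      case False
      have "x = k + (r - s) *\<^sub>R v + s *\<^sub>R v" using kr by (simp add: algebra_simps)
      moreover have "(r - s) *\<^sub>R v \<in> seg (t *\<^sub>R v)"
        unfolding mem_seg_scaleR_iff[OF st(2)] using False kr by (intro exI[of _ "r - s"]) auto
      ultimately have "x \<in> ?B" using kr(1) by (auto simp: set_plus_def)
      then show ?thesis by blast
    qed
  next
    fix x assume x: "x \<in> ?A \<union> ?B"
    have "\<exists>k\<in>K. \<exists>r. 0 \<le> r \<and> r \<le> s + t \<and> x = k + r *\<^sub>R v"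
    proof (cases "x \<in> ?A")
      case True
      then obtain k r where "k \<in> K" "0 \<le> r" "r \<le> s" "x = k + r *\<^sub>R v"
        using st by (auto simp: set_plus_def mem_seg_scaleR_iff)
      then show ?thesis using st by (intro bexI[of _ k] exI[of _ r]) auto
    next
      case False
      then obtain k r where "k \<in> K" "0 \<le> r" "r \<le> t" "x = k + r *\<^sub>R v + s *\<^sub>R v"
        using x st by (auto simp: set_plus_def mem_seg_scaleR_iff)
      then show ?thesis using st
        by (intro bexI[of _ k] exI[of _ "r + s"]) (auto simp: algebra_simps)
    qed
    then obtain k r where kr: "k \<in> K" "0 \<le> r" "r \<le> s + t" "x = k + r *\<^sub>R v" by blast
    then have "r *\<^sub>R v \<in> seg ((s + t) *\<^sub>R v)" using st by (auto simp: mem_seg_scaleR_iff)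
    then show "x \<in> K + seg ((s + t) *\<^sub>R v)" using kr by blast
  qed
  have int: "?A \<inter> ?B = K + {s *\<^sub>R v}"
  proof (intro equalityI subsetI)
    fix x assume x: "x \<in> ?A \<inter> ?B"
    obtain k r where 1: "k \<in> K" "0 \<le> r" "r \<le> s" "x = k + r *\<^sub>R v"
      using x st by (auto simp: set_plus_def mem_seg_scaleR_iff)
    obtain k' r' where 2: "k' \<in> K" "0 \<le> r'" "r' \<le> t" "x = k' + r' *\<^sub>R v + s *\<^sub>R v"
      using x st by (auto simp: set_plus_def mem_seg_scaleR_iff)
    define y where "y = x - s *\<^sub>R v"
    have k: "k = y + (s - r) *\<^sub>R v" and k': "k' = y - r' *\<^sub>R v"
      using 1 2 by (auto simp: y_def algebra_simps)
    have "y \<in> K"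
    proof (cases "s - r + r' = 0")
      case True
      then have "r = s" using 1 2 by linarith
      then show ?thesis using k 1 by simp
    next
      case False
      then have pos: "s - r + r' > 0" using 1 2 by linarith
      let ?a = "r' / (s - r + r')" and ?b = "(s - r) / (s - r + r')"
      have ab: "?a + ?b = 1" using pos by (simp add: add_divide_distrib[symmetric])
      have "?a *\<^sub>R k + ?b *\<^sub>R k' \<in> K"
        using K(2) 1 2 pos ab by (intro convexD) auto
      moreover have "a *\<^sub>R k + b *\<^sub>R k' = (a + b) *\<^sub>R y + (a * (s - r) - b * r') *\<^sub>R v" for a b
        unfolding k k' by (simp add: algebra_simps)
      moreover have "?a * (s - r) - ?b * r' = 0" by simp
      ultimately show ?thesis using ab by simp
    qed
    then show "x \<in> K + {s *\<^sub>R v}" by (auto simp: set_plus_def y_def intro: bexI[of _ y])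
  next
    fix x assume "x \<in> K + {s *\<^sub>R v}"
    then obtain k where k: "k \<in> K" "x = k + s *\<^sub>R v" by (auto simp: set_plus_def)
    have "s *\<^sub>R v \<in> seg (s *\<^sub>R v)" by (simp add: seg_def)
    then have "x \<in> ?A" using k by (auto simp: set_plus_def)
    moreover have "x = k + 0 + s *\<^sub>R v" using k by simp
    then have "x \<in> ?B" using k(1) zero_in_seg by (metis insertI1 set_plus_intro)
    ultimately show "x \<in> ?A \<inter> ?B" by blast
  qed
  have cA: "compact ?A" and cB: "compact ?B"
    using K by (auto intro!: compact_set_plus)
  have "vol (?A \<union> ?B) = vol ?A + vol ?B - vol (?A \<inter> ?B)"
    using measure_Un3[OF lmeasurable_compact[OF cA] lmeasurable_compact[OF cB]] by simp
  then show ?thesis by (simp add: un int vol_plus_singleton)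
qed

text \<open>
  Cauchy's functional equation: an additive nonnegative function is monotone, hence squeezed between
  its values at the integer multiples of \<open>1/n\<close>.
\<close>
lemma additive_nonneg_imp_linear:
  fixes g :: "real \<Rightarrow> real"
  assumes add: "\<And>s t. s \<ge> 0 \<Longrightarrow> t \<ge> 0 \<Longrightarrow> g (s + t) = g s + g t"
    and nonneg: "\<And>s. s \<ge> 0 \<Longrightarrow> g s \<ge> 0" and t: "t \<ge> 0"
  shows "g t = t * g 1"
proof -
  have mono: "g a \<le> g b" if "0 \<le> a" "a \<le> b" for a b
    using add[of a "b - a"] nonneg[of "b - a"] that by simp
  have g0: "g 0 = 0" using add[of 0 0] by simp
  have mult: "g (real n * s) = real n * g s" if "s \<ge> 0" for n s
  proof (induction n)
    case (Suc n)
    have "g (real (Suc n) * s) = g (real n * s + s)" by (simp add: algebra_simps)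
    also have "\<dots> = g (real n * s) + g s" using that by (intro add) auto
    finally show ?case using Suc by (simp add: algebra_simps)
  qed (simp add: g0)
  have bound: "\<bar>g t - t * g 1\<bar> * real n \<le> g 1" for n
  proof -
    define m where "m = nat \<lfloor>real n * t\<rfloor>"
    have m: "real m \<le> real n * t" "real n * t \<le> real m + 1"
      using t by (auto simp: m_def)
    have "real m * g 1 \<le> real n * g t"
      using mono[of "real m" "real n * t"] m mult[of 1 m] mult[OF t, of n] by simp
    moreover have "real n * g t \<le> (real m + 1) * g 1"
      using mono[of "real n * t" "real (Suc m)"] m t mult[of 1 "Suc m"] mult[OF t, of n]
      by (simp add: algebra_simps)
    moreover have "real m * g 1 \<le> real n * t * g 1" "real n * t * g 1 \<le> (real m + 1) * g 1"
      using m nonneg[of 1] by (auto intro!: mult_right_mono)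
    ultimately have "\<bar>real n * (g t - t * g 1)\<bar> \<le> g 1"
      by (simp add: algebra_simps abs_le_iff)
    then show ?thesis by (simp add: abs_mult mult.commute)
  qed
  have "\<bar>g t - t * g 1\<bar> = 0"
  proof (rule ccontr)
    assume "\<bar>g t - t * g 1\<bar> \<noteq> 0"
    then have "\<bar>g t - t * g 1\<bar> > 0" by simp
    from reals_Archimedean3[OF this] obtain n where "g 1 < real n * \<bar>g t - t * g 1\<bar>" by blast
    with bound[of n] show False by (simp add: mult.commute)
  qed
  then show ?thesis by simp
qed

lemma vol_plus_seg_affine:
  fixes K :: "'a::euclidean_space set"
  assumes K: "compact K" "convex K" and t: "t \<ge> 0"
  shows "vol (K + seg (t *\<^sub>R v)) = vol K + t * (vol (K + seg v) - vol K)"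
proof -
  define g where "g t = vol (K + seg (t *\<^sub>R v)) - vol K" for t
  have "K \<subseteq> K + seg (s *\<^sub>R v)" for s
    using zero_in_seg[of "s *\<^sub>R v"] by (force simp: set_plus_def)
  then have "g s \<ge> 0" for s
    using K by (auto simp: g_def intro!: vol_mono compact_set_plus)
  then have "g t = t * g 1"
    using t by (intro additive_nonneg_imp_linear) (auto simp: g_def vol_plus_seg_add[OF K])
  then show ?thesis by (simp add: g_def)
qed

text \<open>
  The polynomial \<open>t \<mapsto> vol (K + t Z)\<close> for the zonotope \<open>Z\<close> generated by a list. The volume is affine in
  the length of each single generator, whence the recursion.
\<close>
fun zonotope_poly :: "'a::euclidean_space set \<Rightarrow> 'a list \<Rightarrow> real poly" where
  "zonotope_poly K [] = [:vol K:]"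
| "zonotope_poly K (v # vs) = zonotope_poly K vs + pCons 0 (zonotope_poly (K + seg v) vs - zonotope_poly K vs)"

lemma poly_zonotope_poly:
  assumes "compact K" "convex K" and t: "t \<ge> 0"
  shows "poly (zonotope_poly K vs) t = vol (K + zonotope (map ((*\<^sub>R) t) vs))"
  using assms(1,2)
proof (induction vs arbitrary: K)
  case Nil
  then show ?case by (simp add: vol_plus_singleton)
next
  case (Cons v vs)
  let ?L = "K + zonotope (map ((*\<^sub>R) t) vs)"
  have L: "compact ?L" "convex ?L" using Cons.prems by (auto intro: compact_set_plus convex_set_plus)
  have Kv: "compact (K + seg v)" "convex (K + seg v)"
    using Cons.prems by (auto intro: compact_set_plus convex_set_plus)
  have "vol (K + zonotope (map ((*\<^sub>R) t) (v # vs))) = vol (?L + seg (t *\<^sub>R v))"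
    by (simp add: ac_simps)
  also have "\<dots> = vol ?L + t * (vol (?L + seg v) - vol ?L)"
    by (rule vol_plus_seg_affine[OF L t])
  also have "?L + seg v = (K + seg v) + zonotope (map ((*\<^sub>R) t) vs)"
    by (simp add: ac_simps)
  finally show ?case using Cons.IH[OF Cons.prems] Cons.IH[OF Kv] by simp
qed

text \<open>
  The coefficient of \<open>st\<close> in \<open>vol (K + [0, sv] + [0, tw])\<close>, a mixed volume up to a factor.
\<close>
definition mixed_diff :: "'a::euclidean_space set \<Rightarrow> 'a \<Rightarrow> 'a \<Rightarrow> real" where
  "mixed_diff K v w = vol (K + seg v + seg w) - vol (K + seg v) - vol (K + seg w) + vol K"

fun sum_pairs :: "('a \<Rightarrow> 'a \<Rightarrow> real) \<Rightarrow> 'a list \<Rightarrow> real" where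
  "sum_pairs f [] = 0"
| "sum_pairs f (v # vs) = (\<Sum>w\<leftarrow>vs. f v w) + sum_pairs f vs"

lemma coeff_zonotope_poly_0: "coeff (zonotope_poly K vs) 0 = vol K"
  by (induction vs arbitrary: K) auto

lemma coeff_zonotope_poly_1: "coeff (zonotope_poly K vs) 1 = (\<Sum>w\<leftarrow>vs. vol (K + seg w) - vol K)"
  by (induction vs arbitrary: K) (auto simp: coeff_zonotope_poly_0)

lemma coeff_zonotope_poly_2: "coeff (zonotope_poly K vs) 2 = sum_pairs (mixed_diff K) vs"
proof (induction vs arbitrary: K)
  case (Cons v vs)
  have "coeff (zonotope_poly K (v # vs)) 2 =
    coeff (zonotope_poly K vs) 2 + (coeff (zonotope_poly (K + seg v) vs) 1 - coeff (zonotope_poly K vs) 1)"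
    by (simp add: numeral_2_eq_2)
  also have "coeff (zonotope_poly (K + seg v) vs) 1 - coeff (zonotope_poly K vs) 1 = (\<Sum>w\<leftarrow>vs. mixed_diff K v w)"
    unfolding coeff_zonotope_poly_1 sum_list_subtractf[symmetric] mixed_diff_def
    by (intro arg_cong[of _ _ sum_list] map_cong) auto
  finally show ?case using Cons by simp
qed (simp add: numeral_2_eq_2)

lemma zonotope_subset_cball:
  fixes vs :: "'a::real_normed_vector list"
  shows "t \<ge> 0 \<Longrightarrow> zonotope (map ((*\<^sub>R) t) vs) \<subseteq> cball 0 (t * (\<Sum>v\<leftarrow>vs. norm v))"
proof (induction vs)
  case (Cons v vs)
  show ?case
  proof
    fix x assume "x \<in> zonotope (map ((*\<^sub>R) t) (v # vs))"
    then obtain a b where ab: "x = a + b" "a \<in> seg (t *\<^sub>R v)" "b \<in> zonotope (map ((*\<^sub>R) t) vs)"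
      by (auto simp: set_plus_def)
    have "norm a \<le> t * norm v"
      using ab(2) Cons.prems by (auto simp: mem_seg_scaleR_iff intro!: mult_right_mono)
    moreover have "norm b \<le> t * (\<Sum>v\<leftarrow>vs. norm v)"
      using Cons ab(3) by auto
    ultimately show "x \<in> cball 0 (t * (\<Sum>v\<leftarrow>v # vs. norm v))"
      using norm_triangle_ineq[of a b] ab(1) by (simp add: algebra_simps)
  qed
qed simp

lemma vol_cball: "r \<ge> 0 \<Longrightarrow> vol (cball (c::'a::euclidean_space) r) = unit_ball_vol (DIM('a)) * r ^ DIM('a)"
  using content_cball[of r c] by simp

lemma degree_le_of_growth:
  fixes p :: "real poly"
  assumes bound: "\<And>t. t \<ge> 0 \<Longrightarrow> 0 \<le> poly p t \<and> poly p t \<le> poly q t" 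
  shows "degree p \<le> degree q"
proof (rule ccontr)
  assume "\<not> degree p \<le> degree q"
  then have dlt: "degree q < degree p" by simp
  then have p0: "lead_coeff p \<noteq> 0" by auto
  show False
  proof (cases "lead_coeff p > 0")
    case True
    have "lead_coeff (p - q) = lead_coeff p"
      using dlt by (metis coeff_diff degree_add_eq_left degree_minus diff_0_right
        diff_conv_add_uminus coeff_eq_0)
    with True obtain n where n: "\<And>x. x \<ge> n \<Longrightarrow> poly (p - q) x \<ge> lead_coeff p"
      using poly_pinfty_gt_lc[of "p - q"] by metis
    have "poly (p - q) (max n 0) \<ge> lead_coeff p" by (rule n) simp
    with bound[of "max n 0"] True show False by simp
  next
    case False
    then have "lead_coeff p < 0" using p0 by linarith
    then have "lead_coeff (- p) > 0" by simp
    then obtain n where n: "\<And>x. x \<ge> n \<Longrightarrow> poly (- p) x \<ge> lead_coeff (- p)"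
      using poly_pinfty_gt_lc[of "- p"] by metis
    have "poly (- p) (max n 0) \<ge> lead_coeff (- p)" by (rule n) simp
    with bound[of "max n 0"] \<open>lead_coeff (- p) > 0\<close> show False by simp
  qed
qed

text \<open>
  The recursion only bounds the degree by the number of generators; the better bound holds because the
  volume of \<open>K + t Z\<close> grows no faster than that of a ball of radius \<open>R + t S\<close>.
\<close>
lemma degree_zonotope_poly:
  fixes K :: "'a::euclidean_space set"
  assumes K: "compact K" "convex K"
  shows "degree (zonotope_poly K vs) \<le> DIM('a)"
proof -
  obtain R where R: "R > 0" "K \<subseteq> cball 0 R"
    using compact_imp_bounded[OF K(1)] unfolding bounded_pos by (metis mem_cball_0 subsetI)
  define S where "S = (\<Sum>v\<leftarrow>vs. norm v)"
  have S: "S \<ge> 0" by (auto simp: S_def intro!: sum_list_nonneg)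
  define q where "q = smult (unit_ball_vol (DIM('a))) ([:R, S:] ^ DIM('a))"
  have "degree (zonotope_poly K vs) \<le> degree q"
  proof (rule degree_le_of_growth)
    fix t :: real assume t: "t \<ge> 0"
    have "K + zonotope (map ((*\<^sub>R) t) vs) \<subseteq> cball 0 (R + t * S)"
    proof
      fix x assume "x \<in> K + zonotope (map ((*\<^sub>R) t) vs)"
      then obtain a b where "x = a + b" "a \<in> K" "b \<in> zonotope (map ((*\<^sub>R) t) vs)"
        by (auto simp: set_plus_def)
      moreover have "norm a \<le> R" using R \<open>a \<in> K\<close> by auto
      moreover have "norm b \<le> t * S"
        using zonotope_subset_cball[OF t, of vs] \<open>b \<in> _\<close> by (auto simp: S_def)
      ultimately show "x \<in> cball 0 (R + t * S)" using norm_triangle_ineq[of a b] by simp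
    qed
    then have "vol (K + zonotope (map ((*\<^sub>R) t) vs)) \<le> vol (cball (0::'a) (R + t * S))"
      using K by (intro vol_mono compact_set_plus) auto
    also have "\<dots> = poly q t"
      using R S t by (subst vol_cball) (auto simp: q_def poly_power)
    finally show "0 \<le> poly (zonotope_poly K vs) t \<and> poly (zonotope_poly K vs) t \<le> poly q t"
      by (simp add: poly_zonotope_poly[OF K t])
  qed
  also have "degree q \<le> DIM('a)"
    unfolding q_def by (rule order.trans[OF degree_smult_le], rule order.trans[OF degree_power_le]) auto
  finally show ?thesis .
qed

lemma poly_degree_4:
  fixes p :: "real poly"
  assumes "degree p \<le> 4"
  shows "poly p t = coeff p 0 + coeff p 1 * t + coeff p 2 * t^2 + coeff p 3 * t^3 + coeff p 4 * t^4"
proof -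
  have "poly p t = (\<Sum>i\<le>4. coeff p i * t ^ i)"
    unfolding poly_altdef using assms
    by (intro sum.mono_neutral_left) (auto simp: coeff_eq_0)
  then show ?thesis by (simp add: eval_nat_numeral)
qed

text \<open>
  Pointwise convergence of polynomials of bounded degree therefore entails convergence of their
  coefficients.
\<close>
lemma coeff_interpolation_4:
  fixes p :: "real poly"
  assumes "degree p \<le> 4"
  defines "f \<equiv> poly p"
  shows "coeff p 0 = f 0"
    "coeff p 1 = (- 25 * f 0 + 48 * f 1 - 36 * f 2 + 16 * f 3 - 3 * f 4) / 12"
    "coeff p 2 = (35 * f 0 - 104 * f 1 + 114 * f 2 - 56 * f 3 + 11 * f 4) / 24"
    "coeff p 3 = (- 5 * f 0 + 18 * f 1 - 24 * f 2 + 14 * f 3 - 3 * f 4) / 12"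
    "coeff p 4 = (f 0 - 4 * f 1 + 6 * f 2 - 4 * f 3 + f 4) / 24"
  unfolding f_def poly_degree_4[OF assms(1)] by (simp_all add: eval_nat_numeral field_simps)

section \<open>The ball as a limit of zonotopes\<close>

text \<open>
  The reflection in the hyperplane orthogonal to \<open>d\<close> (the identity for \<open>d = 0\<close>). Reflections suffice to
  move any vector to any other vector of the same length.
\<close>
definition householder :: "'a::real_inner \<Rightarrow> 'a \<Rightarrow> 'a" where
  "householder d u = u - (2 * (u \<bullet> d) / (d \<bullet> d)) *\<^sub>R d"

lemma linear_householder: "linear (householder d)"
  unfolding householder_def
  by (rule linearI) (simp_all add: inner_add_left algebra_simps add_divide_distrib)

lemma inner_householder: "householder d u \<bullet> householder d v = u \<bullet> v"
  by (cases "d = 0") (simp_all add: householder_def inner_diff_left inner_diff_right inner_commute field_simps)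

lemma norm_householder: "norm (householder d u) = norm u"
  by (simp add: norm_eq_sqrt_inner inner_householder)

lemma householder_involutive: "householder d (householder d u) = u"
  by (cases "d = 0") (simp_all add: householder_def inner_diff_left)

lemma householder_swap:
  assumes "norm x = norm y"
  shows "householder (x - y) x = y"
proof (cases "x = y")
  case False
  have "x \<bullet> x = y \<bullet> y" using assms by (simp add: norm_eq)
  then have "2 * (x \<bullet> (x - y)) = (x - y) \<bullet> (x - y)"
    by (simp add: inner_diff_left inner_diff_right inner_commute)
  then show ?thesis using False by (simp add: householder_def)
qed (simp add: householder_def)

text \<open>
  The support function of a body that is a continuous sum of segments: \<open>[-u/2, u/2]\<close> has support function
  \<open>|u \<bullet> x|/2\<close>. By rotation invariance this body is a ball, and Riemann sums of the integral are zonotopes.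
\<close>
definition mean_width_at :: "'a::euclidean_space \<Rightarrow> real" where
  "mean_width_at x = (\<integral>u. indicator (cball 0 1) u * \<bar>u \<bullet> x\<bar> \<partial>lborel)"

lemma integrable_cball_bounded:
  fixes f :: "'a::euclidean_space \<Rightarrow> real"
  assumes [measurable]: "f \<in> borel_measurable borel" "A \<in> sets borel"
    and bound: "\<And>u. u \<in> A \<Longrightarrow> \<bar>f u\<bar> \<le> C" and A: "A \<subseteq> cball 0 1"
  shows "integrable lborel (\<lambda>u. indicator A u * f u)"
proof (rule Bochner_Integration.integrable_bound)
  show "integrable lborel (\<lambda>u. \<bar>C\<bar> * indicator (cball (0::'a) 1) u)"
    by (intro integrable_mult_right integrable_real_indicator) (auto simp: emeasure_cball)
  show "AE u in lborel. norm (indicator A u * f u) \<le> norm (\<bar>C\<bar> * indicator (cball (0::'a) 1) u)"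
    using A bound by (intro AE_I2) (fastforce simp: indicator_def)
qed simp

lemma integrable_mean_width:
  fixes x :: "'a::euclidean_space"
  assumes "A \<in> sets borel" "A \<subseteq> cball 0 1"
  shows "integrable lborel (\<lambda>u. indicator A u * \<bar>u \<bullet> x\<bar>)"
proof (rule integrable_cball_bounded[where C = "norm x"])
  fix u assume "u \<in> A"
  then have "norm u \<le> 1" using assms by auto
  then show "\<bar>\<bar>u \<bullet> x\<bar>\<bar> \<le> norm x"
    using Cauchy_Schwarz_ineq2[of u x] mult_right_mono[of "norm u" 1 "norm x"] by simp
qed (use assms in auto)

lemma mean_width_at_eq:
  fixes x y :: "'a::euclidean_space"
  assumes dim: "DIM('a) = 4" and xy: "norm x = norm y"
  shows "mean_width_at x = mean_width_at y"
proof -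
  have nn: "(\<integral>\<^sup>+u. ennreal (indicator (cball 0 1) u * \<bar>u \<bullet> x\<bar>) \<partial>lborel) = ennreal (mean_width_at x)"
    for x :: 'a
    unfolding mean_width_at_def by (intro nn_integral_eq_integral integrable_mean_width) auto
  have hs: "u \<bullet> householder (x - y) x = householder (x - y) u \<bullet> x" for u
    using inner_householder[of "x - y" u "householder (x - y) x"] by (simp add: householder_involutive)
  have "(\<integral>\<^sup>+u. ennreal (indicator (cball 0 1) u * \<bar>u \<bullet> x\<bar>) \<partial>lborel)
     = ennreal (1 ^ 4) * (\<integral>\<^sup>+u. ennreal (indicator (cball 0 1) (householder (x - y) u) * \<bar>householder (x - y) u \<bullet> x\<bar>) \<partial>lborel)"
  proof (rule nn_integral_similarity)
    show "(\<lambda>u. ennreal (indicator (cball 0 1) u * \<bar>u \<bullet> x\<bar>)) \<in> borel_measurable borel"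
      by (intro measurable_compose[OF _ measurable_ennreal] borel_measurable_times borel_measurable_indicator
         borel_measurable_continuous_onI continuous_intros) auto
  qed (auto simp: linear_householder norm_householder dim)
  also have "\<dots> = (\<integral>\<^sup>+u. ennreal (indicator (cball 0 1) u * \<bar>u \<bullet> y\<bar>) \<partial>lborel)"
    by (simp add: hs[symmetric] householder_swap[OF xy] indicator_def norm_householder)
  finally have "ennreal (mean_width_at x) = ennreal (mean_width_at y)" by (simp only: nn)
  moreover have "mean_width_at z \<ge> 0" for z :: 'a
    unfolding mean_width_at_def by (intro integral_nonneg_AE) auto
  ultimately show ?thesis by (simp add: ennreal_inj)
qed

lemma mean_width_at_scaleR: "mean_width_at (r *\<^sub>R x) = \<bar>r\<bar> * mean_width_at x"
  unfolding mean_width_at_def by (simp add: abs_mult mult.left_commute)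

lemma mean_width_at_linear:
  assumes dim: "DIM('a::euclidean_space) = 4"
  obtains c where "c > 0" "\<And>x::'a. mean_width_at x = c * norm x"
proof -
  obtain e :: 'a where e: "e \<in> Basis" using nonempty_Basis by blast
  \<comment> \<open>A small ball inside the unit ball on which \<open>u \<bullet> e\<close> is bounded below.\<close>
  let ?C = "cball ((3/4) *\<^sub>R e) (1/4) :: 'a set"
  have C: "norm u \<le> 1 \<and> \<bar>u \<bullet> e\<bar> \<ge> 1/2" if "u \<in> ?C" for u
  proof -
    have d: "norm (u - (3/4) *\<^sub>R e) \<le> 1/4" using that by (simp add: dist_norm norm_minus_commute)
    have "norm u \<le> norm ((3/4) *\<^sub>R e) + norm (u - (3/4) *\<^sub>R e)"
      using norm_triangle_ineq[of "(3/4) *\<^sub>R e" "u - (3/4) *\<^sub>R e"] by simp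
    moreover have "\<bar>(u - (3/4) *\<^sub>R e) \<bullet> e\<bar> \<le> norm (u - (3/4) *\<^sub>R e)"
      using Cauchy_Schwarz_ineq2[of "u - (3/4) *\<^sub>R e" e] e by simp
    moreover have "(u - (3/4) *\<^sub>R e) \<bullet> e = u \<bullet> e - 3/4"
      using e by (simp add: inner_diff_left)
    ultimately show ?thesis using d e by simp
  qed
  have "(\<integral>u. 1/2 * indicator ?C u \<partial>lborel) \<le> mean_width_at e"
    unfolding mean_width_at_def
    using C by (intro integral_mono integrable_mean_width integrable_mult_right integrable_real_indicator)
      (auto simp: emeasure_cball indicator_def)
  moreover have "(\<integral>u. 1/2 * indicator ?C u \<partial>lborel) = 1/2 * measure lborel ?C" by simp
  moreover have "measure lborel ?C > 0" by (simp add: content_cball_gt_0_iff)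
  ultimately have pos: "mean_width_at e > 0" by linarith
  have "mean_width_at x = mean_width_at e * norm x" for x :: 'a
    using mean_width_at_eq[OF dim, of x "norm x *\<^sub>R e"] e
    by (simp add: mean_width_at_scaleR mult.commute)
  with pos that show ?thesis by blast
qed

text \<open>
  Cut the ball into finitely many pieces of diameter at most \<open>2d\<close> and replace \<open>u\<close> by a fixed point on each of
  them. As \<open>u \<mapsto> |u \<bullet> x|\<close> is Lipschitz with constant \<open>|x|\<close>, the error is at most \<open>d |x|\<close> times the
  volume of the ball.
\<close>
lemma ball_width_approx:
  assumes dim: "DIM('a::euclidean_space) = 4" and "\<delta> > 0"
  obtains vs :: "'a::euclidean_space list" where
    "\<And>x. \<bar>(\<Sum>v\<leftarrow>vs. \<bar>v \<bullet> x\<bar>) / 2 - norm x\<bar> \<le> \<delta> * norm x"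
proof -
  obtain c where c: "c > 0" "\<And>x::'a. mean_width_at x = c * norm x"
    using mean_width_at_linear[OF dim] by blast
  let ?B = "cball 0 1 :: 'a set"
  define V where "V = measure lborel ?B"
  have V: "V > 0" by (simp add: V_def content_cball_gt_0_iff)
  \<comment> \<open>The final error is \<open>d V |x|\<close>, to be compared with \<open>c \<delta> |x|\<close>.\<close>
  define d where "d = \<delta> * c / V"
  have d: "d > 0" using c V assms by (simp add: d_def)
  obtain T where T: "finite T" "?B \<subseteq> (\<Union>b\<in>T. ball b d)"
    using compact_cball[of "0::'a" 1] d unfolding compact_eq_totally_bounded by metis
  obtain bs where bs: "set bs = T" using finite_list[OF T(1)] by blast
  define n where "n = length bs"
  define A where "A i = ?B \<inter> ball (bs ! i) d - (\<Union>j<i. ball (bs ! j) d)" for i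
  have A_meas [measurable]: "A i \<in> sets borel" for i by (simp add: A_def)
  have A_sub: "A i \<subseteq> ?B" for i by (auto simp: A_def)
  have Adist: "norm (u - bs ! i) \<le> d" if "u \<in> A i" for u i
    using that by (auto simp: A_def dist_norm norm_minus_commute)
  have partition: "indicator ?B u = (\<Sum>i<n. indicator (A i) u :: real)" for u
  proof (cases "u \<in> ?B")
    case False
    then have "u \<notin> A i" for i using A_sub by blast
    with False show ?thesis by simp
  next
    case True
    then obtain b where "b \<in> T" "u \<in> ball b d" using T by blast
    then obtain k where k: "k < n" "u \<in> ball (bs ! k) d"
      using bs by (auto simp: n_def in_set_conv_nth)
    define m where "m = (LEAST k. u \<in> ball (bs ! k) d)"
    have m: "u \<in> ball (bs ! m) d" "m \<le> k" "\<And>j. j < m \<Longrightarrow> u \<notin> ball (bs ! j) d"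
      unfolding m_def using k(2) by (auto intro: LeastI Least_le dest: not_less_Least)
    have "u \<in> A i \<longleftrightarrow> i = m" for i
      using m True by (cases i m rule: linorder_cases) (auto simp: A_def)
    then have "(\<Sum>i<n. indicator (A i) u :: real) = (\<Sum>i<n. if i = m then 1 else 0)"
      by (intro sum.cong) auto
    also have "\<dots> = 1" using m k by simp
    finally show ?thesis using True by simp
  qed
  define w where "w i = measure lborel (A i)" for i
  have w: "w i \<ge> 0" for i by (simp add: w_def)
  have fin: "emeasure lborel (A i) < \<infinity>" for i
    using emeasure_mono[OF A_sub[of i], of lborel] emeasure_cball[of 1 "0::'a"]
    by (auto simp: less_top[symmetric] top_unique)
  have intA: "(\<integral>u. indicator (A i) u * r \<partial>lborel) = w i * r" for i r
    by (simp add: w_def)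
  have intgA: "integrable lborel (\<lambda>u. indicator (A i) u * (r::real))" for i r
    using fin by (intro integrable_mult_left integrable_real_indicator) auto
  have sumw: "(\<Sum>i<n. w i) = V"
  proof -
    have "V = (\<integral>u. indicator ?B u \<partial>lborel)" by (simp add: V_def)
    also have "\<dots> = (\<integral>u. (\<Sum>i<n. indicator (A i) u) \<partial>lborel)" by (simp add: partition)
    also have "\<dots> = (\<Sum>i<n. w i)"
      using intgA[of _ 1] by (subst Bochner_Integration.integral_sum) (auto simp: w_def)
    finally show ?thesis ..
  qed
  define vs where "vs = map (\<lambda>i. (2 * w i / c) *\<^sub>R bs ! i) [0..<n]"
  have "\<bar>(\<Sum>v\<leftarrow>vs. \<bar>v \<bullet> x\<bar>) / 2 - norm x\<bar> \<le> \<delta> * norm x" for x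
  proof -
    have "(\<Sum>v\<leftarrow>vs. \<bar>v \<bullet> x\<bar>) = (\<Sum>i<n. 2 * w i / c * \<bar>bs ! i \<bullet> x\<bar>)"
      using w c by (simp add: vs_def interv_sum_list_conv_sum_set_nat o_def abs_mult lessThan_atLeast0)
    then have 1: "c * ((\<Sum>v\<leftarrow>vs. \<bar>v \<bullet> x\<bar>) / 2) = (\<Sum>i<n. w i * \<bar>bs ! i \<bullet> x\<bar>)"
      using c by (simp add: sum_distrib_left sum_divide_distrib field_simps)
    have 2: "c * norm x = (\<Sum>i<n. \<integral>u. indicator (A i) u * \<bar>u \<bullet> x\<bar> \<partial>lborel)"
      unfolding c(2)[symmetric] mean_width_at_def partition sum_distrib_right
      by (intro Bochner_Integration.integral_sum integrable_mean_width A_meas A_sub)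
    have 3: "\<bar>w i * \<bar>bs ! i \<bullet> x\<bar> - (\<integral>u. indicator (A i) u * \<bar>u \<bullet> x\<bar> \<partial>lborel)\<bar> \<le> w i * (d * norm x)" for i
    proof -
      have "w i * \<bar>bs ! i \<bullet> x\<bar> - (\<integral>u. indicator (A i) u * \<bar>u \<bullet> x\<bar> \<partial>lborel)
         = (\<integral>u. indicator (A i) u * \<bar>bs ! i \<bullet> x\<bar> - indicator (A i) u * \<bar>u \<bullet> x\<bar> \<partial>lborel)"
        unfolding intA[symmetric]
        by (intro Bochner_Integration.integral_diff[symmetric] intgA integrable_mean_width A_meas A_sub)
      also have "\<bar>\<dots>\<bar> \<le> (\<integral>u. indicator (A i) u * (d * norm x) \<partial>lborel)"
      proof (rule integral_abs_bound_integral)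
        show "integrable lborel (\<lambda>u. indicator (A i) u * \<bar>bs ! i \<bullet> x\<bar> - indicator (A i) u * \<bar>u \<bullet> x\<bar>)"
          by (intro Bochner_Integration.integrable_diff intgA integrable_mean_width A_meas A_sub)
        fix u :: 'a
        have "\<bar>\<bar>bs ! i \<bullet> x\<bar> - \<bar>u \<bullet> x\<bar>\<bar> \<le> d * norm x" if u: "u \<in> A i"
        proof -
          have "\<bar>\<bar>bs ! i \<bullet> x\<bar> - \<bar>u \<bullet> x\<bar>\<bar> \<le> \<bar>(u - bs ! i) \<bullet> x\<bar>"
            by (simp add: inner_diff_left) 
          also have "\<dots> \<le> norm (u - bs ! i) * norm x" by (rule Cauchy_Schwarz_ineq2)
          also have "\<dots> \<le> d * norm x" using Adist[OF u] by (intro mult_right_mono) auto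
          finally show ?thesis .
        qed
        then show "\<bar>indicator (A i) u * \<bar>bs ! i \<bullet> x\<bar> - indicator (A i) u * \<bar>u \<bullet> x\<bar>\<bar> \<le> indicator (A i) u * (d * norm x)"
          by (auto simp: indicator_def)
      qed (rule intgA)
      also have "\<dots> = w i * (d * norm x)" by (rule intA)
      finally show ?thesis .
    qed
    have "c * \<bar>(\<Sum>v\<leftarrow>vs. \<bar>v \<bullet> x\<bar>) / 2 - norm x\<bar> = \<bar>c * ((\<Sum>v\<leftarrow>vs. \<bar>v \<bullet> x\<bar>) / 2) - c * norm x\<bar>"
      using c by (simp only: right_diff_distrib[symmetric] abs_mult abs_of_pos)
    also have "\<dots> = \<bar>\<Sum>i<n. w i * \<bar>bs ! i \<bullet> x\<bar> - (\<integral>u. indicator (A i) u * \<bar>u \<bullet> x\<bar> \<partial>lborel)\<bar>"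
      by (simp only: 1 2 sum_subtractf)
    also have "\<dots> \<le> (\<Sum>i<n. \<bar>w i * \<bar>bs ! i \<bullet> x\<bar> - (\<integral>u. indicator (A i) u * \<bar>u \<bullet> x\<bar> \<partial>lborel)\<bar>)"
      by (rule sum_abs)
    also have "\<dots> \<le> (\<Sum>i<n. w i * (d * norm x))" by (intro sum_mono 3)
    also have "\<dots> = V * (d * norm x)" by (simp add: sum_distrib_right[symmetric] sumw)
    also have "\<dots> = c * (\<delta> * norm x)" using V by (simp add: d_def)
    finally show ?thesis using c by simp
  qed
  with that show ?thesis by blast
qed

lemma zonotope_support_le:
  "z \<in> zonotope vs \<Longrightarrow> x \<bullet> z \<le> ((\<Sum>v\<leftarrow>vs. x \<bullet> v) + (\<Sum>v\<leftarrow>vs. \<bar>v \<bullet> x\<bar>)) / 2"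
proof (induction vs arbitrary: z)
  case (Cons v vs)
  then obtain t z' where z: "0 \<le> t" "t \<le> 1" "z' \<in> zonotope vs" "z = t *\<^sub>R v + z'"
    by (auto simp: set_plus_def mem_seg_iff)
  have "t * (x \<bullet> v) \<le> (x \<bullet> v + \<bar>v \<bullet> x\<bar>) / 2"
  proof (cases "x \<bullet> v \<ge> 0")
    case True
    then show ?thesis using z by (simp add: inner_commute mult_left_le_one_le)
  next
    case False
    then show ?thesis using z by (simp add: inner_commute mult_nonneg_nonpos)
  qed
  with Cons.IH[OF z(3)] z show ?case by (simp add: inner_add_right algebra_simps add_divide_distrib)
qed simp

lemma zonotope_support_attained:
  "\<exists>z\<in>zonotope vs. x \<bullet> z = ((\<Sum>v\<leftarrow>vs. x \<bullet> v) + (\<Sum>v\<leftarrow>vs. \<bar>v \<bullet> x\<bar>)) / 2"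
proof (induction vs)
  case (Cons v vs)
  then obtain z where z: "z \<in> zonotope vs" "x \<bullet> z = ((\<Sum>v\<leftarrow>vs. x \<bullet> v) + (\<Sum>v\<leftarrow>vs. \<bar>v \<bullet> x\<bar>)) / 2"
    by blast
  define t where "t = (if x \<bullet> v \<ge> 0 then 1 else 0 :: real)"
  have "t *\<^sub>R v \<in> seg v" unfolding mem_seg_iff by (intro exI[of _ t]) (auto simp: t_def)
  then have "t *\<^sub>R v + z \<in> zonotope (v # vs)" using z by auto
  moreover have "x \<bullet> (t *\<^sub>R v) = (x \<bullet> v + \<bar>v \<bullet> x\<bar>) / 2"
    by (auto simp: t_def inner_commute)
  ultimately show ?case using z
    by (intro bexI[of _ "t *\<^sub>R v + z"]) (simp_all add: inner_add_right algebra_simps add_divide_distrib)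
qed simp

text \<open>
  Closed convex sets are compared through their support functions; centring the zonotope makes its support
  function \<open>x \<mapsto> (\<Sum>v. |v \<bullet> x|) / 2\<close>.
\<close>
lemma ball_zonotope_approx:
  assumes dim: "DIM('a::euclidean_space) = 4" and "\<delta> > 0"
  obtains vs :: "'a::euclidean_space list" and c where
    "cball 0 (1 - \<delta>) \<subseteq> zonotope vs + {c}" "zonotope vs + {c} \<subseteq> cball 0 (1 + \<delta>)"
proof -
  obtain vs :: "'a list" where vs: "\<And>x. \<bar>(\<Sum>v\<leftarrow>vs. \<bar>v \<bullet> x\<bar>) / 2 - norm x\<bar> \<le> \<delta> * norm x"
    using ball_width_approx[OF assms] by metis
  define c where "c = - (1/2) *\<^sub>R sum_list vs"
  have xc: "x \<bullet> c = - (\<Sum>v\<leftarrow>vs. x \<bullet> v) / 2" for x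
    by (simp add: c_def) (induction vs, auto simp: inner_add_right)
  have "zonotope vs + {c} \<subseteq> cball 0 (1 + \<delta>)"
  proof
    fix y assume "y \<in> zonotope vs + {c}"
    then obtain z where z: "z \<in> zonotope vs" "y = z + c" by (auto simp: set_plus_def)
    have "y \<bullet> y = y \<bullet> z + y \<bullet> c" using z(2) by (simp add: inner_add_right[symmetric])
    also have "\<dots> \<le> (\<Sum>v\<leftarrow>vs. \<bar>v \<bullet> y\<bar>) / 2"
      using zonotope_support_le[OF z(1), of y] by (simp add: xc add_divide_distrib)
    also have "\<dots> \<le> (1 + \<delta>) * norm y" using vs[of y] by (simp add: algebra_simps abs_le_iff)
    finally have "norm y * norm y \<le> (1 + \<delta>) * norm y"
      by (simp add: power2_norm_eq_inner[symmetric] power2_eq_square)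
    then show "y \<in> cball 0 (1 + \<delta>)" using assms(2) by (cases "y = 0") auto
  qed
  moreover have "cball 0 (1 - \<delta>) \<subseteq> zonotope vs + {c}"
  proof
    fix p :: 'a assume p: "p \<in> cball 0 (1 - \<delta>)"
    show "p \<in> zonotope vs + {c}"
    proof (rule ccontr)
      assume np: "p \<notin> zonotope vs + {c}"
      have "convex (zonotope vs + {c})" "closed (zonotope vs + {c})"
        by (auto intro!: convex_set_plus compact_imp_closed compact_set_plus)
      from separating_hyperplane_closed_point[OF this np] obtain a b
        where ab: "a \<bullet> p < b" "\<And>z. z \<in> zonotope vs + {c} \<Longrightarrow> a \<bullet> z > b" by blast
      obtain z where z: "z \<in> zonotope vs"
        "(- a) \<bullet> z = ((\<Sum>v\<leftarrow>vs. (- a) \<bullet> v) + (\<Sum>v\<leftarrow>vs. \<bar>v \<bullet> (- a)\<bar>)) / 2"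
        using zonotope_support_attained by blast
      have "(- a) \<bullet> (z + c) = (\<Sum>v\<leftarrow>vs. \<bar>v \<bullet> (- a)\<bar>) / 2"
        unfolding inner_add_right z(2) xc by (simp add: add_divide_distrib)
      moreover have "\<dots> \<ge> (1 - \<delta>) * norm a"
        using vs[of "- a"] by (simp add: algebra_simps abs_le_iff)
      moreover have "a \<bullet> (z + c) > b" using z by (intro ab) auto
      moreover have "- (a \<bullet> p) \<le> norm a * (1 - \<delta>)"
        using Cauchy_Schwarz_ineq2[of a p] p mult_left_mono[of "norm p" "1 - \<delta>" "norm a"] by simp
      ultimately show False using ab(1) by (simp add: mult.commute)
    qed
  qed
  ultimately show ?thesis using that by blast
qed

section \<open>Steiner's formula\<close>

text \<open>
  After a translation \<open>0 \<in> K\<close>, and then \<open>K + l B \<subseteq> l (K + B)\<close>. This replaces any discussion of continuity of the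
  volume.
\<close>
lemma vol_plus_cball_scale:
  fixes K :: "'a::euclidean_space set"
  assumes K: "compact K" "convex K" "K \<noteq> {}" and l: "l \<ge> 1"
  shows "vol (K + cball 0 (l * r)) \<le> l ^ DIM('a) * vol (K + cball 0 r)"
proof -
  obtain k where k: "k \<in> K" using K by blast
  define L where "L = K + {- k}"
  have L: "compact L" "convex L" using K by (auto simp: L_def intro: compact_set_plus convex_set_plus)
  have "k + (- k) \<in> L" using k unfolding L_def by blast
  then have L0: "0 \<in> L" by simp
  have sub: "L + cball 0 (l * r) \<subseteq> (\<lambda>x. l *\<^sub>R x + 0) ` (L + cball 0 r)"
  proof
    fix x assume "x \<in> L + cball 0 (l * r)"
    then obtain a b where ab: "x = a + b" "a \<in> L" "norm b \<le> l * r" by (auto simp: set_plus_def)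
    have "(1 / l) *\<^sub>R a + (1 - 1 / l) *\<^sub>R 0 \<in> L"
      using L L0 ab l by (intro convexD) auto
    moreover have "(1 / l) *\<^sub>R b \<in> cball 0 r" using ab(3) l by (simp add: field_simps)
    ultimately have "(1 / l) *\<^sub>R a + (1 / l) *\<^sub>R b \<in> L + cball 0 r" by auto
    moreover have "x = l *\<^sub>R ((1 / l) *\<^sub>R a + (1 / l) *\<^sub>R b) + 0"
      using l ab(1) by (simp add: scaleR_add_right)
    ultimately show "x \<in> (\<lambda>x. l *\<^sub>R x + 0) ` (L + cball 0 r)" by blast
  qed
  have tr: "vol (L + cball 0 s) = vol (K + cball 0 s)" for s
    using vol_plus_singleton[of "K + cball 0 s" "- k"] by (simp add: L_def ac_simps)
  have "vol (L + cball 0 (l * r)) \<le> vol ((\<lambda>x. l *\<^sub>R x + 0) ` (L + cball 0 r))"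
    using L sub by (intro vol_mono compact_set_plus compact_continuous_image continuous_intros) auto
  also have "\<dots> = l ^ DIM('a) * vol (L + cball 0 r)"
    using l by (subst measure_lebesgue_affine) simp
  finally show ?thesis by (simp only: tr)
qed

lemma image_cball_similarity:
  fixes T :: "'a::euclidean_space \<Rightarrow> 'a"
  assumes T: "linear T" "\<And>x. norm (T x) = r * norm x" "r > 0"
  shows "T ` cball 0 s = cball 0 (r * s)"
proof -
  have "inj T"
  proof (rule injI)
    fix x y assume "T x = T y"
    then have "norm (T (x - y)) = 0" by (simp add: linear_diff[OF T(1)])
    then show "x = y" using T by simp
  qed
  then have surj: "surj T" using T(1) linear_injective_imp_surjective by blast
  show ?thesis
  proof (intro equalityI subsetI)
    fix y :: 'a assume y: "y \<in> cball 0 (r * s)"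
    obtain x where x: "y = T x" using surj by blast
    then have "norm x \<le> s" using y T by simp
    then show "y \<in> T ` cball 0 s" using x by auto
  qed (use T in auto)
qed

lemma linear_image_set_plus:
  assumes "linear T" shows "T ` (A + B) = T ` A + T ` B"
  by (force simp: set_plus_def linear_add[OF assms])

lemma linear_image_zonotope:
  assumes "linear T" shows "T ` zonotope vs = zonotope (map T vs)"
proof (induction vs)
  case (Cons v vs)
  have "T ` seg v = seg (T v)"
    using closed_segment_linear_image[OF assms, of 0 v] linear_0[OF assms] by (simp add: seg_def)
  then show ?case using Cons by (simp add: linear_image_set_plus[OF assms])
qed (simp add: linear_0[OF assms])

text \<open>
  The translation \<open>c\<close> allows the zonotope to keep a vertex at the origin.
\<close>
definition near_ball :: "real \<Rightarrow> 'a::real_normed_vector list \<Rightarrow> bool" where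
  "near_ball \<delta> vs \<longleftrightarrow> (\<exists>c. cball 0 (1 - \<delta>) \<subseteq> zonotope vs + {c} \<and> zonotope vs + {c} \<subseteq> cball 0 (1 + \<delta>))"

lemma zonotope_poly_bounds:
  fixes K :: "'a::euclidean_space set" and T :: "'a \<Rightarrow> 'a"
  assumes K: "compact K" "convex K" "K \<noteq> {}" 
    and T: "linear T" "\<And>x. norm (T x) = r * norm x" "r > 0"
    and vs: "near_ball \<delta> vs" "0 < \<delta>" "\<delta> < 1" and t: "t \<ge> 0"
  shows "(1 - \<delta>) ^ DIM('a) * vol (K + cball 0 (t * r)) \<le> poly (zonotope_poly K (map T vs)) t"
    and "poly (zonotope_poly K (map T vs)) t \<le> (1 + \<delta>) ^ DIM('a) * vol (K + cball 0 (t * r))"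
proof -
  let ?n = "DIM('a)" and ?W = "\<lambda>s. vol (K + cball 0 s)"
  have "(1 - \<delta>) ^ ?n * ?W (t * r) \<le> poly (zonotope_poly K (map T vs)) t \<and>
     poly (zonotope_poly K (map T vs)) t \<le> (1 + \<delta>) ^ ?n * ?W (t * r)"
  proof (cases "t = 0")
    case True
    have "poly (zonotope_poly K (map T vs)) t = ?W (t * r)"
      using True by (simp add: poly_0_coeff_0 coeff_zonotope_poly_0 vol_plus_singleton)
    moreover have "(1 - \<delta>) ^ ?n \<le> 1" "1 \<le> (1 + \<delta>) ^ ?n"
      using vs by (auto intro: power_le_one)
    ultimately show ?thesis using mult_right_mono[of _ 1 "?W (t * r)"] mult_right_mono[of 1 _ "?W (t * r)"] by simp
  next
    case False
    then have t: "t > 0" using t by simp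
    define S where "S x = t *\<^sub>R T x" for x
    have S: "linear S" "\<And>x. norm (S x) = (t * r) * norm x" "t * r > 0"
      using T t by (auto simp: S_def[abs_def] linear_compose_scale_right)
    obtain c where c: "cball 0 (1 - \<delta>) \<subseteq> zonotope vs + {c}" "zonotope vs + {c} \<subseteq> cball 0 (1 + \<delta>)"
      using vs(1) by (auto simp: near_ball_def)
    have "poly (zonotope_poly K (map T vs)) t = vol (K + zonotope (map S vs))"
      using poly_zonotope_poly[OF K(1,2), of t "map T vs"] t by (simp add: S_def[abs_def] o_def)
    also have "\<dots> = vol (K + S ` zonotope vs + {S c})"
      by (simp add: linear_image_zonotope[OF S(1)] vol_plus_singleton)
    also have "K + S ` zonotope vs + {S c} = K + S ` (zonotope vs + {c})"
      by (simp add: linear_image_set_plus[OF S(1)] add.assoc)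
    finally have P: "poly (zonotope_poly K (map T vs)) t = vol (K + S ` (zonotope vs + {c}))" .
    have "compact (S ` (zonotope vs + {c}))"
      by (intro compact_continuous_image linear_continuous_on compact_set_plus)
         (use S in \<open>auto simp: linear_conv_bounded_linear\<close>)
    note cpt = compact_set_plus[OF K(1) this]
    have "S ` (zonotope vs + {c}) \<subseteq> cball 0 (t * r * (1 + \<delta>))"
      using image_mono[OF c(2), of S] image_cball_similarity[OF S] by simp
    then have "vol (K + S ` (zonotope vs + {c})) \<le> ?W (t * r * (1 + \<delta>))"
      by (intro vol_mono[OF cpt compact_set_plus[OF K(1) compact_cball]] set_plus_mono2 order_refl)
    also have "\<dots> \<le> (1 + \<delta>) ^ ?n * ?W (t * r)"
      using vol_plus_cball_scale[OF K, of "1 + \<delta>" "t * r"] vs by (simp add: mult.commute)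
    finally have up: "poly (zonotope_poly K (map T vs)) t \<le> (1 + \<delta>) ^ ?n * ?W (t * r)" by (simp only: P)
    have "cball 0 (t * r * (1 - \<delta>)) \<subseteq> S ` (zonotope vs + {c})"
      using image_mono[OF c(1), of S] image_cball_similarity[OF S] by simp
    then have lo: "?W (t * r * (1 - \<delta>)) \<le> vol (K + S ` (zonotope vs + {c}))"
      by (intro vol_mono[OF compact_set_plus[OF K(1) compact_cball] cpt] set_plus_mono2 order_refl)
    have "?W (t * r) \<le> (1 / (1 - \<delta>)) ^ ?n * ?W (t * r * (1 - \<delta>))"
      using vol_plus_cball_scale[OF K, of "1 / (1 - \<delta>)" "t * r * (1 - \<delta>)"] vs by simp
    then have "(1 - \<delta>) ^ ?n * ?W (t * r) \<le> ?W (t * r * (1 - \<delta>))"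
      using vs by (simp add: power_divide field_simps)
    from order_trans[OF this lo] up show ?thesis unfolding P by (rule conjI)
  qed
  then show "(1 - \<delta>) ^ ?n * ?W (t * r) \<le> poly (zonotope_poly K (map T vs)) t"
    "poly (zonotope_poly K (map T vs)) t \<le> (1 + \<delta>) ^ ?n * ?W (t * r)" by blast+
qed

abbreviation ball_err :: "nat \<Rightarrow> real" where "ball_err n \<equiv> 1 / (real n + 2)"

lemma exists_ball_zonotopes:
  assumes "DIM('a::euclidean_space) = 4"
  obtains vs :: "nat \<Rightarrow> 'a::euclidean_space list" where "\<And>n. near_ball (ball_err n) (vs n)"
proof -
  have "\<exists>vs :: 'a list. near_ball (ball_err n) vs" for n
    using ball_zonotope_approx[OF assms, of "ball_err n"] unfolding near_ball_def
    by (metis add_nonneg_pos divide_pos_pos of_nat_0_le_iff zero_less_numeral zero_less_one)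
  then show ?thesis using that by metis
qed

lemma tendsto_zonotope_poly:
  fixes K :: "'a::euclidean_space set" and T :: "'a \<Rightarrow> 'a"
  assumes K: "compact K" "convex K" "K \<noteq> {}" 
    and T: "linear T" "\<And>x. norm (T x) = r * norm x" "r > 0"
    and vs: "\<And>n. near_ball (ball_err n) (vs n)" and t: "t \<ge> 0"
  shows "(\<lambda>n. poly (zonotope_poly K (map T (vs n))) t) \<longlonglongrightarrow> vol (K + cball 0 (t * r))"
proof -
  let ?W = "vol (K + cball 0 (t * r))" and ?d = "DIM('a)"
  have "(\<lambda>n. ball_err n) \<longlonglongrightarrow> 0"
    using LIMSEQ_ignore_initial_segment[OF lim_1_over_n[where 'a=real], of 2] by (simp add: add.commute)
  then have "(\<lambda>n. (1 - ball_err n) ^ ?d * ?W) \<longlonglongrightarrow> (1 - 0) ^ ?d * ?W"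
    "(\<lambda>n. (1 + ball_err n) ^ ?d * ?W) \<longlonglongrightarrow> (1 + 0) ^ ?d * ?W"
    by (intro tendsto_intros; assumption)+
  then have lims: "(\<lambda>n. (1 - ball_err n) ^ ?d * ?W) \<longlonglongrightarrow> ?W" "(\<lambda>n. (1 + ball_err n) ^ ?d * ?W) \<longlonglongrightarrow> ?W"
    by simp_all
  have err: "0 < ball_err n" "ball_err n < 1" for n by auto
  show ?thesis
    by (rule tendsto_sandwich[OF _ _ lims]; intro always_eventually allI;
        rule zonotope_poly_bounds[OF K T vs err t])
qed

text \<open>
  The polynomials attached to zonotopes near the ball converge pointwise, hence coefficientwise.
\<close>
lemma steiner_polynomial:
  fixes K :: "'a::euclidean_space set"
  assumes dim: "DIM('a) = 4" and K: "compact K" "convex K" "K \<noteq> {}"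
  obtains p where "degree p \<le> 4" "\<And>t. t \<ge> 0 \<Longrightarrow> vol (K + cball 0 t) = poly p t"
proof -
  obtain vs :: "nat \<Rightarrow> 'a list" where vs: "\<And>n. near_ball (ball_err n) (vs n)"
    using exists_ball_zonotopes[OF dim] by metis
  define P where "P n = zonotope_poly K (vs n)" for n
  have deg: "degree (P n) \<le> 4" for n
    using degree_zonotope_poly[OF K(1,2), of "vs n"] by (simp add: P_def dim)
  have lim: "(\<lambda>n. poly (P n) t) \<longlonglongrightarrow> vol (K + cball 0 t)" if "t \<ge> 0" for t
    using tendsto_zonotope_poly[OF K linear_ident _ _ vs that, of 1] by (simp add: P_def)
  define W where "W t = vol (K + cball 0 t)" for t
  note lim' = lim[folded W_def]
  define c where "c k = lim (\<lambda>n. coeff (P n) k)" for k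
  have c0: "(\<lambda>n. coeff (P n) 0) \<longlonglongrightarrow> W 0"
    unfolding coeff_interpolation_4[OF deg] by (intro tendsto_intros lim') auto
  have c1: "(\<lambda>n. coeff (P n) 1) \<longlonglongrightarrow> (- 25 * W 0 + 48 * W 1 - 36 * W 2 + 16 * W 3 - 3 * W 4) / 12"
    unfolding coeff_interpolation_4[OF deg] by (intro tendsto_intros lim') auto
  have c2: "(\<lambda>n. coeff (P n) 2) \<longlonglongrightarrow> (35 * W 0 - 104 * W 1 + 114 * W 2 - 56 * W 3 + 11 * W 4) / 24"
    unfolding coeff_interpolation_4[OF deg] by (intro tendsto_intros lim') auto
  have c3: "(\<lambda>n. coeff (P n) 3) \<longlonglongrightarrow> (- 5 * W 0 + 18 * W 1 - 24 * W 2 + 14 * W 3 - 3 * W 4) / 12"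
    unfolding coeff_interpolation_4[OF deg] by (intro tendsto_intros lim') auto
  have c4: "(\<lambda>n. coeff (P n) 4) \<longlonglongrightarrow> (W 0 - 4 * W 1 + 6 * W 2 - 4 * W 3 + W 4) / 24"
    unfolding coeff_interpolation_4[OF deg] by (intro tendsto_intros lim') auto
  have conv: "(\<lambda>n. coeff (P n) k) \<longlonglongrightarrow> c k" if "k \<in> {0,1,2,3,4}" for k
    unfolding c_def convergent_LIMSEQ_iff[symmetric]
    using that c0 c1 c2 c3 c4 by (auto intro: convergentI)
  define p where "p = [:c 0, c 1, c 2, c 3, c 4:]"
  have "vol (K + cball 0 t) = poly p t" if "t \<ge> 0" for t
  proof (rule LIMSEQ_unique[OF lim[OF that]])
    have "(\<lambda>n. poly (P n) t) \<longlonglongrightarrow> c 0 + c 1 * t + c 2 * t^2 + c 3 * t^3 + c 4 * t^4"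
      unfolding poly_degree_4[OF deg] by (intro tendsto_intros conv) auto
    then show "(\<lambda>n. poly (P n) t) \<longlonglongrightarrow> poly p t"
      by (simp add: p_def algebra_simps eval_nat_numeral)
  qed
  moreover have "degree p \<le> 4" by (auto simp: p_def)
  ultimately show ?thesis using that by blast
qed

text \<open>
  The image of a zonotope near the unit ball under a similarity of ratio \<open>r\<close> is near the ball of radius \<open>r\<close>, which
  turns Steiner's polynomial \<open>p(t)\<close> into \<open>p(tr)\<close>.
\<close>
lemma tendsto_sum_pairs_mixed_diff:
  fixes K :: "'a::euclidean_space set" and T :: "'a \<Rightarrow> 'a"
  assumes dim: "DIM('a) = 4" and K: "compact K" "convex K" "K \<noteq> {}"
    and T: "linear T" "\<And>x. norm (T x) = r * norm x" "r > 0"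
    and vs: "\<And>n. near_ball (ball_err n) (vs n)"
    and p: "degree p \<le> 4" "\<And>t. t \<ge> 0 \<Longrightarrow> vol (K + cball 0 t) = poly p t"
  shows "(\<lambda>n. sum_pairs (mixed_diff K) (map T (vs n))) \<longlonglongrightarrow> coeff p 2 * r^2"
proof -
  define P where "P n = zonotope_poly K (map T (vs n))" for n
  have deg: "degree (P n) \<le> 4" for n
    using degree_zonotope_poly[OF K(1,2), of "map T (vs n)"] by (simp add: P_def dim)
  have lim: "(\<lambda>n. poly (P n) t) \<longlonglongrightarrow> poly p (t * r)" if "t \<ge> 0" for t
    using tendsto_zonotope_poly[OF K T vs that] p(2)[of "t * r"] that T(3) by (simp add: P_def)
  have "(\<lambda>n. coeff (P n) 2) \<longlonglongrightarrow> (35 * poly p (0 * r) - 104 * poly p (1 * r) + 114 * poly p (2 * r)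
     - 56 * poly p (3 * r) + 11 * poly p (4 * r)) / 24"
    unfolding coeff_interpolation_4[OF deg] by (intro tendsto_intros lim) auto
  also have "(35 * poly p (0 * r) - 104 * poly p (1 * r) + 114 * poly p (2 * r)
     - 56 * poly p (3 * r) + 11 * poly p (4 * r)) / 24 = coeff p 2 * r^2"
    unfolding poly_degree_4[OF p(1)] by (simp add: power_mult_distrib field_simps eval_nat_numeral)
  finally show ?thesis by (simp add: P_def coeff_zonotope_poly_2)
qed

text \<open>
  A bound independent of \<open>T\<close>, for dominated convergence when \<open>T\<close> is averaged out. The constant is the sum of the
  moduli of the interpolation weights, \<open>320/24\<close>, times \<open>16\<close>, increased to \<open>320\<close> for simplicity.
\<close>
lemma sum_pairs_mixed_diff_bound:
  fixes K :: "'a::euclidean_space set" and T :: "'a \<Rightarrow> 'a"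
  assumes dim: "DIM('a) = 4" and K: "compact K" "convex K" "K \<noteq> {}"
    and T: "linear T" "\<And>x. norm (T x) = r * norm x" "r > 0" "r \<le> 1"
    and vs: "near_ball (ball_err n) vs"
  shows "\<bar>sum_pairs (mixed_diff K) (map T vs)\<bar> \<le> 320 * vol (K + cball 0 4)"
proof -
  define P where "P = zonotope_poly K (map T vs)"
  have deg: "degree P \<le> 4"
    using degree_zonotope_poly[OF K(1,2), of "map T vs"] by (simp add: P_def dim)
  define W where "W = vol (K + cball 0 4)"
  have W: "W \<ge> 0" by (simp add: W_def)
  have b: "0 \<le> poly P t \<and> poly P t \<le> 16 * W" if t: "0 \<le> t" "t \<le> 4" for t
  proof -
    have "poly P t \<le> (1 + ball_err n) ^ 4 * vol (K + cball 0 (t * r))"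
      using zonotope_poly_bounds(2)[OF K T(1-3) vs _ _ t(1)] by (simp add: P_def dim)
    also have "\<dots> \<le> 2 ^ 4 * W"
    proof (rule mult_mono)
      show "(1 + ball_err n) ^ 4 \<le> 2 ^ 4" by (intro power_mono) (auto simp: field_simps)
      have "t * r \<le> 4 * 1" using t T by (intro mult_mono) auto
      then have "cball 0 (t * r) \<subseteq> cball (0::'a) 4" by (intro subset_cball) auto
      then show "vol (K + cball 0 (t * r)) \<le> W"
        unfolding W_def using K by (intro vol_mono compact_set_plus set_plus_mono2) auto
    qed auto
    finally show ?thesis using t K by (simp add: P_def poly_zonotope_poly)
  qed
  show ?thesis
    using b[of 0] b[of 1] b[of 2] b[of 3] b[of 4] coeff_interpolation_4(3)[OF deg]
    unfolding coeff_zonotope_poly_2[symmetric] W_def[symmetric] P_def[symmetric]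
    by (simp add: abs_le_iff)
qed

text \<open>
  Steiner's polynomial has degree at most four, so its coefficients are determined by its values; here
  \<open>vol\<^sub>2(D\<^sub>2) = \<pi>\<close>.
\<close>
lemma intrinsic_volumes_2:
  fixes K :: "'a::euclidean_space set"
  assumes dim: "DIM('a) = 4"
    and p: "degree p \<le> 4" "\<And>t. t \<ge> 0 \<Longrightarrow> vol (K + cball 0 t) = poly p t"
  shows "intrinsic_volumes K 2 = coeff p 2 / pi"
proof -
  define k where "k i = unit_ball_vol (real (4 - i))" for i :: nat
  have k: "k i > 0" for i by (simp add: k_def)
  have set_eq: "{x + \<epsilon> *\<^sub>R y |x y. x \<in> K \<and> y \<in> cball 0 1} = K + cball 0 \<epsilon>" if e: "\<epsilon> \<ge> 0" for \<epsilon>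
  proof -
    have "cball 0 \<epsilon> = (*\<^sub>R) \<epsilon> ` (cball 0 1 :: 'a set)"
    proof (cases "\<epsilon> = 0")
      case False
      then show ?thesis using image_cball_similarity[of "(*\<^sub>R) \<epsilon> :: 'a \<Rightarrow> 'a" \<epsilon> 1] e
        by (simp add: linear_scale_self)
    qed (auto intro: image_eqI[of _ _ 0])
    then show ?thesis by (auto simp: set_plus_def simp del: mem_cball mem_cball_0)
  qed
  define Q where "Q V \<longleftrightarrow> (\<forall>i>4. V i = 0) \<and> (\<forall>\<epsilon>\<ge>0. poly p \<epsilon> = (\<Sum>i\<le>4. \<epsilon> ^ (4 - i) * k i * V i))"
    for V :: "nat \<Rightarrow> real"
  have "intrinsic_volumes K = (THE V. Q V)"
    unfolding intrinsic_volumes_def Q_def dim k_def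
    by (intro arg_cong[of _ _ The] ext conj_cong refl all_cong1 imp_cong) (simp only: set_eq p(2))
  moreover have "(THE V. Q V) = (\<lambda>i. if i \<le> 4 then coeff p (4 - i) / k i else 0)" (is "_ = ?V")
  proof (rule the_equality)
    show "Q ?V" unfolding Q_def poly_degree_4[OF p(1)]
      using k by (auto simp: eval_nat_numeral less_imp_neq[THEN not_sym])
  next
    fix V assume V: "Q V"
    define q where "q = (\<Sum>i\<le>4. monom (k i * V i) (4 - i))"
    have q: "poly q e = poly p e" if "e \<ge> 0" for e
      using V that by (simp add: q_def Q_def poly_sum poly_monom mult_ac)
    have qd: "degree q \<le> 4" unfolding q_def
      by (intro degree_sum_le order.trans[OF degree_monom_le]) auto
    have e0: "coeff q 0 = coeff p 0"
      unfolding coeff_interpolation_4(1)[OF p(1)] coeff_interpolation_4(1)[OF qd] by (simp add: q)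
    have e1: "coeff q 1 = coeff p 1"
      unfolding coeff_interpolation_4(2)[OF p(1)] coeff_interpolation_4(2)[OF qd] by (simp add: q)
    have e2: "coeff q 2 = coeff p 2"
      unfolding coeff_interpolation_4(3)[OF p(1)] coeff_interpolation_4(3)[OF qd] by (simp add: q)
    have e3: "coeff q 3 = coeff p 3"
      unfolding coeff_interpolation_4(4)[OF p(1)] coeff_interpolation_4(4)[OF qd] by (simp add: q)
    have e4: "coeff q 4 = coeff p 4"
      unfolding coeff_interpolation_4(5)[OF p(1)] coeff_interpolation_4(5)[OF qd] by (simp add: q)
    have qc: "coeff q (4 - i) = k i * V i" if "i \<le> 4" for i
    proof -
      have "coeff q (4 - i) = (\<Sum>j\<le>4. if j = i then k i * V i else 0)"
        unfolding q_def coeff_sum coeff_monom using that by (intro sum.cong) auto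
      then show ?thesis using that by simp
    qed
    have "k i * V i = coeff p (4 - i)" if "i \<le> 4" for i
    proof -
      have "i \<in> {0,1,2,3,4}" using that by auto
      then show ?thesis using qc[of i] e0 e1 e2 e3 e4 by auto
    qed
    then show "V = ?V" using V k by (auto simp: Q_def fun_eq_iff field_simps less_imp_neq[THEN not_sym])
  qed
  ultimately show ?thesis by (simp add: k_def unit_ball_vol_2)
qed

section \<open>Areas of convex polygons as Hessian integrals\<close>

text \<open>
  The weights of the Gibbs distribution on the points \<open>q\<^sub>i\<close>. Its mean is the gradient, and its covariance is the
  Hessian, of \<open>x \<mapsto> ln (\<Sum>i. exp (q\<^sub>i \<bullet> x))\<close>.
\<close>
definition gibbs :: "'i set \<Rightarrow> ('i \<Rightarrow> 'a::real_inner) \<Rightarrow> 'a \<Rightarrow> 'i \<Rightarrow> real" where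
  "gibbs S q x i = exp (q i \<bullet> x) / (\<Sum>j\<in>S. exp (q j \<bullet> x))"

definition gibbs_mean :: "'i set \<Rightarrow> ('i \<Rightarrow> 'a::real_inner) \<Rightarrow> 'a \<Rightarrow> 'a" where
  "gibbs_mean S q x = (\<Sum>i\<in>S. gibbs S q x i *\<^sub>R q i)"

definition gibbs_cov :: "'i set \<Rightarrow> ('i \<Rightarrow> 'a::real_inner) \<Rightarrow> 'a \<Rightarrow> 'a \<Rightarrow> 'a \<Rightarrow> real" where
  "gibbs_cov S q x v w = (\<Sum>i\<in>S. gibbs S q x i * ((q i - gibbs_mean S q x) \<bullet> v) * ((q i - gibbs_mean S q x) \<bullet> w))"

lemma gibbs_partition_pos: "finite S \<Longrightarrow> S \<noteq> {} \<Longrightarrow> (\<Sum>j\<in>S. exp (q j \<bullet> x)) > (0::real)"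
  by (intro sum_pos) auto

lemma gibbs_pos: "finite S \<Longrightarrow> S \<noteq> {} \<Longrightarrow> gibbs S q x i > 0"
  by (simp add: gibbs_def gibbs_partition_pos)

lemma sum_gibbs: "finite S \<Longrightarrow> S \<noteq> {} \<Longrightarrow> (\<Sum>i\<in>S. gibbs S q x i) = 1"
  using gibbs_partition_pos[of S q x] by (simp add: gibbs_def sum_divide_distrib[symmetric])

lemma gibbs_mean_inner: "gibbs_mean S q x \<bullet> v = (\<Sum>i\<in>S. gibbs S q x i * (q i \<bullet> v))"
  by (simp add: gibbs_mean_def inner_sum_left)

lemma gibbs_cov_eq:
  assumes "finite S" "S \<noteq> {}"
  shows "gibbs_cov S q x v w = (\<Sum>i\<in>S. gibbs S q x i * (q i \<bullet> v - gibbs_mean S q x \<bullet> v) * (q i \<bullet> w))"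
proof -
  let ?m = "gibbs_mean S q x"
  have "(\<Sum>i\<in>S. gibbs S q x i * (q i \<bullet> v - ?m \<bullet> v) * (?m \<bullet> w))
      = ((\<Sum>i\<in>S. gibbs S q x i * (q i \<bullet> v)) - (\<Sum>i\<in>S. gibbs S q x i) * (?m \<bullet> v)) * (?m \<bullet> w)"
    by (simp add: sum_distrib_right right_diff_distrib left_diff_distrib sum_subtractf)
  also have "\<dots> = 0" by (simp add: sum_gibbs[OF assms] gibbs_mean_inner)
  finally have z: "(\<Sum>i\<in>S. gibbs S q x i * (q i \<bullet> v - ?m \<bullet> v) * (?m \<bullet> w)) = 0" .
  have "gibbs_cov S q x v w = (\<Sum>i\<in>S. gibbs S q x i * (q i \<bullet> v - ?m \<bullet> v) * (q i \<bullet> w))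
      - (\<Sum>i\<in>S. gibbs S q x i * (q i \<bullet> v - ?m \<bullet> v) * (?m \<bullet> w))"
    unfolding gibbs_cov_def by (simp add: inner_diff_left right_diff_distrib sum_subtractf)
  with z show ?thesis by simp
qed

lemma has_derivative_gibbs:
  fixes q :: "'i \<Rightarrow> 'a::real_inner"
  assumes "finite S" "S \<noteq> {}"
  shows "((\<lambda>x. gibbs S q x i) has_derivative
     (\<lambda>v. gibbs S q x i * (q i \<bullet> v - gibbs_mean S q x \<bullet> v))) (at x)"
proof -
  let ?Z = "\<Sum>j\<in>S. exp (q j \<bullet> x)"
  have Z: "?Z > 0" by (rule gibbs_partition_pos[OF assms])
  have mean: "gibbs_mean S q x \<bullet> v = (\<Sum>j\<in>S. exp (q j \<bullet> x) * (q j \<bullet> v)) / ?Z" for v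
    by (simp add: gibbs_mean_inner gibbs_def sum_divide_distrib)
  have e: "((\<lambda>x. exp (q k \<bullet> x)) has_derivative (\<lambda>v. exp (q k \<bullet> x) * (q k \<bullet> v))) (at x)" for k
    by (auto intro!: derivative_eq_intros)
  have "((\<lambda>x. exp (q i \<bullet> x) / (\<Sum>j\<in>S. exp (q j \<bullet> x))) has_derivative
     (\<lambda>v. (exp (q i \<bullet> x) * (q i \<bullet> v) * ?Z - exp (q i \<bullet> x) * (\<Sum>j\<in>S. exp (q j \<bullet> x) * (q j \<bullet> v))) / (?Z * ?Z))) (at x)"
    using Z by (intro has_derivative_divide' has_derivative_sum e) auto
  also have "(\<lambda>v. (exp (q i \<bullet> x) * (q i \<bullet> v) * ?Z - exp (q i \<bullet> x) * (\<Sum>j\<in>S. exp (q j \<bullet> x) * (q j \<bullet> v))) / (?Z * ?Z))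
     = (\<lambda>v. gibbs S q x i * (q i \<bullet> v - gibbs_mean S q x \<bullet> v))"
    unfolding mean using Z by (intro ext) (simp add: gibbs_def field_simps)
  finally show ?thesis by (simp add: gibbs_def[abs_def])
qed

lemma has_derivative_gibbs_mean:
  fixes q :: "'i \<Rightarrow> 'a::real_inner"
  assumes "finite S" "S \<noteq> {}"
  shows "(gibbs_mean S q has_derivative
     (\<lambda>v. \<Sum>i\<in>S. (gibbs S q x i * (q i \<bullet> v - gibbs_mean S q x \<bullet> v)) *\<^sub>R q i)) (at x)"
  unfolding gibbs_mean_def[of S q, abs_def]
  by (intro has_derivative_sum bounded_linear.has_derivative[OF bounded_linear_scaleR_left]
        has_derivative_gibbs[OF assms, unfolded gibbs_mean_def])

lemma gibbs_cov_nonneg: "finite S \<Longrightarrow> S \<noteq> {} \<Longrightarrow> gibbs_cov S q x v v \<ge> 0"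
  unfolding gibbs_cov_def
  by (intro sum_nonneg) (metis gibbs_pos less_imp_le mult.assoc mult_nonneg_nonneg zero_le_square)

lemma gibbs_cov_pos_imp:
  assumes "finite S" "S \<noteq> {}" "gibbs_cov S q x v v = 0" "i \<in> S"
  shows "q i \<bullet> v = gibbs_mean S q x \<bullet> v"
proof -
  have nn: "gibbs S q x j * (((q j - gibbs_mean S q x) \<bullet> v) * ((q j - gibbs_mean S q x) \<bullet> v)) \<ge> 0" for j
    by (intro mult_nonneg_nonneg less_imp_le[OF gibbs_pos[OF assms(1,2)]] zero_le_square)
  have "gibbs S q x i * ((q i - gibbs_mean S q x) \<bullet> v) * ((q i - gibbs_mean S q x) \<bullet> v) = 0"
    using assms(3,4) unfolding gibbs_cov_def
    by (subst (asm) sum_nonneg_eq_0_iff)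
       (use assms(1,2) nn in \<open>auto simp: mult.assoc\<close>)
  then show ?thesis using gibbs_pos[OF assms(1,2), of q x i] by (simp add: inner_diff_left)
qed

lemma gibbs_cov_bilinear:
  "gibbs_cov S q x (v + v') w = gibbs_cov S q x v w + gibbs_cov S q x v' w"
  "gibbs_cov S q x (c *\<^sub>R v) w = c * gibbs_cov S q x v w"
  "gibbs_cov S q x v w = gibbs_cov S q x w v"
    apply (simp add: gibbs_cov_def inner_add_right distrib_left distrib_right sum.distrib)
   apply (simp add: gibbs_cov_def sum_distrib_left mult_ac)
  apply (simp add: gibbs_cov_def mult_ac)
  done

lemma gibbs_cov_Cauchy_Schwarz:
  assumes "finite S" "S \<noteq> {}"
  shows "(gibbs_cov S q x v w)\<^sup>2 \<le> gibbs_cov S q x v v * gibbs_cov S q x w w"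
proof -
  let ?f = "\<lambda>v i. sqrt (gibbs S q x i) * ((q i - gibbs_mean S q x) \<bullet> v)"
  have g: "sqrt (gibbs S q x i) * sqrt (gibbs S q x i) = gibbs S q x i" for i
    using gibbs_pos[OF assms, of q x i] by simp
  have eq: "gibbs_cov S q x v w = (\<Sum>i\<in>S. ?f v i * ?f w i)" for v w
    unfolding gibbs_cov_def by (intro sum.cong refl) (subst g[symmetric], simp add: mult_ac)
  show ?thesis
    using Cauchy_Schwarz_ineq_sum[of "?f v" "?f w" S] unfolding eq by (simp add: power2_eq_square)
qed

text \<open>
  Minimise \<open>H(x) = \<Sum>i. exp ((q\<^sub>i - p) \<bullet> x)\<close>. Since \<open>p\<close> is an interior point, for each direction some \<open>q\<^sub>i\<close> lies
  strictly beyond \<open>p\<close>, so \<open>H\<close> grows exponentially and attains its minimum; there the gradient vanishes, which says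
  that the mean is \<open>p\<close>.
\<close>
lemma gibbs_mean_surj_interior:
  fixes q :: "'i \<Rightarrow> 'a::euclidean_space"
  assumes S: "finite S" "S \<noteq> {}" and p: "p \<in> interior (convex hull (q ` S))"
  shows "p \<in> range (gibbs_mean S q)"
proof -
  obtain d where d: "d > 0" "cball p d \<subseteq> convex hull (q ` S)"
    using p mem_interior_cball by blast
  define H where "H x = (\<Sum>i\<in>S. exp ((q i - p) \<bullet> x))" for x
  have coer: "exp (d * norm x) \<le> H x" for x
  proof -
    have "\<exists>i\<in>S. (q i - p) \<bullet> x \<ge> d * norm x"
    proof (rule ccontr)
      assume "\<not> (\<exists>i\<in>S. (q i - p) \<bullet> x \<ge> d * norm x)"
      then have lt: "(q i - p) \<bullet> x < d * norm x" if "i \<in> S" for i using that by force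
      have "q ` S \<subseteq> {z. x \<bullet> z < d * norm x + x \<bullet> p}"
        using lt by (auto simp: inner_diff_left inner_commute algebra_simps)
      then have sub: "convex hull (q ` S) \<subseteq> {z. x \<bullet> z < d * norm x + x \<bullet> p}"
        by (intro hull_minimal convex_halfspace_lt)
      have "p + d *\<^sub>R sgn x \<in> cball p d" using d by (simp add: dist_norm norm_sgn)
      then have "x \<bullet> (p + d *\<^sub>R sgn x) < d * norm x + x \<bullet> p" using d sub by blast
      moreover have "x \<bullet> (d *\<^sub>R sgn x) = d * norm x"
        by (cases "x = 0") (simp_all add: sgn_div_norm power2_norm_eq_inner[symmetric] power2_eq_square field_simps)
      ultimately show False using d(1) by (simp add: inner_add_right)
    qed
    then obtain i where i: "i \<in> S" "(q i - p) \<bullet> x \<ge> d * norm x" by blast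
    have "exp (d * norm x) \<le> exp ((q i - p) \<bullet> x)" using i by simp
    also have "\<dots> \<le> H x" unfolding H_def using i S by (intro member_le_sum) auto
    finally show ?thesis .
  qed
  define R where "R = ln (real (card S)) / d"
  have cardS: "card S \<ge> 1" using S by (simp add: Suc_leI card_gt_0_iff)
  have R: "R \<ge> 0" using d cardS by (simp add: R_def)
  have "continuous_on (cball 0 R) H"
    unfolding H_def by (intro continuous_intros)
  then obtain x where x: "x \<in> cball 0 R" "\<And>y. y \<in> cball 0 R \<Longrightarrow> H x \<le> H y"
    using continuous_attains_inf[of "cball 0 R" H] R by (metis cball_eq_empty compact_cball not_less)
  have min: "H x \<le> H y" for y
  proof (cases "y \<in> cball 0 R")
    case False
    then have "norm y > ln (real (card S)) / d" by (simp add: R_def)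
    then have "d * norm y > ln (real (card S))" using d by (simp add: field_simps)
    then have "exp (d * norm y) \<ge> real (card S)"
      using cardS by (metis exp_le_cancel_iff exp_ln less_imp_le of_nat_0_less_iff zero_less_one order_less_le_trans)
    moreover have "H 0 = real (card S)" by (simp add: H_def)
    moreover have "H x \<le> H 0" using R by (intro x) auto
    ultimately show ?thesis using coer[of y] by linarith
  qed (rule x)
  have derH: "(H has_derivative (\<lambda>v. \<Sum>i\<in>S. exp ((q i - p) \<bullet> x) * ((q i - p) \<bullet> v))) (at x)"
    unfolding H_def[abs_def] by (auto intro!: derivative_eq_intros simp: mult.commute)
  have "(\<lambda>v. \<Sum>i\<in>S. exp ((q i - p) \<bullet> x) * ((q i - p) \<bullet> v)) = (\<lambda>v. 0)"
    by (rule differential_zero_maxmin[OF UNIV_I open_UNIV derH]) (use min in auto)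
  then have zero: "(\<Sum>i\<in>S. exp ((q i - p) \<bullet> x) * ((q i - p) \<bullet> v)) = 0" for v by metis
  have "gibbs_mean S q x \<bullet> v = p \<bullet> v" for v
  proof -
    have eq: "gibbs S q x i * ((q i - p) \<bullet> v) = (exp ((q i - p) \<bullet> x) * ((q i - p) \<bullet> v)) * (exp (p \<bullet> x) / (\<Sum>j\<in>S. exp (q j \<bullet> x)))" for i
      by (simp add: gibbs_def inner_diff_left exp_diff)
    have "(\<Sum>i\<in>S. gibbs S q x i * ((q i - p) \<bullet> v)) = 0"
      unfolding eq sum_distrib_right[symmetric] zero by simp
    then have "(\<Sum>i\<in>S. gibbs S q x i * (q i \<bullet> v)) = (\<Sum>i\<in>S. gibbs S q x i) * (p \<bullet> v)"
      by (simp add: inner_diff_left right_diff_distrib sum_subtractf sum_distrib_right)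
    then show ?thesis by (simp add: gibbs_mean_inner sum_gibbs[OF S])
  qed
  then have "gibbs_mean S q x = p" by (metis vector_eq_rdot)
  then show ?thesis by blast
qed

lemma gibbs_mean_in_hull:
  assumes "finite S" "S \<noteq> {}"
  shows "gibbs_mean S q x \<in> convex hull (q ` S)"
  unfolding gibbs_mean_def
  by (intro convex_sum) (use assms in \<open>auto simp: sum_gibbs hull_inc intro: less_imp_le[OF gibbs_pos]\<close>)

text \<open>
  Along a segment with direction \<open>d\<close> the derivative of \<open>mean \<bullet> d\<close> is the variance of \<open>q\<^sub>i \<bullet> d\<close>, which is positive
  unless all \<open>q\<^sub>i\<close> lie in one hyperplane.
\<close>
lemma gibbs_mean_inj:
  fixes q :: "'i \<Rightarrow> 'a::euclidean_space"
  assumes S: "finite S" "S \<noteq> {}" and int: "interior (convex hull (q ` S)) \<noteq> {}"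
  shows "inj (gibbs_mean S q)"
proof (rule injI, rule ccontr)
  fix x y assume eq: "gibbs_mean S q x = gibbs_mean S q y" and ne: "x \<noteq> y"
  define d where "d = y - x"
  have d: "d \<noteq> 0" using ne by (simp add: d_def)
  have pos: "gibbs_cov S q z d d > 0" for z
  proof (rule ccontr)
    assume "\<not> ?thesis"
    then have "gibbs_cov S q z d d = 0" using gibbs_cov_nonneg[OF S, of q z d] by linarith
    then have "q ` S \<subseteq> {u. d \<bullet> u = gibbs_mean S q z \<bullet> d}"
      using gibbs_cov_pos_imp[OF S] by (auto simp: inner_commute)
    then have "convex hull (q ` S) \<subseteq> {u. d \<bullet> u = gibbs_mean S q z \<bullet> d}"
      by (intro hull_minimal convex_hyperplane)
    then show False using int d interior_mono interior_hyperplane by blast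
  qed
  have "gibbs_mean S q (x + 0 *\<^sub>R d) \<bullet> d < gibbs_mean S q (x + 1 *\<^sub>R d) \<bullet> d"
  proof (rule DERIV_pos_imp_increasing[of 0 1 "\<lambda>t. gibbs_mean S q (x + t *\<^sub>R d) \<bullet> d"])
    fix t :: real
    have "((\<lambda>t. gibbs_mean S q (x + t *\<^sub>R d) \<bullet> d) has_derivative
      (\<lambda>s. (\<Sum>i\<in>S. (gibbs S q (x + t *\<^sub>R d) i * (q i \<bullet> (s *\<^sub>R d) - gibbs_mean S q (x + t *\<^sub>R d) \<bullet> (s *\<^sub>R d))) *\<^sub>R q i) \<bullet> d)) (at t)"
      by (rule bounded_linear.has_derivative[OF bounded_linear_inner_left],
          rule has_derivative_compose[OF _ has_derivative_gibbs_mean[OF S]])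
         (auto intro!: derivative_eq_intros)
    also have "(\<lambda>s. (\<Sum>i\<in>S. (gibbs S q (x + t *\<^sub>R d) i * (q i \<bullet> (s *\<^sub>R d) - gibbs_mean S q (x + t *\<^sub>R d) \<bullet> (s *\<^sub>R d))) *\<^sub>R q i) \<bullet> d)
       = (\<lambda>s. gibbs_cov S q (x + t *\<^sub>R d) d d * s)"
      unfolding gibbs_cov_eq[OF S] unfolding inner_sum_left sum_distrib_right
      by (intro ext sum.cong refl) (simp add: algebra_simps)
    finally have "((\<lambda>t. gibbs_mean S q (x + t *\<^sub>R d) \<bullet> d) has_field_derivative gibbs_cov S q (x + t *\<^sub>R d) d d) (at t)"
      by (simp add: has_field_derivative_def)
    with pos show "\<exists>y. ((\<lambda>t. gibbs_mean S q (x + t *\<^sub>R d) \<bullet> d) has_field_derivative y) (at t) \<and> 0 < y" by blast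
  qed simp
  then show False using eq by (simp add: d_def)
qed

lemma continuous_gibbs [continuous_intros]:
  fixes q :: "'i \<Rightarrow> 'a::real_inner"
  assumes "finite S" "S \<noteq> {}" "continuous_on A f"
  shows "continuous_on A (\<lambda>x. gibbs S q (f x) i)"
proof -
  have "(\<Sum>j\<in>S. exp (q j \<bullet> f x)) \<noteq> 0" for x
    using gibbs_partition_pos[OF assms(1,2), of q "f x"] by simp
  then show ?thesis unfolding gibbs_def by (intro continuous_intros assms) auto
qed

lemma continuous_gibbs_cov:
  fixes q :: "'i \<Rightarrow> 'a::real_inner"
  assumes "finite S" "S \<noteq> {}" "continuous_on A f" "continuous_on A g" "continuous_on A h"
  shows "continuous_on A (\<lambda>x. gibbs_cov S q (f x) (g x) (h x))"
  unfolding gibbs_cov_def gibbs_mean_def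
  by (intro continuous_intros assms)

text \<open>
  The gradient of \<open>x \<mapsto> ln (\<Sum>i. exp (q\<^sub>i \<bullet> x))\<close> maps space diffeomorphically onto the interior of the
  convex hull of the points \<open>q\<^sub>i\<close>; its Jacobian is the covariance matrix of the Gibbs weights.
\<close>
lemma vol_convex_hull_gibbs:
  fixes q :: "'i \<Rightarrow> real^'n::{finite,wellorder}"
  assumes S: "finite S" "S \<noteq> {}"
  shows "ennreal (vol (convex hull (q ` S))) =
    (\<integral>\<^sup>+x. ennreal \<bar>det (\<chi> i j. gibbs_cov S q x (axis j 1) (axis i 1) :: real^'n::_^'n::_)\<bar> \<partial>lborel)"
proof -
  let ?C = "convex hull (q ` S)"
  define D where "D x v = (\<Sum>i\<in>S. (gibbs S q x i * (q i \<bullet> v - gibbs_mean S q x \<bullet> v)) *\<^sub>R q i)" for x v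
  have der: "(gibbs_mean S q has_derivative D x) (at x)" for x
    unfolding D_def by (rule has_derivative_gibbs_mean[OF S])
  have lin: "linear (D x)" for x using der[of x] has_derivative_linear by blast
  have mat: "matrix (D x) = (\<chi> i j. gibbs_cov S q x (axis j 1) (axis i 1))" for x
    unfolding matrix_def D_def
    by (simp add: vec_eq_iff gibbs_cov_eq[OF S] inner_axis)
  have cpt: "compact ?C" using S by (simp add: finite_imp_compact_convex_hull)
  show ?thesis
  proof (cases "interior ?C = {}")
    case True
    then have "vol ?C = 0"
      using negligible_convex_interior[of ?C] by (simp add: negligible_imp_measure0)
    moreover have "det (matrix (D x)) = 0" for x
    proof -
      obtain a b where ab: "a \<noteq> 0" "?C \<subseteq> {z. a \<bullet> z = b}"
        using empty_interior_subset_hyperplane[OF _ True] by auto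
      then have qi: "q i \<bullet> a = b" if "i \<in> S" for i
        using that hull_inc[of "q i" "q ` S" convex] by (auto simp: inner_commute)
      moreover have "gibbs_mean S q x \<bullet> a = b"
        using ab(2) gibbs_mean_in_hull[OF S, of q x] by (auto simp: inner_commute)
      ultimately have "D x a = 0" unfolding D_def by (intro sum.neutral) auto
      then have "\<not> inj (D x)" using ab(1) linear_0[OF lin] by (metis injD)
      then show ?thesis using det_nz_iff_inj[OF lin] by blast
    qed
    ultimately show ?thesis by (simp add: mat[symmetric])
  next
    case False
    have "interior ?C \<subseteq> range (gibbs_mean S q)" "range (gibbs_mean S q) \<subseteq> ?C"
      using gibbs_mean_surj_interior[OF S] gibbs_mean_in_hull[OF S] by auto
    moreover have "?C - interior ?C \<subseteq> frontier ?C"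
      using closure_subset by (auto simp: frontier_def)
    then have neg: "negligible (?C - interior ?C)"
      using negligible_convex_frontier[of ?C] negligible_subset by auto
    ultimately have "negligible (sym_diff ?C (range (gibbs_mean S q)))"
      by (intro negligible_subset[OF neg]) auto
    then have rng: "range (gibbs_mean S q) \<in> lmeasurable" "vol (range (gibbs_mean S q)) = vol ?C"
      using measure_negligible_symdiff[OF _ \<open>negligible (sym_diff _ _)\<close>] lmeasurable_compact[OF cpt]
        lmeasurable_negligible_symdiff[OF lmeasurable_compact[OF cpt]] by auto
    have "((\<lambda>x. \<bar>det (matrix (D x))\<bar>) has_integral vol ?C) UNIV"
      using has_measure_differentiable_image[of UNIV "gibbs_mean S q" D "vol ?C"]
        der gibbs_mean_inj[OF S False] rng by auto
    then have "(\<integral>\<^sup>+x. ennreal (indicator UNIV x * \<bar>det (matrix (D x))\<bar>) \<partial>lborel) = ennreal (vol ?C)"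
      by (intro nn_integral_has_integral_lebesgue) auto
    then show ?thesis by (simp add: mat)
  qed
qed

section \<open>Areas of plane projections\<close>

definition coords :: "'a::euclidean_space \<Rightarrow> 'a \<Rightarrow> 'a \<Rightarrow> real^2" where
  "coords v w x = vector [x \<bullet> v, x \<bullet> w]"

text \<open>
  For orthonormal \<open>v\<close> and \<open>w\<close> this is the area of the projection of \<open>K\<close> to their span. Allowing arbitrary \<open>v\<close>
  and \<open>w\<close>, which multiplies it by the area of the parallelogram they span, removes all normalisations.
\<close>
definition shadow :: "'a::euclidean_space set \<Rightarrow> 'a \<Rightarrow> 'a \<Rightarrow> real" where
  "shadow K v w = vol (coords v w ` K)"

lemma coords_nth [simp]: "coords v w x $ 1 = x \<bullet> v" "coords v w x $ 2 = x \<bullet> w"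
  by (simp_all add: coords_def)

lemma linear_coords: "linear (coords v w)"
  by (rule linearI) (simp_all add: vec_eq_iff forall_2 inner_add_left)

lemma continuous_on_linear: "linear f \<Longrightarrow> continuous_on S (f :: 'a::euclidean_space \<Rightarrow> 'b::real_normed_vector)"
  by (simp add: linear_conv_bounded_linear linear_continuous_on)

lemma compact_coords: "compact K \<Longrightarrow> compact (coords v w ` K)"
  by (intro compact_continuous_image continuous_on_linear linear_coords)

lemma shadow_nonneg: "shadow K v w \<ge> 0"
  by (simp add: shadow_def)

lemma shadow_change_basis:
  fixes K :: "'a::euclidean_space set"
  assumes "compact K"
  shows "shadow K (a *\<^sub>R v + b *\<^sub>R w) (c *\<^sub>R v + d *\<^sub>R w) = \<bar>a * d - b * c\<bar> * shadow K v w"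
proof -
  define M :: "real^2^2" where "M = vector [vector [a, b], vector [c, d]]"
  have "coords (a *\<^sub>R v + b *\<^sub>R w) (c *\<^sub>R v + d *\<^sub>R w) x = M *v coords v w x" for x
    by (simp add: vec_eq_iff forall_2 matrix_vector_mult_def sum_2 M_def inner_add_right)
  then have "coords (a *\<^sub>R v + b *\<^sub>R w) (c *\<^sub>R v + d *\<^sub>R w) ` K = (*v) M ` coords v w ` K"
    by (simp add: image_image)
  moreover have "vol ((*v) M ` coords v w ` K) = \<bar>det (matrix ((*v) M))\<bar> * vol (coords v w ` K)"
    by (intro measure_linear_image lmeasurable_compact compact_coords assms) simp
  moreover have "det M = a * d - b * c" by (simp add: det_2 M_def)
  ultimately show ?thesis by (simp add: shadow_def matrix_of_matrix_vector_mul)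
qed

lemma shadow_bound:
  fixes K :: "'a::euclidean_space set"
  assumes K: "compact K" "K \<subseteq> cball 0 R" and R: "R \<ge> 0"
  shows "shadow K v w \<le> 4 * R\<^sup>2 * (norm v * norm w)"
proof -
  let ?u = "vector [R * norm v, R * norm w] :: real^2"
  have "coords v w ` K \<subseteq> cbox (- ?u) ?u"
  proof
    fix y assume "y \<in> coords v w ` K"
    then obtain x where x: "x \<in> K" "y = coords v w x" by blast
    then have "norm x \<le> R" using K by auto
    then have "\<bar>x \<bullet> z\<bar> \<le> R * norm z" for z
      using Cauchy_Schwarz_ineq2[of x z] mult_right_mono[of "norm x" R "norm z"] by simp
    from this[of v] this[of w] show "y \<in> cbox (- ?u) ?u"
      by (auto simp: mem_box_cart x forall_2 abs_le_iff)
  qed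
  then have "shadow K v w \<le> vol (cbox (- ?u) ?u)"
    unfolding shadow_def by (intro vol_mono compact_coords K compact_cbox)
  also have "cbox (- ?u) ?u \<noteq> {}" using R by (auto simp: interval_ne_empty_cart forall_2)
  then have "vol (cbox (- ?u) ?u) = 4 * R\<^sup>2 * (norm v * norm w)"
    by (simp add: content_cbox_cart prod_2 UNIV_2 power2_eq_square)
  finally show ?thesis .
qed

abbreviation gibbs_area :: "'a set \<Rightarrow> 'a::euclidean_space \<Rightarrow> 'a \<Rightarrow> 'a \<Rightarrow> real" where
  "gibbs_area P x v w \<equiv> gibbs_cov P id x v v * gibbs_cov P id x w w - (gibbs_cov P id x v w)\<^sup>2"

lemma gibbs_area_nonneg: "finite P \<Longrightarrow> P \<noteq> {} \<Longrightarrow> gibbs_area P x v w \<ge> 0"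
  using gibbs_cov_Cauchy_Schwarz[of P id x v w] by simp

text \<open>
  The restriction of \<open>ln (\<Sum>p. exp (p \<bullet> x))\<close> to the plane \<open>x = z\<^sub>1 v + z\<^sub>2 w\<close> is the same kind of function for the
  projected points.
\<close>
lemma shadow_hull:
  fixes P :: "'a::euclidean_space set"
  assumes P: "finite P" "P \<noteq> {}"
  shows "ennreal (shadow (convex hull P) v w) =
    (\<integral>\<^sup>+z. ennreal (gibbs_area P (z $ 1 *\<^sub>R v + z $ 2 *\<^sub>R w) v w) \<partial>(lborel :: (real^2) measure))"
proof -
  let ?q = "coords v w"
  have "coords v w ` (convex hull P) = convex hull (?q ` P)"
    by (rule convex_hull_linear_image[OF linear_coords])
  moreover have inner: "?q p \<bullet> z = p \<bullet> (z $ 1 *\<^sub>R v + z $ 2 *\<^sub>R w)" for p z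
    by (simp add: inner_vec_def sum_2 inner_add_right mult.commute)
  have gb: "gibbs P ?q z p = gibbs P id (z $ 1 *\<^sub>R v + z $ 2 *\<^sub>R w) p" for z p
    by (simp add: gibbs_def inner)
  have mean: "gibbs_mean P ?q z \<bullet> u = gibbs_mean P id (z $ 1 *\<^sub>R v + z $ 2 *\<^sub>R w) \<bullet> (u $ 1 *\<^sub>R v + u $ 2 *\<^sub>R w)" for z u
    unfolding gibbs_mean_inner gb inner by simp
  have cov: "gibbs_cov P ?q z u u' = gibbs_cov P id (z $ 1 *\<^sub>R v + z $ 2 *\<^sub>R w) (u $ 1 *\<^sub>R v + u $ 2 *\<^sub>R w) (u' $ 1 *\<^sub>R v + u' $ 2 *\<^sub>R w)" for z u u'
    unfolding gibbs_cov_def by (simp only: inner_diff_left gb inner mean id_apply)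
  have "det (\<chi> i j. gibbs_cov P ?q z (axis j 1) (axis i 1) :: real^2^2)
     = gibbs_area P (z $ 1 *\<^sub>R v + z $ 2 *\<^sub>R w) v w" for z
    by (simp add: det_2 cov axis_def power2_eq_square gibbs_cov_bilinear(3)[of P id _ w v])
  ultimately show ?thesis
    using vol_convex_hull_gibbs[OF P, of ?q] gibbs_area_nonneg[OF P] by (simp add: shadow_def)
qed

text \<open>
  Take the hulls of the first \<open>n\<close> points of a dense sequence. Their union is convex and dense in \<open>K\<close>, and a convex
  set differs from its closure by a null set.
\<close>
lemma polytope_exhaustion:
  fixes K :: "'a::euclidean_space set"
  assumes K: "compact K" "convex K" "K \<noteq> {}"
  obtains P :: "nat \<Rightarrow> 'a set" where "\<And>n. finite (P n)" "\<And>n. P n \<noteq> {}"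
    "\<And>v w. ennreal (shadow K v w) = (SUP n. ennreal (shadow (convex hull (P n)) v w))"
    "\<And>v w. incseq (\<lambda>n. ennreal (shadow (convex hull (P n)) v w))"
proof -
  obtain T where T: "countable T" "T \<subseteq> K" "K \<subseteq> closure T"
    using separable by blast
  have Tne: "T \<noteq> {}" using T K by auto
  define P where "P n = from_nat_into T ` {..n}" for n
  have fin: "finite (P n)" "P n \<noteq> {}" for n by (auto simp: P_def)
  have inc: "incseq P" by (auto simp: P_def incseq_def)
  have PK: "P n \<subseteq> K" for n using from_nat_into[OF Tne] T by (auto simp: P_def)
  define U where "U = (\<Union>n. convex hull (P n))"
  have incU: "incseq (\<lambda>n. convex hull (P n))"
    using inc by (auto simp: incseq_def hull_mono)
  have "convex U"
  proof (rule convexI)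
    fix x y and a b :: real assume xy: "x \<in> U" "y \<in> U" and ab: "0 \<le> a" "0 \<le> b" "a + b = 1"
    obtain m n where "x \<in> convex hull (P m)" "y \<in> convex hull (P n)" using xy by (auto simp: U_def)
    then have "x \<in> convex hull (P (max m n))" "y \<in> convex hull (P (max m n))"
      using incU unfolding incseq_def by (meson max.cobounded1 max.cobounded2 subsetD)+
    then have "a *\<^sub>R x + b *\<^sub>R y \<in> convex hull (P (max m n))"
      using ab by (intro convexD convex_convex_hull) auto
    then show "a *\<^sub>R x + b *\<^sub>R y \<in> U" by (auto simp: U_def)
  qed
  have UK: "U \<subseteq> K" using PK K(2) by (auto simp: U_def intro: hull_minimal[THEN subsetD])
  have TU: "T \<subseteq> U"
  proof
    fix t assume "t \<in> T"
    then obtain n where "t = from_nat_into T n" using T(1) by (metis from_nat_into_surj)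
    then have "t \<in> P n" by (simp add: P_def)
    then show "t \<in> U" unfolding U_def by (blast intro: hull_inc)
  qed
  have main: "ennreal (shadow K v w) = (SUP n. ennreal (shadow (convex hull (P n)) v w))" for v w
  proof -
    let ?f = "coords v w"
    have "convex (?f ` U)" by (intro convex_linear_image linear_coords \<open>convex U\<close>)
    have sub: "?f ` K \<subseteq> closure (?f ` U)"
    proof -
      have "?f ` K \<subseteq> ?f ` closure U" using T(3) closure_mono[OF TU] by blast
      also have "\<dots> \<subseteq> closure (?f ` U)"
        by (intro image_closure_subset closure_subset continuous_on_linear linear_coords closed_closure)
      finally show ?thesis .
    qed
    have diff: "?f ` K - ?f ` U \<subseteq> frontier (?f ` U)"
      using sub interior_subset by (auto simp: frontier_def)
    have neg: "negligible (?f ` K - ?f ` U)"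
      using negligible_convex_frontier[OF \<open>convex (?f ` U)\<close>] diff negligible_subset by blast
    have hm: "?f ` (convex hull (P n)) \<in> lmeasurable" for n
      by (intro lmeasurable_compact compact_coords finite_imp_compact_convex_hull fin)
    have "emeasure lebesgue (?f ` K) = emeasure lebesgue (?f ` U)"
    proof -
      have meas: "?f ` U \<in> sets lebesgue"
        unfolding U_def image_UN using hm by (intro sets.countable_UN) auto
      have "emeasure lebesgue (?f ` U \<union> (?f ` K - ?f ` U)) = emeasure lebesgue (?f ` U)"
        by (rule emeasure_Un_null_set[OF meas]) (use neg negligible_iff_null_sets in blast)
      also have "?f ` U \<union> (?f ` K - ?f ` U) = ?f ` K" using UK by auto
      finally show ?thesis .
    qed
    also have "emeasure lebesgue (?f ` U) = (SUP n. emeasure lebesgue (?f ` (convex hull (P n))))"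
      unfolding U_def image_UN
    proof (rule SUP_emeasure_incseq[symmetric])
      show "incseq (\<lambda>n. ?f ` (convex hull (P n)))"
        using incU unfolding incseq_def by (intro allI impI image_mono) blast
    qed (use hm in auto)
    finally show ?thesis
      using lmeasurable_compact[OF compact_coords[OF K(1)], of v w] hm
      by (simp add: shadow_def emeasure_eq_measure2)
  qed
  have "incseq (\<lambda>n. ennreal (shadow (convex hull (P n)) v w))" for v w
    unfolding incseq_def shadow_def using incU
    by (intro allI impI ennreal_leI vol_mono compact_coords finite_imp_compact_convex_hull fin image_mono)
       (auto simp: incseq_def)
  with that fin main show ?thesis by blast
qed

lemma measurable_shadow_hull:
  fixes P :: "'a::euclidean_space set"
  assumes P: "finite P" "P \<noteq> {}"
  shows "(\<lambda>p. ennreal (shadow (convex hull P) (fst p) (snd p))) \<in> borel_measurable borel"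
proof -
  have "(\<lambda>(p :: 'a \<times> 'a, z :: real^2). ennreal (gibbs_area P (z $ 1 *\<^sub>R fst p + z $ 2 *\<^sub>R snd p) (fst p) (snd p)))
     \<in> borel_measurable borel"
    by (intro borel_measurable_continuous_onI, unfold split_beta, intro continuous_on_ennreal)
       (intro continuous_intros continuous_gibbs_cov P)
  then show ?thesis
    unfolding shadow_hull[OF P]
    by (intro lborel.borel_measurable_nn_integral) (simp add: borel_prod measurable_cong_sets[OF sets_pair_measure_cong[OF refl sets_lborel]])
qed

text \<open>
  For polytopes the area is a parameter integral of a continuous function.
\<close>
lemma measurable_shadow:
  fixes K :: "'a::euclidean_space set"
  assumes K: "compact K" "convex K"
  shows "(\<lambda>p. shadow K (fst p) (snd p)) \<in> borel_measurable borel"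
proof (cases "K = {}")
  case False
  obtain P :: "nat \<Rightarrow> 'a set" where P: "\<And>n. finite (P n)" "\<And>n. P n \<noteq> {}"
    "\<And>v w. ennreal (shadow K v w) = (SUP n. ennreal (shadow (convex hull (P n)) v w))"
    using polytope_exhaustion[OF K False] by metis
  have "(\<lambda>p. ennreal (shadow K (fst p) (snd p))) \<in> borel_measurable borel"
    unfolding P(3) by (intro borel_measurable_SUP measurable_shadow_hull P) auto
  then have "(\<lambda>p. enn2real (ennreal (shadow K (fst p) (snd p)))) \<in> borel_measurable borel"
    by measurable
  then show ?thesis by (simp add: shadow_nonneg)
qed (simp add: shadow_def)

section \<open>Complex structures on the quaternions\<close>

type_synonym c2 = "complex^2"

definition qI :: "c2 \<Rightarrow> c2" where "qI x = \<i> *s x"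
text \<open>
  With \<open>I = qI\<close> and \<open>J = qJ\<close> one has \<open>J\<^sup>2 = -1\<close> and \<open>IJ = -JI\<close>, so \<open>\<complex>\<^sup>2\<close> becomes the left module of the quaternions
  over itself; \<open>K\<close> is \<open>IJ\<close>.
\<close>
definition qJ :: "c2 \<Rightarrow> c2" where "qJ x = vector [- cnj (x $ 2), cnj (x $ 1)]"

text \<open>
  Multiplication by the imaginary quaternion \<open>aI + bJ + cK\<close>.
\<close>
definition imag :: "real \<Rightarrow> real \<Rightarrow> real \<Rightarrow> c2 \<Rightarrow> c2" where
  "imag a b c x = a *\<^sub>R qI x + b *\<^sub>R qJ x + c *\<^sub>R qI (qJ x)"

lemmas c2_simps = vec_eq_iff forall_2 complex_eq_iff inner_vec_def sum_2 inner_complex_def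

lemma imag_nth [simp]:
  "Re (imag a b c x $ 1) = - a * Im (x $ 1) - b * Re (x $ 2) - c * Im (x $ 2)"
  "Im (imag a b c x $ 1) = a * Re (x $ 1) + b * Im (x $ 2) - c * Re (x $ 2)"
  "Re (imag a b c x $ 2) = - a * Im (x $ 2) + b * Re (x $ 1) + c * Im (x $ 1)"
  "Im (imag a b c x $ 2) = a * Re (x $ 2) - b * Im (x $ 1) + c * Re (x $ 1)"
  by (simp_all add: imag_def qI_def qJ_def)

lemma linear_imag: "linear (imag a b c)"
  by (rule linearI) (simp_all add: c2_simps algebra_simps)

lemma imag_imag: "imag a b c (imag a b c x) = - (a\<^sup>2 + b\<^sup>2 + c\<^sup>2) *\<^sub>R x"
  by (simp add: c2_simps power2_eq_square algebra_simps)

lemma inner_imag_self [simp]: "x \<bullet> imag a b c x = 0" "imag a b c x \<bullet> x = 0"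
  by (simp_all add: c2_simps algebra_simps)

lemma inner_imag: "imag a b c x \<bullet> imag a' b' c' x = (a * a' + b * b' + c * c') * (x \<bullet> x)"
  by (simp add: c2_simps algebra_simps)

lemma imag_adjoint: "imag a b c x \<bullet> y = x \<bullet> (- imag a b c y)"
  by (simp add: c2_simps algebra_simps)

lemma norm_imag: "a\<^sup>2 + b\<^sup>2 + c\<^sup>2 = 1 \<Longrightarrow> norm (imag a b c x) = norm x"
  using inner_imag[of a b c x a b c] by (simp add: norm_eq_sqrt_inner power2_eq_square)

lemma DIM_c2 [simp]: "DIM(c2) = 4"
  by simp

text \<open>
  Each line \<open>span {y, ly}\<close> enters with the area of its projection scaled by \<open>|y|\<^sup>2\<close>; as the weight is radial, this
  is an average over all lines of \<open>l\<close>.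
\<close>
definition line_avg_coords :: "real \<Rightarrow> real \<Rightarrow> real \<Rightarrow> c2 set \<Rightarrow> ennreal" where
  "line_avg_coords a b c K = (\<integral>\<^sup>+y. indicator (cball 0 1) y * ennreal (shadow K y (imag a b c y)) \<partial>lborel)"

lemma norm_real2: "norm (z :: real^2) = sqrt ((z $ 1)\<^sup>2 + (z $ 2)\<^sup>2)"
  by (simp add: norm_vec_def L2_set_def sum_2)

lemma norm_sim_imag:
  assumes "a\<^sup>2 + b\<^sup>2 + c\<^sup>2 = 1"
  shows "norm (z $ 1 *\<^sub>R y + z $ 2 *\<^sub>R imag a b c y) = norm (z :: real^2) * norm y"
proof -
  have "(norm (z $ 1 *\<^sub>R y + z $ 2 *\<^sub>R imag a b c y))\<^sup>2 = ((z $ 1)\<^sup>2 + (z $ 2)\<^sup>2) * (norm y)\<^sup>2"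
    using inner_imag[of a b c y a b c] assms
    by (simp add: power2_norm_eq_inner inner_add_left inner_add_right) (simp add: power2_eq_square algebra_simps)
  also have "\<dots> = (norm z * norm y)\<^sup>2" by (simp add: norm_real2 power_mult_distrib)
  finally show ?thesis by (simp add: power2_eq_iff_nonneg)
qed

lemma gibbs_area_change_basis:
  "gibbs_area P x (a *\<^sub>R v + b *\<^sub>R w) (c *\<^sub>R v + d *\<^sub>R w) = (a * d - b * c)\<^sup>2 * gibbs_area P x v w"
proof -
  have s: "gibbs_cov P id x w v = gibbs_cov P id x v w" by (rule gibbs_cov_bilinear(3))
  have b: "gibbs_cov P id x u (v + v') = gibbs_cov P id x u v + gibbs_cov P id x u v'"
    "gibbs_cov P id x u (r *\<^sub>R v) = r * gibbs_cov P id x u v" for u v v' r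
    using gibbs_cov_bilinear by metis+
  show ?thesis
    by (simp add: gibbs_cov_bilinear(1,2) b s) (simp add: power2_eq_square algebra_simps)
qed

text \<open>
  Every nonzero point of \<open>\<complex>\<^sup>2\<close> lies on exactly one line of the complex structure \<open>a\<close>, so
  integrating over a line and then over all lines amounts to integrating over \<open>\<complex>\<^sup>2\<close>. The outcome
  depends on \<open>a\<close> only through the vector \<open>ax\<close> in the integrand, which is quadratic in it.
\<close>
lemma line_avg_coords_hull:
  assumes P: "finite P" "P \<noteq> {}" and abc: "a\<^sup>2 + b\<^sup>2 + c\<^sup>2 = 1"
  shows "line_avg_coords a b c (convex hull P) = (\<integral>\<^sup>+z. (\<integral>\<^sup>+x. indicator (cball 0 (norm z)) x *
     ennreal (gibbs_area P x x (imag a b c x) / norm z ^ 8) \<partial>lborel) \<partial>(lborel :: (real^2) measure))"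
proof -
  let ?j = "imag a b c"
  have contj: "continuous_on A (\<lambda>x. ?j (f x))" if "continuous_on A f" for A and f :: "'b::topological_space \<Rightarrow> c2"
    using continuous_on_compose2[OF continuous_on_linear[OF linear_imag] that] by auto
  define G where "G y z = indicator (cball 0 1) y * ennreal (gibbs_area P (z $ 1 *\<^sub>R y + z $ 2 *\<^sub>R ?j y) y (?j y))"
    for y :: c2 and z :: "real^2"
  have G_meas: "(\<lambda>(y, z). G y z) \<in> borel_measurable (lborel \<Otimes>\<^sub>M lborel)"
  proof -
    have m1: "(\<lambda>(y :: c2, z :: real^2). ennreal (gibbs_area P (z $ 1 *\<^sub>R y + z $ 2 *\<^sub>R ?j y) y (?j y))) \<in> borel_measurable borel"
      by (intro borel_measurable_continuous_onI, unfold split_beta, intro continuous_on_ennreal)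
         (intro continuous_intros continuous_gibbs_cov P contj)
    have m2: "(\<lambda>(y :: c2, z :: real^2). indicator (cball 0 1) y :: ennreal) \<in> borel_measurable (borel \<Otimes>\<^sub>M borel)"
      unfolding split_beta by (rule measurable_compose[OF measurable_fst borel_measurable_indicator]) simp
    have "(\<lambda>(y, z). G y z) \<in> borel_measurable borel"
      using borel_measurable_times_ennreal[OF m2[unfolded borel_prod] m1] by (simp add: G_def split_beta)
    then show ?thesis by (simp add: lborel_prod)
  qed
  have "line_avg_coords a b c (convex hull P) = (\<integral>\<^sup>+y. (\<integral>\<^sup>+z. G y z \<partial>lborel) \<partial>lborel)"
    unfolding line_avg_coords_def shadow_hull[OF P] G_def
  proof (intro nn_integral_cong nn_integral_cmult[symmetric])
    fix y :: c2
    have "(\<lambda>z :: real^2. ennreal (gibbs_area P (z $ 1 *\<^sub>R y + z $ 2 *\<^sub>R ?j y) y (?j y))) \<in> borel_measurable borel"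
      by (intro borel_measurable_continuous_onI continuous_on_ennreal)
         (intro continuous_intros continuous_gibbs_cov P contj)
    then show "(\<lambda>z :: real^2. ennreal (gibbs_area P (z $ 1 *\<^sub>R y + z $ 2 *\<^sub>R ?j y) y (?j y))) \<in> borel_measurable lborel"
      by simp
  qed
  also have "\<dots> = (\<integral>\<^sup>+z. (\<integral>\<^sup>+y. G y z \<partial>lborel) \<partial>lborel)"
    by (rule lborel_pair.Fubini'[OF G_meas, symmetric])
  also have "\<dots> = (\<integral>\<^sup>+z. (\<integral>\<^sup>+x. indicator (cball 0 (norm z)) x *
     ennreal (gibbs_area P x x (?j x) / norm z ^ 8) \<partial>lborel) \<partial>(lborel :: (real^2) measure))"
  proof (rule nn_integral_cong_AE)
    have "AE z in (lborel :: (real^2) measure). z \<noteq> 0"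
      using AE_lborel_singleton[of "0 :: real^2"] by simp
    then show "AE z in (lborel :: (real^2) measure). (\<integral>\<^sup>+y. G y z \<partial>lborel) = (\<integral>\<^sup>+x. indicator (cball 0 (norm z)) x *
     ennreal (gibbs_area P x x (?j x) / norm z ^ 8) \<partial>lborel)"
    proof (rule AE_mp, intro AE_I2 impI)
      fix z :: "real^2" assume z: "z \<noteq> 0"
      define r where "r = norm z"
      have r: "r > 0" using z by (simp add: r_def)
      define T where "T y = z $ 1 *\<^sub>R y + z $ 2 *\<^sub>R ?j y" for y
      have T: "linear T"
        unfolding T_def[abs_def] by (intro linear_compose_add linear_compose_scale_right linear_ident linear_imag)
      have nT: "norm (T y) = r * norm y" for y
        by (simp add: T_def r_def norm_sim_imag[OF abc])
      define f where "f x = indicator (cball 0 r) x * ennreal (gibbs_area P x x (?j x) / r ^ 8)" for x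
      have f_meas: "f \<in> borel_measurable borel"
      proof -
        have "(\<lambda>x. ennreal (gibbs_area P x x (?j x) / r ^ 8)) \<in> borel_measurable borel"
          by (intro borel_measurable_continuous_onI continuous_on_ennreal)
             (use r in \<open>auto intro!: continuous_intros continuous_gibbs_cov P contj\<close>)
        then show ?thesis unfolding f_def by (intro borel_measurable_times_ennreal borel_measurable_indicator) auto
      qed
      have "(\<integral>\<^sup>+x. f x \<partial>lborel) = ennreal (r ^ 4) * (\<integral>\<^sup>+y. f (T y) \<partial>lborel)"
        by (rule nn_integral_similarity[OF T nT r _ _ f_meas]) auto
      also have "\<dots> = (\<integral>\<^sup>+y. ennreal (r ^ 4) * f (T y) \<partial>lborel)"
        using measurable_compose[OF linear_borel_measurable[OF T] f_meas]
        by (intro nn_integral_cmult[symmetric]) simp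
      also have "\<dots> = (\<integral>\<^sup>+y. G y z \<partial>lborel)"
      proof (rule nn_integral_cong)
        fix y
        have jT: "?j (T y) = (- z $ 2) *\<^sub>R y + z $ 1 *\<^sub>R ?j y"
          using imag_imag[of a b c y] abc
          by (simp add: T_def linear_add[OF linear_imag] linear_scale[OF linear_imag])
        have "gibbs_area P (T y) (T y) (?j (T y)) = (z $ 1 * z $ 1 - z $ 2 * (- z $ 2))\<^sup>2 * gibbs_area P (T y) y (?j y)"
          using gibbs_area_change_basis[of P "T y" "z $ 1" y "z $ 2" "?j y" "- z $ 2" "z $ 1"]
          by (simp only: jT T_def[symmetric])
        also have "z $ 1 * z $ 1 - z $ 2 * (- z $ 2) = r\<^sup>2"
          by (simp add: r_def norm_real2 power2_eq_square)
        finally have "gibbs_area P (T y) (T y) (?j (T y)) = (r\<^sup>2)\<^sup>2 * gibbs_area P (T y) y (?j y)" .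
        then have e: "gibbs_area P (T y) (T y) (?j (T y)) / r ^ 8 * r ^ 4 = gibbs_area P (T y) y (?j y)"
          using r by (simp add: eval_nat_numeral)
        have i: "indicator (cball 0 r) (T y) = (indicator (cball 0 1) y :: ennreal)"
          using r by (auto simp: indicator_def nT)
        have "ennreal (r ^ 4) * f (T y) = indicator (cball 0 1) y * (ennreal (gibbs_area P (T y) (T y) (?j (T y)) / r ^ 8) * ennreal (r ^ 4))"
          by (simp add: f_def i mult_ac)
        also have "\<dots> = indicator (cball 0 1) y * ennreal (gibbs_area P (T y) y (?j y))"
          using r gibbs_area_nonneg[OF P] e by (subst ennreal_mult[symmetric]) (auto simp del: times_divide_eq_left)
        finally show "ennreal (r ^ 4) * f (T y) = G y z" by (simp add: G_def T_def)
      qed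
      finally show "(\<integral>\<^sup>+y. G y z \<partial>lborel) = (\<integral>\<^sup>+x. indicator (cball 0 (norm z)) x *
         ennreal (gibbs_area P x x (?j x) / norm z ^ 8) \<partial>lborel)" by (simp add: f_def r_def)
    qed
  qed
  finally show ?thesis .
qed

lemma borel_measurable_sum_list_ennreal:
  fixes f :: "'l \<Rightarrow> 'a \<Rightarrow> ennreal"
  assumes "\<And>l. l \<in> set ls \<Longrightarrow> f l \<in> borel_measurable M"
  shows "(\<lambda>x. \<Sum>l\<leftarrow>ls. f l x) \<in> borel_measurable M"
  using assms by (induction ls) simp_all

lemma nn_integral_sum_list:
  assumes "\<And>l. l \<in> set ls \<Longrightarrow> f l \<in> borel_measurable M"
  shows "(\<integral>\<^sup>+x. (\<Sum>l\<leftarrow>ls. f l x) \<partial>M) = (\<Sum>l\<leftarrow>ls. (\<integral>\<^sup>+x. f l x \<partial>M))"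
  using assms
proof (induction ls)
  case (Cons l ls)
  have "(\<lambda>x. \<Sum>l\<leftarrow>ls. f l x) \<in> borel_measurable M"
    using Cons.prems by (intro borel_measurable_sum_list_ennreal) auto
  with Cons show ?case by (simp add: nn_integral_add)
qed simp

lemma sum_list_ennreal_nonneg:
  "(\<And>l. l \<in> set ls \<Longrightarrow> f l \<ge> 0) \<Longrightarrow> (\<Sum>l\<leftarrow>ls. ennreal (f l)) = ennreal (\<Sum>l\<leftarrow>ls. f l)"
proof (induction ls)
  case (Cons l ls)
  have "(\<Sum>l\<leftarrow>ls. f l) \<ge> 0" using Cons.prems by (intro sum_list_nonneg) auto
  with Cons show ?case by (simp add: ennreal_plus)
qed simp

lemma sum_list_SUP_ennreal:
  fixes f :: "'l \<Rightarrow> nat \<Rightarrow> ennreal"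
  assumes "\<And>l. incseq (f l)"
  shows "(SUP n. \<Sum>l\<leftarrow>ls. f l n) = (\<Sum>l\<leftarrow>ls. SUP n. f l n)"
proof (induction ls)
  case (Cons l ls)
  have "incseq (\<lambda>n. \<Sum>l\<leftarrow>ls. f l n)"
    using assms by (induction ls) (auto simp: incseq_def intro: add_mono)
  then show ?case using Cons assms by (simp add: ennreal_SUP_add)
qed simp

definition quad :: "real \<Rightarrow> real \<Rightarrow> real \<Rightarrow> real \<Rightarrow> real \<Rightarrow> real \<Rightarrow> real \<times> real \<times> real \<Rightarrow> real" where
  "quad A B C D E F = (\<lambda>(a, b, c). A * a\<^sup>2 + B * b\<^sup>2 + C * c\<^sup>2 + D * (a * b) + E * (b * c) + F * (c * a))"

definition unit3 :: "real \<times> real \<times> real \<Rightarrow> bool" where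
  "unit3 = (\<lambda>(a, b, c). a\<^sup>2 + b\<^sup>2 + c\<^sup>2 = 1)"

definition imag3 :: "real \<times> real \<times> real \<Rightarrow> c2 \<Rightarrow> c2" where
  "imag3 = (\<lambda>(a, b, c). imag a b c)"

definition line_avg :: "real \<times> real \<times> real \<Rightarrow> c2 set \<Rightarrow> ennreal" where
  "line_avg = (\<lambda>(a, b, c). line_avg_coords a b c)"

lemma line_avg_eq: "line_avg l K = (\<integral>\<^sup>+y. indicator (cball 0 1) y * ennreal (shadow K y (imag3 l y)) \<partial>lborel)"
  by (cases l) (simp add: line_avg_def line_avg_coords_def imag3_def)

lemma linear_imag3: "linear (imag3 l)"
  by (cases l) (simp add: imag3_def linear_imag)

lemma continuous_imag3 [continuous_intros]:
  "continuous_on A f \<Longrightarrow> continuous_on A (\<lambda>x. imag3 l (f x))"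
  by (rule continuous_on_compose2[of UNIV "imag3 l"]) (simp_all add: continuous_on_linear linear_imag3)

lemma line_avg_hull:
  assumes P: "finite P" "P \<noteq> {}" and l: "unit3 l"
  shows "line_avg l (convex hull P) = (\<integral>\<^sup>+z. (\<integral>\<^sup>+x. indicator (cball 0 (norm z)) x *
     ennreal (gibbs_area P x x (imag3 l x) / norm z ^ 8) \<partial>lborel) \<partial>(lborel :: (real^2) measure))"
  using l line_avg_coords_hull[OF P] by (cases l) (auto simp: line_avg_def unit3_def imag3_def)

lemma quad_expansion:
  fixes a b c X :: real
  shows "X * (a * (a * ii + b * ij + c * ik) + b * (a * ij + b * jj + c * jk) + c * (a * ik + b * jk + c * kk))
      - (a * i + b * j + c * k)\<^sup>2
    = quad (X * ii - i\<^sup>2) (X * jj - j\<^sup>2) (X * kk - k\<^sup>2) (2 * (X * ij - i * j)) (2 * (X * jk - j * k))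
        (2 * (X * ik - k * i)) (a, b, c)"
  unfolding quad_def prod.case by algebra

lemma gibbs_area_quad:
  obtains A B C D E F where "\<And>l. gibbs_area P x x (imag3 l x) = quad A B C D E F l"
proof -
  let ?i = "qI x" and ?j = "qJ x" and ?k = "qI (qJ x)" and ?c = "gibbs_cov P id x"
  have b: "?c u (v + v') = ?c u v + ?c u v'" "?c u (r *\<^sub>R v) = r * ?c u v" for u v v' r
    using gibbs_cov_bilinear by metis+
  note l = gibbs_cov_bilinear(1,2)[of P id x]
  have s: "?c ?j ?i = ?c ?i ?j" "?c ?k ?j = ?c ?j ?k" "?c ?k ?i = ?c ?i ?k"
    by (rule gibbs_cov_bilinear(3))+
  have key: "gibbs_area P x x (imag a b c x) =
    quad (?c x x * ?c ?i ?i - (?c x ?i)\<^sup>2) (?c x x * ?c ?j ?j - (?c x ?j)\<^sup>2) (?c x x * ?c ?k ?k - (?c x ?k)\<^sup>2)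
      (2 * (?c x x * ?c ?i ?j - ?c x ?i * ?c x ?j)) (2 * (?c x x * ?c ?j ?k - ?c x ?j * ?c x ?k))
      (2 * (?c x x * ?c ?i ?k - ?c x ?k * ?c x ?i)) (a, b, c)" for a b c
    unfolding imag_def l b s by (rule quad_expansion)
  show ?thesis by (rule that, unfold split_paired_all imag3_def prod.case, rule key)
qed

lemma measurable_line_avg_coords_integrand:
  assumes P: "finite P" "P \<noteq> {}"
  shows "(\<lambda>(z :: real^2, x). indicator (cball 0 (norm z)) x * ennreal (gibbs_area P x x (imag3 l x) / norm z ^ 8))
     \<in> borel_measurable (borel \<Otimes>\<^sub>M borel)"
proof -
  have "closed {p :: (real^2) \<times> c2. norm (snd p) \<le> norm (fst p)}"
    by (intro closed_Collect_le continuous_intros)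
  then have "{p :: (real^2) \<times> c2. norm (snd p) \<le> norm (fst p)} \<in> sets (borel \<Otimes>\<^sub>M borel)"
    unfolding borel_prod by (rule borel_closed)
  then have 1: "(indicator {p :: (real^2) \<times> c2. norm (snd p) \<le> norm (fst p)} :: _ \<Rightarrow> ennreal) \<in> borel_measurable (borel \<Otimes>\<^sub>M borel)"
    by (rule borel_measurable_indicator)
  have [measurable]: "(\<lambda>x. gibbs_area P x x (imag3 l x)) \<in> borel_measurable borel"
    by (intro borel_measurable_continuous_onI continuous_intros continuous_gibbs_cov P)
  have 2: "(\<lambda>p :: (real^2) \<times> c2. ennreal (gibbs_area P (snd p) (snd p) (imag3 l (snd p)) / norm (fst p) ^ 8)) \<in> borel_measurable (borel \<Otimes>\<^sub>M borel)"
    by measurable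
  have "(\<lambda>p. indicator {p :: (real^2) \<times> c2. norm (snd p) \<le> norm (fst p)} p * ennreal (gibbs_area P (snd p) (snd p) (imag3 l (snd p)) / norm (fst p) ^ 8)) \<in> borel_measurable (borel \<Otimes>\<^sub>M borel)"
    using 1 2 by (rule borel_measurable_times_ennreal)
  then show ?thesis by (simp add: split_beta indicator_def)
qed

lemma sum_line_avg_hull:
  assumes P: "finite P" "P \<noteq> {}" and As: "\<And>l. l \<in> set As \<Longrightarrow> unit3 l"
  shows "(\<Sum>l\<leftarrow>As. line_avg l (convex hull P)) = (\<integral>\<^sup>+z. (\<integral>\<^sup>+x. indicator (cball 0 (norm z)) x *
     ennreal ((\<Sum>l\<leftarrow>As. gibbs_area P x x (imag3 l x)) / norm z ^ 8) \<partial>lborel) \<partial>(lborel :: (real^2) measure))"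
proof -
  define g where "g l z x = indicator (cball 0 (norm z)) x * ennreal (gibbs_area P x x (imag3 l x) / norm z ^ 8)"
    for l and z :: "real^2" and x :: c2
  have g_meas: "(\<lambda>(z, x). g l z x) \<in> borel_measurable (borel \<Otimes>\<^sub>M borel)" for l
    unfolding g_def by (rule measurable_line_avg_coords_integrand[OF P])
  have g1: "g l z \<in> borel_measurable lborel" for l z
    using measurable_Pair2[OF g_meas] by simp
  have g2: "(\<lambda>z. \<integral>\<^sup>+x. g l z x \<partial>lborel) \<in> borel_measurable lborel" for l
    using lborel.borel_measurable_nn_integral[of "g l" borel] g_meas[of l]
    by (simp add: measurable_cong_sets[OF sets_pair_measure_cong[OF refl sets_lborel]])
  have inner: "(\<Sum>l\<leftarrow>As. g l z x) = indicator (cball 0 (norm z)) x *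
     ennreal ((\<Sum>l\<leftarrow>As. gibbs_area P x x (imag3 l x)) / norm z ^ 8)" for z x
  proof -
    have "(\<Sum>l\<leftarrow>As. ennreal (gibbs_area P x x (imag3 l x) / norm z ^ 8)) =
      ennreal (\<Sum>l\<leftarrow>As. gibbs_area P x x (imag3 l x) / norm z ^ 8)"
      by (intro sum_list_ennreal_nonneg divide_nonneg_nonneg gibbs_area_nonneg P) auto
    also have "(\<Sum>l\<leftarrow>As. gibbs_area P x x (imag3 l x) / norm z ^ 8) = (\<Sum>l\<leftarrow>As. gibbs_area P x x (imag3 l x)) / norm z ^ 8"
      unfolding divide_inverse by (rule sum_list_mult_const)
    finally show ?thesis unfolding g_def sum_list_const_mult by (simp only:)
  qed
  have "(\<Sum>l\<leftarrow>As. line_avg l (convex hull P)) = (\<Sum>l\<leftarrow>As. (\<integral>\<^sup>+z. (\<integral>\<^sup>+x. g l z x \<partial>lborel) \<partial>lborel))"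
    using As by (intro arg_cong[of _ _ sum_list] map_cong refl) (simp add: line_avg_hull[OF P] g_def)
  also have "\<dots> = (\<integral>\<^sup>+z. (\<Sum>l\<leftarrow>As. (\<integral>\<^sup>+x. g l z x \<partial>lborel)) \<partial>lborel)"
    by (intro nn_integral_sum_list[symmetric] g2)
  also have "\<dots> = (\<integral>\<^sup>+z. (\<integral>\<^sup>+x. (\<Sum>l\<leftarrow>As. g l z x) \<partial>lborel) \<partial>lborel)"
    by (intro nn_integral_cong nn_integral_sum_list[symmetric] g1)
  also have "\<dots> = (\<integral>\<^sup>+z. (\<integral>\<^sup>+x. indicator (cball 0 (norm z)) x *
     ennreal ((\<Sum>l\<leftarrow>As. gibbs_area P x x (imag3 l x)) / norm z ^ 8) \<partial>lborel) \<partial>(lborel :: (real^2) measure))"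
    by (simp only: inner)
  finally show ?thesis .
qed

lemma measurable_shadow_imag3:
  assumes "compact K" "convex K"
  shows "(\<lambda>y. shadow K y (imag3 l y)) \<in> borel_measurable borel"
proof -
  have "(\<lambda>y. (y, imag3 l y)) \<in> borel_measurable borel"
    by (intro borel_measurable_continuous_onI continuous_intros)
  from measurable_compose[OF this measurable_shadow[OF assms]] show ?thesis by simp
qed

text \<open>
  The quadratic dependence on \<open>l\<close>: any two families with equal second moments \<open>\<Sum>\<^sub>l l \<otimes> l\<close> give the same sum. For
  polytopes this is visible in the integrand; the general case is a monotone limit.
\<close>
lemma sum_line_avg_cong:
  assumes K: "compact K" "convex K" "K \<noteq> {}"
    and As: "\<And>l. l \<in> set As \<Longrightarrow> unit3 l" and Bs: "\<And>l. l \<in> set Bs \<Longrightarrow> unit3 l"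
    and moments: "\<And>A B C D E F. (\<Sum>l\<leftarrow>As. quad A B C D E F l) = (\<Sum>l\<leftarrow>Bs. quad A B C D E F l)"
  shows "(\<Sum>l\<leftarrow>As. line_avg l K) = (\<Sum>l\<leftarrow>Bs. line_avg l K)"
proof -
  obtain P :: "nat \<Rightarrow> c2 set" where P: "\<And>n. finite (P n)" "\<And>n. P n \<noteq> {}"
    "\<And>v w. ennreal (shadow K v w) = (SUP n. ennreal (shadow (convex hull (P n)) v w))"
    "\<And>v w. incseq (\<lambda>n. ennreal (shadow (convex hull (P n)) v w))"
    using polytope_exhaustion[OF K] by metis
  have hullK: "compact (convex hull (P n))" for n by (simp add: P finite_imp_compact_convex_hull)
  define f where "f l n y = indicator (cball 0 1) y * ennreal (shadow (convex hull (P n)) y (imag3 l y))" for l n and y :: c2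
  have f_inc: "incseq (f l)" for l
    using P(4) unfolding f_def incseq_def le_fun_def by (auto intro!: mult_left_mono)
  have f_meas: "f l n \<in> borel_measurable lborel" for l n
    unfolding f_def
    by (intro borel_measurable_times_ennreal borel_measurable_indicator measurable_compose[OF _ measurable_ennreal])
       (simp_all add: measurable_shadow_imag3 hullK)
  have gamK: "line_avg l K = (SUP n. line_avg l (convex hull (P n)))" for l
  proof -
    have "line_avg l K = (\<integral>\<^sup>+y. (SUP n. f l n y) \<partial>lborel)"
      unfolding line_avg_eq P(3) f_def by (simp add: SUP_mult_left_ennreal)
    also have "\<dots> = (SUP n. (\<integral>\<^sup>+y. f l n y \<partial>lborel))"
      by (intro nn_integral_monotone_convergence_SUP f_inc f_meas)
    finally show ?thesis by (simp add: line_avg_eq f_def)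
  qed
  have inc: "incseq (\<lambda>n. line_avg l (convex hull (P n)))" for l
    unfolding line_avg_eq f_def[symmetric] using f_inc[of l]
    by (auto simp: incseq_def le_fun_def intro!: nn_integral_mono)
  have "(\<Sum>l\<leftarrow>As. gibbs_area (P n) x x (imag3 l x)) = (\<Sum>l\<leftarrow>Bs. gibbs_area (P n) x x (imag3 l x))" for n x
  proof -
    obtain A B C D E F where "\<And>l. gibbs_area (P n) x x (imag3 l x) = quad A B C D E F l"
      using gibbs_area_quad[of "P n" x] by blast
    then show ?thesis by (simp only: moments)
  qed
  then have "(\<Sum>l\<leftarrow>As. line_avg l (convex hull (P n))) = (\<Sum>l\<leftarrow>Bs. line_avg l (convex hull (P n)))" for n
    by (simp add: sum_line_avg_hull[OF P(1,2)] As Bs)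
  then show ?thesis
    unfolding gamK by (simp add: sum_list_SUP_ennreal[symmetric] inc)
qed

lemma shadow_scale:
  fixes K :: "'a::euclidean_space set"
  assumes "compact K" shows "shadow K (r *\<^sub>R v) (r *\<^sub>R w) = r\<^sup>2 * shadow K v w"
  using shadow_change_basis[OF assms, of r v 0 w 0 r] by (simp add: power2_eq_square)

text \<open>
  Both integrals are transforms of the integral over the ball of radius \<open>r\<close>.
\<close>
lemma line_avg_transport:
  assumes K: "compact K" "convex K" and S: "linear S" "\<And>y. norm (S y) = r * norm y" "r > 0"
  shows "(\<integral>\<^sup>+y. indicator (cball 0 1) (y::c2) * ennreal (shadow K (S y) (imag3 l (S y))) \<partial>lborel) = ennreal (r\<^sup>2) * line_avg l K"
proof -
  define f where "f x = indicator (cball 0 r) x * ennreal (shadow K x (imag3 l x))" for x :: c2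
  have f: "f \<in> borel_measurable borel"
    unfolding f_def
    by (intro borel_measurable_times_ennreal borel_measurable_indicator measurable_compose[OF _ measurable_ennreal])
       (simp_all add: measurable_shadow_imag3 K)
  have g: "(\<lambda>y. indicator (cball 0 1) (y::c2) * ennreal (shadow K y (imag3 l y))) \<in> borel_measurable borel"
    by (intro borel_measurable_times_ennreal borel_measurable_indicator measurable_compose[OF _ measurable_ennreal])
       (simp_all add: measurable_shadow_imag3 K)
  have ind: "indicator (cball 0 r) (T y) = (indicator (cball 0 1) y :: ennreal)"
    if "\<And>y. norm (T y) = r * norm y" for T :: "c2 \<Rightarrow> c2" and y
    using S(3) by (auto simp: indicator_def that)
  have "(\<integral>\<^sup>+x. f x \<partial>lborel) = ennreal (r ^ 4) * (\<integral>\<^sup>+y. f (S y) \<partial>lborel)"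
    by (rule nn_integral_similarity[OF S _ _ f]) auto
  moreover have "(\<integral>\<^sup>+x. f x \<partial>lborel) = ennreal (r ^ 4) * (\<integral>\<^sup>+y. f (r *\<^sub>R y) \<partial>lborel)"
    by (rule nn_integral_similarity[OF linear_scale_self _ S(3) _ _ f]) (use S in auto)
  ultimately have "(\<integral>\<^sup>+y. f (S y) \<partial>lborel) = (\<integral>\<^sup>+y. f (r *\<^sub>R y) \<partial>lborel)"
    using S(3) by (simp add: ennreal_mult_cancel_left)
  also have "\<dots> = (\<integral>\<^sup>+y. ennreal (r\<^sup>2) * (indicator (cball 0 1) y * ennreal (shadow K y (imag3 l y))) \<partial>lborel)"
    using S(3) by (intro nn_integral_cong)
      (simp add: f_def ind linear_scale[OF linear_imag3] shadow_scale[OF K(1)] ennreal_mult shadow_nonneg mult_ac)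
  also have "\<dots> = ennreal (r\<^sup>2) * line_avg l K"
    unfolding line_avg_eq using g by (intro nn_integral_cmult) simp
  finally show ?thesis by (simp add: f_def ind[OF S(2)])
qed

section \<open>Mixed second differences and projections\<close>

text \<open>
  Orthogonal vectors of common length \<open>r\<close> split the space into two planes, so that volumes of products can be
  computed by Fubini's theorem. The length is left arbitrary because the frames will be of the form
  \<open>x, lx, mx, lmx\<close> with arbitrary \<open>x \<noteq> 0\<close>.
\<close>
locale orth_frame =
  fixes e1 e2 e3 e4 :: "'a::euclidean_space" and r :: real
  assumes dim4: "DIM('a) = 4" and r: "r > 0"
    and norms: "e1 \<bullet> e1 = r\<^sup>2" "e2 \<bullet> e2 = r\<^sup>2" "e3 \<bullet> e3 = r\<^sup>2" "e4 \<bullet> e4 = r\<^sup>2"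
    and orth: "e1 \<bullet> e2 = 0" "e1 \<bullet> e3 = 0" "e1 \<bullet> e4 = 0" "e2 \<bullet> e3 = 0" "e2 \<bullet> e4 = 0" "e3 \<bullet> e4 = 0"
begin

definition frame :: "(real^2) \<times> (real^2) \<Rightarrow> 'a" where
  "frame z = fst z $ 1 *\<^sub>R e1 + fst z $ 2 *\<^sub>R e2 + snd z $ 1 *\<^sub>R e3 + snd z $ 2 *\<^sub>R e4"

lemma linear_frame: "linear frame"
  by (rule linearI) (simp_all add: frame_def algebra_simps)

lemma orth': "e2 \<bullet> e1 = 0" "e3 \<bullet> e1 = 0" "e4 \<bullet> e1 = 0" "e3 \<bullet> e2 = 0" "e4 \<bullet> e2 = 0" "e4 \<bullet> e3 = 0"
  using orth by (simp_all add: inner_commute)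

lemma frame_inner:
  "frame z \<bullet> e1 = r\<^sup>2 * fst z $ 1" "frame z \<bullet> e2 = r\<^sup>2 * fst z $ 2"
  "frame z \<bullet> e3 = r\<^sup>2 * snd z $ 1" "frame z \<bullet> e4 = r\<^sup>2 * snd z $ 2"
  by (simp_all add: frame_def inner_add_left norms orth orth')

lemma norm_frame: "norm (frame z) = r * norm z"
proof -
  have "(norm (frame z))\<^sup>2 = r\<^sup>2 * (norm z)\<^sup>2"
    unfolding power2_norm_eq_inner
    by (subst (2) frame_def)
       (simp add: inner_add_right frame_inner inner_prod_def inner_vec_def sum_2 algebra_simps power2_eq_square)
  then have "(norm (frame z))\<^sup>2 = (r * norm z)\<^sup>2" by (simp add: power_mult_distrib)
  then show ?thesis using r by (simp add: power2_eq_iff_nonneg)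
qed

lemma inj_frame: "inj frame"
proof (rule injI)
  fix x y assume "frame x = frame y"
  then have "norm (frame (x - y)) = 0" by (simp add: linear_diff[OF linear_frame])
  then show "x = y" using r by (simp add: norm_frame)
qed

lemma surj_frame: "surj frame"
proof -
  have "dim (range frame) = dim (UNIV :: ((real^2) \<times> (real^2)) set)"
    by (intro dim_image_eq linear_frame) (use inj_frame in auto)
  then have "dim (range frame) = DIM('a)" by (simp add: dim4)
  moreover have "subspace (range frame)" by (intro linear_subspace_image linear_frame subspace_UNIV)
  ultimately show ?thesis by (metis dim_eq_full span_eq_iff)
qed

lemma frame_coords: "frame ((1 / r\<^sup>2) *\<^sub>R coords e1 e2 z, (1 / r\<^sup>2) *\<^sub>R coords e3 e4 z) = z"
proof -
  obtain w where w: "z = frame w" using surj_frame by blast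
  have "((1 / r\<^sup>2) *\<^sub>R coords e1 e2 z, (1 / r\<^sup>2) *\<^sub>R coords e3 e4 z) = w"
    using r by (simp add: w prod_eq_iff vec_eq_iff forall_2 frame_inner)
  then show ?thesis by (simp add: w)
qed

lemma vol_frame_Times:
  assumes B: "compact B" and A: "compact A"
  shows "vol (frame ` (B \<times> A)) = r ^ 4 * (vol B * vol A)"
proof -
  have cpt: "compact (frame ` (B \<times> A))"
    by (intro compact_continuous_image continuous_on_linear linear_frame compact_Times A B)
  have "(\<integral>\<^sup>+x. indicator (frame ` (B \<times> A)) x \<partial>lborel) = ennreal (r ^ 4) * (\<integral>\<^sup>+z. indicator (frame ` (B \<times> A)) (frame z) \<partial>lborel)"
    by (rule nn_integral_similarity[OF linear_frame norm_frame r]) (use cpt dim4 in \<open>auto simp: compact_imp_closed\<close>)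
  also have "(\<lambda>z. indicator (frame ` (B \<times> A)) (frame z) :: ennreal) = indicator (B \<times> A)"
    using inj_frame by (auto simp: indicator_def inj_image_mem_iff)
  also have "(\<integral>\<^sup>+z. indicator (B \<times> A) z \<partial>lborel) = emeasure (lborel \<Otimes>\<^sub>M lborel) (B \<times> A)"
    unfolding lborel_prod by (rule nn_integral_indicator) (auto simp: compact_imp_closed compact_Times A B)
  also have "\<dots> = emeasure lborel B * emeasure lborel A"
    by (rule lborel.emeasure_pair_measure_Times) (auto simp: compact_imp_closed A B)
  finally have "emeasure lborel (frame ` (B \<times> A)) = ennreal (r ^ 4) * (emeasure lborel B * emeasure lborel A)"
    using cpt by (simp add: compact_imp_closed)
  then have "measure lborel (frame ` (B \<times> A)) = r ^ 4 * (measure lborel B * measure lborel A)"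
    using r by (simp add: measure_def enn2real_mult)
  then show ?thesis using cpt A B by (simp add: compact_imp_closed)
qed

text \<open>
  The prism with parallelogram base spanned by multiples of \<open>e1\<close> and \<open>\<alpha> e1 + \<beta> e2\<close> over the projection of \<open>K\<close> to
  \<open>span {e3, e4}\<close>; the points of that projection have coordinates \<open>(1/r\<^sup>2) (z \<bullet> e3, z \<bullet> e4)\<close>.
\<close>
lemma vol_frame_parallelogram:
  fixes \<alpha> \<beta> a b :: real
  assumes K: "compact K" and ab: "a \<le> b"
  defines "N \<equiv> (\<lambda>p :: real^2. vector [p $ 1 + \<alpha> * p $ 2, \<beta> * p $ 2] :: real^2)"
  shows "vol (frame ` (N ` cbox (vector [a, a]) (vector [b, b]) \<times> (*\<^sub>R) (1 / r\<^sup>2) ` coords e3 e4 ` K))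
    = (b - a)\<^sup>2 * (\<bar>\<beta>\<bar> * shadow K e3 e4)"
    "compact (frame ` (N ` cbox (vector [a, a]) (vector [b, b]) \<times> (*\<^sub>R) (1 / r\<^sup>2) ` coords e3 e4 ` K))"
proof -
  let ?Q = "cbox (vector [a, a]) (vector [b, b]) :: (real^2) set"
  let ?A = "(*\<^sub>R) (1 / r\<^sup>2) ` coords e3 e4 ` K"
  have N: "N = (*v) (vector [vector [1, \<alpha>], vector [0, \<beta>]] :: real^2^2)"
    by (auto simp: N_def fun_eq_iff vec_eq_iff forall_2 matrix_vector_mult_def sum_2)
  have linN: "linear N" unfolding N by simp
  have cN: "compact (N ` ?Q)" by (intro compact_continuous_image continuous_on_linear linN compact_cbox)
  have cA: "compact ?A" by (intro compact_scaling compact_coords K)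
  have volQ: "vol ?Q = (b - a)\<^sup>2"
  proof -
    have "?Q \<noteq> {}" using ab by (auto simp: interval_ne_empty_cart forall_2)
    then show ?thesis by (simp add: content_cbox_cart prod_2 UNIV_2 power2_eq_square)
  qed
  have "vol (N ` ?Q) = \<bar>\<beta>\<bar> * (b - a)\<^sup>2"
    using measure_linear_image[OF linN lmeasurable_cbox, of "vector [a, a]" "vector [b, b]"]
    unfolding volQ by (simp add: N matrix_of_matrix_vector_mul det_2)
  moreover have "vol ?A = (1 / r\<^sup>2)\<^sup>2 * shadow K e3 e4"
    using measure_lebesgue_affine[of "1 / r\<^sup>2" "0 :: real^2" "coords e3 e4 ` K"]
    by (simp add: shadow_def)
  ultimately have "vol (frame ` (N ` ?Q \<times> ?A)) =
    (r ^ 4 * (1 / r\<^sup>2)\<^sup>2) * ((b - a)\<^sup>2 * (\<bar>\<beta>\<bar> * shadow K e3 e4))"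
    unfolding vol_frame_Times[OF cN cA] by (simp only: mult_ac)
  moreover have "r ^ 4 * (1 / r\<^sup>2)\<^sup>2 = 1"
    using r by (simp add: power_divide)
  ultimately show "vol (frame ` (N ` ?Q \<times> ?A)) = (b - a)\<^sup>2 * (\<bar>\<beta>\<bar> * shadow K e3 e4)"
    by (simp only: mult_1)
  show "compact (frame ` (N ` ?Q \<times> ?A))"
    by (intro compact_continuous_image continuous_on_linear linear_frame compact_Times cN cA)
qed

text \<open>
  For large \<open>s\<close> the body \<open>K + [0, s e\<^sub>1] + [0, s v]\<close> is squeezed between two parallelogram prisms over
  the projection of \<open>K\<close> along \<open>e\<^sub>1\<close> and \<open>v\<close>.
\<close>
lemma mixed_diff_eq_shadow_nonparallel:
  assumes K: "compact K" "convex K" and b: "\<beta> \<noteq> 0"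
  shows "mixed_diff K e1 (\<alpha> *\<^sub>R e1 + \<beta> *\<^sub>R e2) = \<bar>\<beta>\<bar> * shadow K e3 e4"
proof -
  define v where "v = \<alpha> *\<^sub>R e1 + \<beta> *\<^sub>R e2"
  define N where "N = (\<lambda>p :: real^2. vector [p $ 1 + \<alpha> * p $ 2, \<beta> * p $ 2] :: real^2)"
  define A where "A = (*\<^sub>R) (1 / r\<^sup>2) ` coords e3 e4 ` K"
  define Q where "Q a b = (cbox (vector [a, a]) (vector [b, b]) :: (real^2) set)" for a b :: real
  have mem_Q: "p \<in> Q a b \<longleftrightarrow> a \<le> p $ 1 \<and> p $ 1 \<le> b \<and> a \<le> p $ 2 \<and> p $ 2 \<le> b" for p a b
    by (auto simp: Q_def mem_box_cart forall_2)
  have vQ: "vol (frame ` (N ` Q a b \<times> A)) = (b - a)\<^sup>2 * (\<bar>\<beta>\<bar> * shadow K e3 e4)"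
    "compact (frame ` (N ` Q a b \<times> A))" if "a \<le> b" for a b
    using vol_frame_parallelogram[OF K(1) that, of \<alpha> \<beta>] by (auto simp: N_def Q_def A_def)
  have Nadd: "frame (N p, q) + (s *\<^sub>R e1 + t *\<^sub>R v) = frame (N (vector [p $ 1 + s, p $ 2 + t]), q)" for p q s t
    by (simp add: frame_def N_def v_def algebra_simps)
  \<comment> \<open>The coordinates of \<open>z\<close> with respect to \<open>e1\<close> and \<open>v\<close>, modulo \<open>span {e3, e4}\<close>.\<close>
  define c1 c2 where "c1 z = (z \<bullet> e1 / r\<^sup>2) - \<alpha> * (z \<bullet> e2 / r\<^sup>2 / \<beta>)" and "c2 z = z \<bullet> e2 / r\<^sup>2 / \<beta>" for z
  have rep: "z = frame (N (vector [c1 z, c2 z]), (1 / r\<^sup>2) *\<^sub>R coords e3 e4 z)" for z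
  proof -
    have "N (vector [c1 z, c2 z]) = (1 / r\<^sup>2) *\<^sub>R coords e1 e2 z"
      using b by (simp add: N_def c1_def c2_def vec_eq_iff forall_2)
    then show ?thesis by (simp add: frame_coords)
  qed
  have "continuous_on K (\<lambda>z. max \<bar>c1 z\<bar> \<bar>c2 z\<bar>)"
    using r b unfolding c1_def c2_def by (intro continuous_intros) auto
  then have bdd: "bounded ((\<lambda>z. max \<bar>c1 z\<bar> \<bar>c2 z\<bar>) ` K)"
    using K compact_continuous_image compact_imp_bounded by blast
  obtain R where R: "R > 0" "\<And>z. z \<in> K \<Longrightarrow> \<bar>c1 z\<bar> \<le> R" "\<And>z. z \<in> K \<Longrightarrow> \<bar>c2 z\<bar> \<le> R"
  proof -
    obtain R where R: "R > 0" "\<forall>x\<in>(\<lambda>z. max \<bar>c1 z\<bar> \<bar>c2 z\<bar>) ` K. norm x \<le> R"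
      using bdd unfolding bounded_pos by blast
    then have "max \<bar>c1 z\<bar> \<bar>c2 z\<bar> \<le> R" if "z \<in> K" for z using that by force
    then show ?thesis using R(1) that by simp
  qed
  define g where "g s = vol (K + seg (s *\<^sub>R e1) + seg (s *\<^sub>R v))" for s :: real
  have cpt: "compact (K + seg (s *\<^sub>R e1) + seg (s *\<^sub>R v))" for s
    using K by (intro compact_set_plus compact_seg)
  have mem: "x \<in> K + seg (s *\<^sub>R e1) + seg (s *\<^sub>R v) \<longleftrightarrow>
    (\<exists>z\<in>K. \<exists>\<sigma> \<tau>. 0 \<le> \<sigma> \<and> \<sigma> \<le> s \<and> 0 \<le> \<tau> \<and> \<tau> \<le> s \<and> x = z + (\<sigma> *\<^sub>R e1 + \<tau> *\<^sub>R v))" if s0: "s \<ge> 0" for x s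
  proof
    assume "x \<in> K + seg (s *\<^sub>R e1) + seg (s *\<^sub>R v)"
    then obtain z a b where z: "z \<in> K" "a \<in> seg (s *\<^sub>R e1)" "b \<in> seg (s *\<^sub>R v)" "x = z + a + b"
      by (auto simp: set_plus_def)
    moreover obtain \<sigma> where "0 \<le> \<sigma>" "\<sigma> \<le> s" "a = \<sigma> *\<^sub>R e1"
      using z(2) s0 by (auto simp: mem_seg_scaleR_iff)
    moreover obtain \<tau> where "0 \<le> \<tau>" "\<tau> \<le> s" "b = \<tau> *\<^sub>R v"
      using z(3) s0 by (auto simp: mem_seg_scaleR_iff)
    ultimately show "\<exists>z\<in>K. \<exists>\<sigma> \<tau>. 0 \<le> \<sigma> \<and> \<sigma> \<le> s \<and> 0 \<le> \<tau> \<and> \<tau> \<le> s \<and> x = z + (\<sigma> *\<^sub>R e1 + \<tau> *\<^sub>R v)"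
      by (intro bexI[of _ z] exI[of _ \<sigma>] exI[of _ \<tau>]) (simp_all add: add.assoc)
  next
    assume "\<exists>z\<in>K. \<exists>\<sigma> \<tau>. 0 \<le> \<sigma> \<and> \<sigma> \<le> s \<and> 0 \<le> \<tau> \<and> \<tau> \<le> s \<and> x = z + (\<sigma> *\<^sub>R e1 + \<tau> *\<^sub>R v)"
    then obtain z \<sigma> \<tau> where z: "z \<in> K" "0 \<le> \<sigma>" "\<sigma> \<le> s" "0 \<le> \<tau>" "\<tau> \<le> s" "x = z + \<sigma> *\<^sub>R e1 + \<tau> *\<^sub>R v"
      by (auto simp: add.assoc)
    have "\<sigma> *\<^sub>R e1 \<in> seg (s *\<^sub>R e1)" "\<tau> *\<^sub>R v \<in> seg (s *\<^sub>R v)"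
      unfolding mem_seg_scaleR_iff[OF s0] using z by blast+
    then show "x \<in> K + seg (s *\<^sub>R e1) + seg (s *\<^sub>R v)" unfolding z(6) using z(1) by (intro set_plus_intro)
  qed
  have upper: "g s \<le> (s + 2 * R)\<^sup>2 * (\<bar>\<beta>\<bar> * shadow K e3 e4)" if s: "s \<ge> 2 * R" for s
  proof -
    have "K + seg (s *\<^sub>R e1) + seg (s *\<^sub>R v) \<subseteq> frame ` (N ` Q (- R) (s + R) \<times> A)"
    proof
      fix x assume "x \<in> K + seg (s *\<^sub>R e1) + seg (s *\<^sub>R v)"
      then obtain z \<sigma> \<tau> where z: "z \<in> K" "0 \<le> \<sigma>" "\<sigma> \<le> s" "0 \<le> \<tau>" "\<tau> \<le> s" "x = z + (\<sigma> *\<^sub>R e1 + \<tau> *\<^sub>R v)"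
        using mem[of s] s R by auto
      have "x = frame (N (vector [c1 z + \<sigma>, c2 z + \<tau>]), (1 / r\<^sup>2) *\<^sub>R coords e3 e4 z)"
        unfolding z(6) by (subst rep[of z], subst Nadd) simp
      moreover have "vector [c1 z + \<sigma>, c2 z + \<tau>] \<in> Q (- R) (s + R)"
        using R(2,3)[OF z(1)] z by (auto simp: mem_Q)
      ultimately show "x \<in> frame ` (N ` Q (- R) (s + R) \<times> A)" using z(1) by (auto simp: A_def)
    qed
    then have "g s \<le> vol (frame ` (N ` Q (- R) (s + R) \<times> A))"
      unfolding g_def using vQ(2)[of "- R" "s + R"] R s by (intro vol_mono cpt) auto
    then show ?thesis using vQ(1)[of "- R" "s + R"] R s by (simp add: add.commute)
  qed
  have lower: "(s - 2 * R)\<^sup>2 * (\<bar>\<beta>\<bar> * shadow K e3 e4) \<le> g s" if s: "s \<ge> 2 * R" for s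
  proof -
    have "frame ` (N ` Q R (s - R) \<times> A) \<subseteq> K + seg (s *\<^sub>R e1) + seg (s *\<^sub>R v)"
    proof
      fix x assume "x \<in> frame ` (N ` Q R (s - R) \<times> A)"
      then obtain p z where pz: "p \<in> Q R (s - R)" "z \<in> K" "x = frame (N p, (1 / r\<^sup>2) *\<^sub>R coords e3 e4 z)"
        by (auto simp: A_def)
      have xz: "x = z + ((p $ 1 - c1 z) *\<^sub>R e1 + (p $ 2 - c2 z) *\<^sub>R v)"
      proof -
        have "vector [c1 z + (p $ 1 - c1 z), c2 z + (p $ 2 - c2 z)] = p" by (simp add: vec_eq_iff forall_2)
        then have "frame (N p, (1 / r\<^sup>2) *\<^sub>R coords e3 e4 z) =
          frame (N (vector [c1 z, c2 z]), (1 / r\<^sup>2) *\<^sub>R coords e3 e4 z) + ((p $ 1 - c1 z) *\<^sub>R e1 + (p $ 2 - c2 z) *\<^sub>R v)"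
          by (subst Nadd) simp
        then show ?thesis using pz(3) rep[of z] by metis
      qed
      have "0 \<le> p $ 1 - c1 z \<and> p $ 1 - c1 z \<le> s \<and> 0 \<le> p $ 2 - c2 z \<and> p $ 2 - c2 z \<le> s"
        using R(2,3)[OF pz(2)] pz(1) by (auto simp: mem_Q)
      with xz pz(2) have "\<exists>z\<in>K. \<exists>\<sigma> \<tau>. 0 \<le> \<sigma> \<and> \<sigma> \<le> s \<and> 0 \<le> \<tau> \<and> \<tau> \<le> s \<and> x = z + (\<sigma> *\<^sub>R e1 + \<tau> *\<^sub>R v)"
        by blast
      then show "x \<in> K + seg (s *\<^sub>R e1) + seg (s *\<^sub>R v)"
        using mem[of s x] s R(1) by simp
    qed
    then have "vol (frame ` (N ` Q R (s - R) \<times> A)) \<le> g s"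
      unfolding g_def using vQ(2)[of R "s - R"] R s by (intro vol_mono cpt) auto
    then show ?thesis using vQ(1)[of R "s - R"] R s by (simp add: algebra_simps)
  qed
  define S where "S = \<bar>\<beta>\<bar> * shadow K e3 e4"
  define D where "D = (vol (K + seg e1) - vol K) + (vol (K + seg v) - vol K)"
  define F where "F = mixed_diff K e1 v"
  have g_poly: "g s = vol K + s * D + s\<^sup>2 * F" if s: "s \<ge> 0" for s
  proof -
    have c: "compact (K + seg (s *\<^sub>R e1))" "convex (K + seg (s *\<^sub>R e1))" "compact (K + seg v)" "convex (K + seg v)"
      using K by (auto intro: compact_set_plus convex_set_plus)
    have "K + seg (s *\<^sub>R e1) + seg v = K + seg v + seg (s *\<^sub>R e1)" "K + seg v + seg e1 = K + seg e1 + seg v"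
      by (simp_all add: ac_simps)
    then have 3: "vol (K + seg (s *\<^sub>R e1) + seg v) = vol (K + seg v) + s * (vol (K + seg e1 + seg v) - vol (K + seg v))"
      using vol_plus_seg_affine[OF c(3,4) s, of e1] by simp
    have gen: "y = k + s * ((e - k) + (w - k)) + s\<^sup>2 * (d - e - w + k)"
      if "y = a + s * (b - a)" "a = k + s * (e - k)" "b = w + s * (d - w)" for y a b k e w d :: real
      unfolding that by (simp add: power2_eq_square algebra_simps)
    show ?thesis
      unfolding g_def F_def mixed_diff_def D_def
      by (rule gen[OF vol_plus_seg_affine[OF c(1,2) s, of v] vol_plus_seg_affine[OF K s, of e1] 3])
  qed
  have "((\<lambda>s. (vol K + s * D + s\<^sup>2 * F) / s\<^sup>2) \<longlongrightarrow> F) at_top" by real_asymp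
  moreover have "((\<lambda>s. (vol K + s * D + s\<^sup>2 * F) / s\<^sup>2) \<longlongrightarrow> S) at_top"
  proof (rule tendsto_sandwich)
    show "((\<lambda>s. (s - 2 * R)\<^sup>2 * S / s\<^sup>2) \<longlongrightarrow> S) at_top" "((\<lambda>s. (s + 2 * R)\<^sup>2 * S / s\<^sup>2) \<longlongrightarrow> S) at_top"
      by real_asymp+
    show "\<forall>\<^sub>F s in at_top. (s - 2 * R)\<^sup>2 * S / s\<^sup>2 \<le> (vol K + s * D + s\<^sup>2 * F) / s\<^sup>2"
      using eventually_ge_at_top[of "2 * R"]
      by eventually_elim (use lower g_poly R in \<open>auto simp: S_def intro!: divide_right_mono\<close>)
    show "\<forall>\<^sub>F s in at_top. (vol K + s * D + s\<^sup>2 * F) / s\<^sup>2 \<le> (s + 2 * R)\<^sup>2 * S / s\<^sup>2"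
      using eventually_ge_at_top[of "2 * R"]
      by eventually_elim (use upper g_poly R in \<open>auto simp: S_def intro!: divide_right_mono\<close>)
  qed
  ultimately have "F = S" using tendsto_unique[OF trivial_limit_at_top_linorder] by blast
  then show ?thesis by (simp add: F_def S_def v_def)
qed

end

text \<open>
  Along a single direction the volume is affine in the length of the segment, so the second difference
  vanishes.
\<close>
lemma mixed_diff_parallel:
  fixes K :: "'a::euclidean_space set"
  assumes K: "compact K" "convex K"
  shows "mixed_diff K u (a *\<^sub>R u) = 0"
proof -
  have main: "mixed_diff K u (a *\<^sub>R u) = 0" if a: "a \<ge> 0" for a
  proof -
    have c: "compact (K + seg u)" "convex (K + seg u)"
      using K by (auto intro: compact_set_plus convex_set_plus)
    have 2: "vol (K + seg (2 *\<^sub>R u)) = 2 * vol (K + seg u) - vol K"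
      using vol_plus_seg_affine[OF K, of 2 u] by simp
    have "K + seg u + seg u = K + seg (2 *\<^sub>R u)"
    proof -
      have "seg u + seg u = seg (2 *\<^sub>R u)"
      proof (intro equalityI subsetI)
        fix x assume "x \<in> seg (2 *\<^sub>R u)"
        then obtain t where t: "0 \<le> t" "t \<le> 2" "x = t *\<^sub>R u" by (auto simp: mem_seg_scaleR_iff)
        then have "(t / 2) *\<^sub>R u + (t / 2) *\<^sub>R u \<in> seg u + seg u"
          by (intro set_plus_intro) (auto simp: mem_seg_iff intro!: exI[of _ "t / 2"])
        then show "x \<in> seg u + seg u" using t by (simp add: scaleR_add_left[symmetric])
      next
        fix x assume "x \<in> seg u + seg u"
        then obtain s t where "0 \<le> s" "s \<le> 1" "0 \<le> t" "t \<le> 1" "x = s *\<^sub>R u + t *\<^sub>R u"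
          by (auto simp: set_plus_def mem_seg_iff)
        then show "x \<in> seg (2 *\<^sub>R u)"
          by (subst mem_seg_scaleR_iff) (auto intro!: exI[of _ "s + t"] simp: scaleR_add_left)
      qed
      then show ?thesis by (simp add: add.assoc)
    qed
    then show ?thesis
      using vol_plus_seg_affine[OF K a, of u] vol_plus_seg_affine[OF c a, of u] 2
      by (simp add: mixed_diff_def algebra_simps)
  qed
  show ?thesis
  proof (cases "a \<ge> 0")
    case False
    have neg: "seg (- w) = seg w + {- w}" for w :: 'a
    proof (intro equalityI subsetI)
      fix x assume "x \<in> seg (- w)"
      then obtain t where t: "0 \<le> t" "t \<le> 1" "x = t *\<^sub>R (- w)" by (auto simp: mem_seg_iff)
      then have "(1 - t) *\<^sub>R w \<in> seg w" unfolding mem_seg_iff by (intro exI[of _ "1 - t"]) auto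
      moreover have "x = (1 - t) *\<^sub>R w + - w" using t by (simp add: algebra_simps)
      ultimately show "x \<in> seg w + {- w}" by (metis insertI1 set_plus_intro)
    next
      fix x assume "x \<in> seg w + {- w}"
      then obtain t where t: "0 \<le> t" "t \<le> 1" "x = t *\<^sub>R w + - w" by (auto simp: mem_seg_iff set_plus_def)
      then show "x \<in> seg (- w)" unfolding mem_seg_iff by (intro exI[of _ "1 - t"]) (auto simp: algebra_simps)
    qed
    define w where "w = (- a) *\<^sub>R u"
    have aw: "a *\<^sub>R u = - w" by (simp add: w_def)
    have "mixed_diff K u (- w) = mixed_diff K u w"
      by (simp add: mixed_diff_def neg add.assoc[symmetric] vol_plus_singleton)
    moreover have "mixed_diff K u w = 0" unfolding w_def using False by (intro main) simp
    ultimately show ?thesis by (simp only: aw)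
  qed (rule main)
qed

context orth_frame
begin

lemma mixed_diff_eq_shadow:
  assumes K: "compact K" "convex K"
  shows "mixed_diff K e1 (\<alpha> *\<^sub>R e1 + \<beta> *\<^sub>R e2) = \<bar>\<beta>\<bar> * shadow K e3 e4"
  using mixed_diff_eq_shadow_nonparallel[OF K, of \<beta> \<alpha>] mixed_diff_parallel[OF K, of e1 \<alpha>]
  by (cases "\<beta> = 0") simp_all

end

section \<open>Rotations by quaternions\<close>

text \<open>
  The right multiplication that commutes with all left multiplications \<open>imag a b c\<close> and maps \<open>(1, 0)\<close> to \<open>y\<close>:
  \<open>|y|\<close> times an element of \<open>SU(2)\<close>. As a quaternion product it is also linear in \<open>y\<close>.
\<close>
definition right_sim :: "c2 \<Rightarrow> c2 \<Rightarrow> c2" where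
  "right_sim y x = x $ 1 *s y + x $ 2 *s qJ y"

lemma right_sim_nth [simp]:
  "right_sim y x $ 1 = x $ 1 * y $ 1 - x $ 2 * cnj (y $ 2)"
  "right_sim y x $ 2 = x $ 1 * y $ 2 + x $ 2 * cnj (y $ 1)"
  by (simp_all add: right_sim_def qJ_def)

lemma linear_right_sim_right: "linear (right_sim y)"
  by (rule linearI) (simp_all add: c2_simps algebra_simps)

lemma linear_right_sim_left: "linear (\<lambda>y. right_sim y x)"
  by (rule linearI) (simp_all add: c2_simps algebra_simps)

lemma inner_right_sim: "right_sim y x \<bullet> right_sim y x' = (y \<bullet> y) * (x \<bullet> x')"
  by (simp add: c2_simps algebra_simps)

lemma norm_right_sim: "norm (right_sim y x) = norm y * norm x"
  by (simp add: norm_eq_sqrt_inner inner_right_sim real_sqrt_mult)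

lemma imag_right_sim: "imag a b c (right_sim y x) = right_sim y (imag a b c x)"
  by (simp add: c2_simps algebra_simps)

lemma imag3_right_sim: "imag3 l (right_sim y x) = right_sim y (imag3 l x)"
  by (cases l) (simp add: imag3_def imag_right_sim)

type_synonym quat = "real \<times> real \<times> real \<times> real"

text \<open>
  Left multiplication by the quaternion \<open>r + aI + bJ + cK\<close>.
\<close>
definition quat_mult :: "quat \<Rightarrow> c2 \<Rightarrow> c2" where
  "quat_mult = (\<lambda>(r, a, b, c) x. r *\<^sub>R x + imag a b c x)"

text \<open>
  Representatives modulo \<open>\<plusminus>1\<close> of the binary tetrahedral group. Acting by conjugation on the imaginary quaternions they
  generate the even sign changes and the cyclic permutations of the coordinates, which is enough to average every
  quadratic form to its trace.
\<close>
definition tetrahedral :: "quat list" where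
  "tetrahedral = [(1,0,0,0), (0,1,0,0), (0,0,1,0), (0,0,0,1)] @
    [(1/2, a, b, c). a \<leftarrow> [1/2, -1/2], b \<leftarrow> [1/2, -1/2], c \<leftarrow> [1/2, -1/2]]"

text \<open>
  Conjugation of the imaginary quaternion \<open>aI + bJ + cK\<close> by \<open>r + pI + qJ + sK\<close>, times the squared norm of the latter.
\<close>
definition quat_rot :: "quat \<Rightarrow> real \<times> real \<times> real \<Rightarrow> real \<times> real \<times> real" where
  "quat_rot = (\<lambda>(r, p, q, s) (a, b, c).
     ((r\<^sup>2 + p\<^sup>2 - q\<^sup>2 - s\<^sup>2) * a + 2 * (p * q - r * s) * b + 2 * (p * s + r * q) * c,
      2 * (p * q + r * s) * a + (r\<^sup>2 - p\<^sup>2 + q\<^sup>2 - s\<^sup>2) * b + 2 * (q * s - r * p) * c,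
      2 * (p * s - r * q) * a + 2 * (q * s + r * p) * b + (r\<^sup>2 - p\<^sup>2 - q\<^sup>2 + s\<^sup>2) * c))"

lemma linear_quat_mult: "linear (quat_mult p)"
proof -
  obtain r a b c where "p = (r, a, b, c)" by (cases p)
  then have "quat_mult p = (\<lambda>x. r *\<^sub>R x + imag a b c x)" by (simp add: quat_mult_def fun_eq_iff)
  then show ?thesis
    by (simp add: linear_compose_add linear_compose_scale_right linear_ident linear_imag)
qed

lemma tetrahedral_unit:
  assumes "(r, a, b, c) \<in> set tetrahedral" shows "r\<^sup>2 + a\<^sup>2 + b\<^sup>2 + c\<^sup>2 = 1"
proof -
  have "\<forall>p\<in>set tetrahedral. case p of (r, a, b, c) \<Rightarrow> r\<^sup>2 + a\<^sup>2 + b\<^sup>2 + c\<^sup>2 = 1"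
    by (simp add: tetrahedral_def power_divide)
  with assms show ?thesis by fastforce
qed

lemma norm_quat_mult: "p \<in> set tetrahedral \<Longrightarrow> norm (quat_mult p x) = norm x"
proof -
  assume p: "p \<in> set tetrahedral"
  obtain r a b c where abc: "p = (r, a, b, c)" by (cases p)
  have "quat_mult p x \<bullet> quat_mult p x = (r\<^sup>2 + a\<^sup>2 + b\<^sup>2 + c\<^sup>2) * (x \<bullet> x)"
    using inner_imag[of a b c x a b c]
    by (simp add: abc quat_mult_def inner_add_left inner_add_right power2_eq_square algebra_simps)
  then show ?thesis using tetrahedral_unit p by (simp add: abc norm_eq_sqrt_inner)
qed

lemma quat_mult_imag_general:
  "imag3 (quat_rot (r, p, q, s) (a, b, c)) (quat_mult (r, p, q, s) x) = (r\<^sup>2 + p\<^sup>2 + q\<^sup>2 + s\<^sup>2) *\<^sub>R quat_mult (r, p, q, s) (imag3 (a, b, c) x)"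
  unfolding vec_eq_iff forall_2 complex_eq_iff
  by (simp add: quat_rot_def imag3_def quat_mult_def; algebra)

lemma quat_mult_imag3:
  assumes "p \<in> set tetrahedral" shows "quat_mult p (imag3 l x) = imag3 (quat_rot p l) (quat_mult p x)"
  using quat_mult_imag_general tetrahedral_unit assms
  by (cases p, cases l) auto

lemma unit3_quat_rot:
  assumes "p \<in> set tetrahedral" "unit3 l" shows "unit3 (quat_rot p l)"
proof -
  have key: "(case quat_rot (r, p, q, s) (a, b, c) of (x, y, z) \<Rightarrow> x\<^sup>2 + y\<^sup>2 + z\<^sup>2) = (r\<^sup>2 + p\<^sup>2 + q\<^sup>2 + s\<^sup>2)\<^sup>2 * (a\<^sup>2 + b\<^sup>2 + c\<^sup>2)"
    for r p q s a b c
    unfolding quat_rot_def prod.case by algebra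
  obtain r p' q s where p: "p = (r, p', q, s)" by (cases p)
  obtain a b c where l: "l = (a, b, c)" by (cases l)
  obtain x y z where xyz: "quat_rot p l = (x, y, z)" by (cases "quat_rot p l")
  then have "x\<^sup>2 + y\<^sup>2 + z\<^sup>2 = (r\<^sup>2 + p'\<^sup>2 + q\<^sup>2 + s\<^sup>2)\<^sup>2 * (a\<^sup>2 + b\<^sup>2 + c\<^sup>2)"
    using key[of r p' q s a b c] by (simp add: p l)
  moreover have "r\<^sup>2 + p'\<^sup>2 + q\<^sup>2 + s\<^sup>2 = 1" using tetrahedral_unit assms(1) p by blast
  moreover have "a\<^sup>2 + b\<^sup>2 + c\<^sup>2 = 1" using assms(2) by (simp add: unit3_def l)
  ultimately show ?thesis by (simp add: unit3_def xyz)
qed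

text \<open>
  The trace of the quadratic form \<open>l \<mapsto> \<Gamma>\<^sub>l(K)\<close>, unnormalised.
\<close>
definition Theta :: "c2 set \<Rightarrow> ennreal" where
  "Theta K = line_avg (1, 0, 0) K + line_avg (0, 1, 0) K + line_avg (0, 0, 1) K"

text \<open>
  The second moments of the orbit of \<open>l\<close> under the twelve rotations are those of four copies of \<open>I, J, K\<close>.
\<close>
lemma sum_tetrahedral_line_avg:
  assumes K: "compact K" "convex K" "K \<noteq> {}" and l: "unit3 l"
  shows "(\<Sum>p\<leftarrow>tetrahedral. line_avg (quat_rot p l) K) = 4 * Theta K"
proof -
  define Bs :: "(real \<times> real \<times> real) list" where "Bs = concat (replicate 4 [(1, 0, 0), (0, 1, 0), (0, 0, 1)])"
  obtain a b c where abc: "l = (a, b, c)" by (cases l)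
  have "(\<Sum>l\<leftarrow>map (\<lambda>p. quat_rot p l) tetrahedral. line_avg l K) = (\<Sum>l\<leftarrow>Bs. line_avg l K)"
  proof (rule sum_line_avg_cong[OF K])
    fix A B C D E F
    have "(\<Sum>l\<leftarrow>map (\<lambda>p. quat_rot p l) tetrahedral. quad A B C D E F l) = 4 * (a\<^sup>2 + b\<^sup>2 + c\<^sup>2) * (A + B + C)"
      by (simp add: tetrahedral_def abc quat_rot_def quad_def) algebra
    also have "\<dots> = (\<Sum>l\<leftarrow>Bs. quad A B C D E F l)"
      using l by (simp add: Bs_def quad_def unit3_def abc eval_nat_numeral)
    finally show "(\<Sum>l\<leftarrow>map (\<lambda>p. quat_rot p l) tetrahedral. quad A B C D E F l) = (\<Sum>l\<leftarrow>Bs. quad A B C D E F l)" .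
  next
    show "unit3 l'" if "l' \<in> set (map (\<lambda>p. quat_rot p l) tetrahedral)" for l'
      using that unit3_quat_rot[OF _ l] by (metis (no_types, lifting) imageE set_map)
    show "unit3 l'" if "l' \<in> set Bs" for l' using that by (auto simp: Bs_def unit3_def)
  qed
  moreover have "(\<Sum>l\<leftarrow>Bs. line_avg l K) = (\<Sum>L\<leftarrow>replicate 4 [(1, 0, 0), (0, 1, 0), (0, 0, 1)]. \<Sum>l\<leftarrow>L. line_avg l K)"
  proof -
    have "(\<Sum>l\<leftarrow>concat Ls. f l) = (\<Sum>L\<leftarrow>Ls. \<Sum>l\<leftarrow>L. f l)" for Ls and f :: "_ \<Rightarrow> ennreal"
      by (induction Ls) auto
    then show ?thesis unfolding Bs_def .
  qed
  moreover have "\<dots> = 4 * Theta K"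
    by (simp add: Theta_def sum_list_replicate add.assoc)
  ultimately show ?thesis by (simp add: o_def)
qed

text \<open>
  The vectors \<open>u, Iu, Ju, Ku\<close> form an orthogonal basis.
\<close>
lemma c2_decomposition:
  assumes "u \<noteq> (0 :: c2)"
  obtains \<alpha> \<beta> l where "unit3 l" "v = \<alpha> *\<^sub>R u + \<beta> *\<^sub>R imag3 l u"
proof -
  define n where "n = u \<bullet> u"
  have n: "n > 0" using assms by (simp add: n_def)
  define a b c where "a = (v \<bullet> imag 1 0 0 u) / n" and "b = (v \<bullet> imag 0 1 0 u) / n" and "c = (v \<bullet> imag 0 0 1 u) / n"
  have "n *\<^sub>R v = (v \<bullet> u) *\<^sub>R u + imag (v \<bullet> imag 1 0 0 u) (v \<bullet> imag 0 1 0 u) (v \<bullet> imag 0 0 1 u) u"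
    unfolding vec_eq_iff forall_2 complex_eq_iff
    by (simp add: n_def inner_vec_def sum_2 inner_complex_def; algebra)
  then have "(1 / n) *\<^sub>R (n *\<^sub>R v) = ((v \<bullet> u) / n) *\<^sub>R u + imag a b c u"
    by (simp add: a_def b_def c_def imag_def scaleR_add_right)
  then have v: "v = ((v \<bullet> u) / n) *\<^sub>R u + imag a b c u" using n by simp
  define \<beta> where "\<beta> = sqrt (a\<^sup>2 + b\<^sup>2 + c\<^sup>2)"
  show ?thesis
  proof (cases "\<beta> = 0")
    case True
    then have "a\<^sup>2 + b\<^sup>2 + c\<^sup>2 = 0" by (simp add: \<beta>_def)
    then have "a = 0" "b = 0" "c = 0" by (simp_all add: add_nonneg_eq_0_iff)
    then have "v = ((v \<bullet> u) / n) *\<^sub>R u + 0 *\<^sub>R imag3 (1, 0, 0) u" using v by (simp add: imag_def)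
    moreover have "unit3 (1, 0, 0)" by (simp add: unit3_def)
    ultimately show ?thesis using that by blast
  next
    case False
    have b2: "\<beta>\<^sup>2 = a\<^sup>2 + b\<^sup>2 + c\<^sup>2" by (simp add: \<beta>_def)
    have "unit3 (a / \<beta>, b / \<beta>, c / \<beta>)"
      using False by (simp add: unit3_def power_divide b2[symmetric] add_divide_distrib[symmetric])
    moreover have "imag a b c u = \<beta> *\<^sub>R imag3 (a / \<beta>, b / \<beta>, c / \<beta>) u"
      using False by (simp add: imag3_def imag_def scaleR_add_right)
    ultimately show ?thesis using that v by metis
  qed
qed

lemma unit3_orthogonal:
  assumes "unit3 (a, b, c)"
  obtains a' b' c' where "unit3 (a', b', c')" "a * a' + b * b' + c * c' = 0"
proof (cases "a = 0 \<and> b = 0")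
  case True
  then show ?thesis using that[of 1 0 0] by (simp add: unit3_def)
next
  case False
  then have pos: "a\<^sup>2 + b\<^sup>2 > 0" by (simp add: sum_power2_gt_zero_iff)
  let ?s = "sqrt (a\<^sup>2 + b\<^sup>2)"
  have "unit3 (- b / ?s, a / ?s, 0)"
    using pos by (auto simp: unit3_def power_divide add_divide_distrib[symmetric] add.commute)
  moreover have "a * (- b / ?s) + b * (a / ?s) + c * 0 = 0" by (simp add: algebra_simps)
  ultimately show ?thesis using that by blast
qed

text \<open>
  The plane spanned by \<open>x\<close> and \<open>v = \<alpha>x + \<beta>lx\<close> is a complex line for the structure \<open>l\<close>, and so is
  its orthogonal complement, which \<open>mx\<close> generates for any \<open>m\<close> orthogonal to \<open>l\<close>.
\<close>
lemma mixed_diff_imag3: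
  assumes K: "compact K" "convex K" and l: "unit3 l"
  obtains m where "unit3 m"
    "\<And>x \<alpha> \<beta>. mixed_diff K x (\<alpha> *\<^sub>R x + \<beta> *\<^sub>R imag3 l x) = \<bar>\<beta>\<bar> * shadow K (imag3 m x) (imag3 l (imag3 m x))"
proof -
  obtain a b c where abc: "l = (a, b, c)" by (cases l)
  obtain a' b' c' where m: "unit3 (a', b', c')" "a * a' + b * b' + c * c' = 0"
    using unit3_orthogonal l abc by blast
  have "mixed_diff K x (\<alpha> *\<^sub>R x + \<beta> *\<^sub>R imag3 l x) = \<bar>\<beta>\<bar> * shadow K (imag3 (a', b', c') x) (imag3 l (imag3 (a', b', c') x))" for x \<alpha> \<beta>
  proof (cases "x = 0")
    case True
    have "shadow K 0 0 = 0" using shadow_scale[OF K(1), of 0 0 0] by simp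
    moreover have "mixed_diff K 0 0 = 0" using mixed_diff_parallel[OF K, of 0 0] by simp
    ultimately show ?thesis using True by (simp add: linear_0[OF linear_imag3])
  next
    case False
    let ?j = "imag a b c" and ?k = "imag a' b' c'"
    have u: "a * a + b * b + c * c = 1" "a' * a' + b' * b' + c' * c' = 1"
      using l m by (auto simp: unit3_def abc power2_eq_square)
    have iso: "?j y \<bullet> ?j z = y \<bullet> z" for y z
    proof -
      have "a\<^sup>2 + b\<^sup>2 + c\<^sup>2 = 1" using l by (simp add: unit3_def abc)
      then have "?j (?j z) = - z" unfolding imag_imag by (simp only:) simp
      then show ?thesis using imag_adjoint[of a b c y "?j z"] by simp
    qed
    have jk: "?j x \<bullet> ?k x = 0" using inner_imag[of a b c x a' b' c'] m by simp
    interpret orth_frame x "?j x" "?k x" "?j (?k x)" "norm x"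
    proof
      show "x \<bullet> ?j (?k x) = 0" using imag_adjoint[of a b c x "?k x"] jk by simp
      show "?j x \<bullet> ?j (?k x) = 0" by (simp add: iso)
    qed (use False jk u in \<open>simp_all add: iso inner_imag power2_norm_eq_inner\<close>)
    show ?thesis using mixed_diff_eq_shadow[OF K, of \<alpha> \<beta>] by (simp add: abc imag3_def)
  qed
  with m(1) that show ?thesis by blast
qed

section \<open>The second intrinsic volume as an average of projections\<close>

text \<open>
  The average over all rotations \<open>p \<cdot> _ \<cdot> y\<close> of the quantity \<open>f K p y\<close> is a multiple of \<open>\<Theta>(K)\<close> whose factor does not
  depend on \<open>K\<close>. Nonnegativity and measurability are included so that the property is closed under sums.
\<close>
definition averages :: "(c2 set \<Rightarrow> quat \<Rightarrow> c2 \<Rightarrow> real) \<Rightarrow> real \<Rightarrow> bool" where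
  "averages f b \<longleftrightarrow> b \<ge> 0 \<and> (\<forall>K. compact K \<longrightarrow> convex K \<longrightarrow> K \<noteq> {} \<longrightarrow>
     (\<forall>p\<in>set tetrahedral. (\<forall>y. f K p y \<ge> 0) \<and> f K p \<in> borel_measurable borel) \<and>
     (\<Sum>p\<leftarrow>tetrahedral. (\<integral>\<^sup>+y. indicator (cball 0 1) y * ennreal (f K p y) \<partial>lborel)) = ennreal b * Theta K)"

lemma averagesD:
  assumes "averages f b"
  shows "b \<ge> 0"
    "compact K \<Longrightarrow> convex K \<Longrightarrow> K \<noteq> {} \<Longrightarrow> p \<in> set tetrahedral \<Longrightarrow> f K p y \<ge> 0"
    "compact K \<Longrightarrow> convex K \<Longrightarrow> K \<noteq> {} \<Longrightarrow> p \<in> set tetrahedral \<Longrightarrow> f K p \<in> borel_measurable borel"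
    "compact K \<Longrightarrow> convex K \<Longrightarrow> K \<noteq> {} \<Longrightarrow>
     (\<Sum>p\<leftarrow>tetrahedral. (\<integral>\<^sup>+y. indicator (cball 0 1) y * ennreal (f K p y) \<partial>lborel)) = ennreal b * Theta K"
  using assms unfolding averages_def by blast+

lemma averages_zero: "averages (\<lambda>_ _ _. 0) 0"
  by (auto simp: averages_def)

lemma measurable_cball_ennreal:
  fixes f :: "'a::euclidean_space \<Rightarrow> real"
  shows "f \<in> borel_measurable borel \<Longrightarrow> (\<lambda>y. indicator (cball 0 1) y * ennreal (f y)) \<in> borel_measurable borel"
  by (intro borel_measurable_times_ennreal borel_measurable_indicator measurable_compose[OF _ measurable_ennreal]) auto

lemma measurable_ball_ennreal:
  fixes f :: "c2 \<Rightarrow> real"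
  shows "f \<in> borel_measurable borel \<Longrightarrow> (\<lambda>y. indicator (cball 0 1) y * ennreal (f y)) \<in> borel_measurable lborel"
  using measurable_cball_ennreal by simp

lemma averages_add:
  assumes f: "averages f b" and g: "averages g c"
  shows "averages (\<lambda>K p y. f K p y + g K p y) (b + c)"
  unfolding averages_def
proof (intro conjI allI impI)
  show "b + c \<ge> 0" using f g by (simp add: averages_def)
  fix K :: "c2 set" assume K: "compact K" "convex K" "K \<noteq> {}"
  have f': "\<And>p. p \<in> set tetrahedral \<Longrightarrow> (\<forall>y. f K p y \<ge> 0) \<and> f K p \<in> borel_measurable borel"
    "(\<Sum>p\<leftarrow>tetrahedral. (\<integral>\<^sup>+y. indicator (cball 0 1) y * ennreal (f K p y) \<partial>lborel)) = ennreal b * Theta K" "b \<ge> 0"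
    using f K by (auto simp: averages_def)
  have g': "\<And>p. p \<in> set tetrahedral \<Longrightarrow> (\<forall>y. g K p y \<ge> 0) \<and> g K p \<in> borel_measurable borel"
    "(\<Sum>p\<leftarrow>tetrahedral. (\<integral>\<^sup>+y. indicator (cball 0 1) y * ennreal (g K p y) \<partial>lborel)) = ennreal c * Theta K" "c \<ge> 0"
    using g K by (auto simp: averages_def)
  show "\<forall>p\<in>set tetrahedral. (\<forall>y. f K p y + g K p y \<ge> 0) \<and> (\<lambda>y. f K p y + g K p y) \<in> borel_measurable borel"
    using f'(1) g'(1) by (intro ballI conjI allI add_nonneg_nonneg borel_measurable_add) blast+
  have "(\<Sum>p\<leftarrow>tetrahedral. (\<integral>\<^sup>+y. indicator (cball 0 1) y * ennreal (f K p y + g K p y) \<partial>lborel))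
    = (\<Sum>p\<leftarrow>tetrahedral. (\<integral>\<^sup>+y. indicator (cball 0 1) y * ennreal (f K p y) \<partial>lborel)
         + (\<integral>\<^sup>+y. indicator (cball 0 1) y * ennreal (g K p y) \<partial>lborel))"
  proof (intro arg_cong[of _ _ sum_list] map_cong refl)
    fix p assume p: "p \<in> set tetrahedral"
    show "(\<integral>\<^sup>+y. indicator (cball 0 1) y * ennreal (f K p y + g K p y) \<partial>lborel) =
      (\<integral>\<^sup>+y. indicator (cball 0 1) y * ennreal (f K p y) \<partial>lborel)
         + (\<integral>\<^sup>+y. indicator (cball 0 1) y * ennreal (g K p y) \<partial>lborel)"
    proof -
      have fp: "\<And>y. f K p y \<ge> 0" "f K p \<in> borel_measurable borel" using f'(1)[OF p] by auto
      have gp: "\<And>y. g K p y \<ge> 0" "g K p \<in> borel_measurable borel" using g'(1)[OF p] by auto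
      show ?thesis
        unfolding nn_integral_add[OF measurable_ball_ennreal[OF fp(2)] measurable_ball_ennreal[OF gp(2)], symmetric]
        by (intro nn_integral_cong) (simp add: fp gp ennreal_plus distrib_left)
    qed
  qed
  also have "\<dots> = ennreal (b + c) * Theta K"
    using f'(2,3) g'(2,3) by (simp add: sum_list_addf ennreal_plus distrib_right)
  finally show "(\<Sum>p\<leftarrow>tetrahedral. (\<integral>\<^sup>+y. indicator (cball 0 1) y * ennreal (f K p y + g K p y) \<partial>lborel)) = ennreal (b + c) * Theta K" .
qed

text \<open>
  Write \<open>v = \<alpha>u + \<beta>lu\<close>. The rotation \<open>p \<cdot> _ \<cdot> y\<close> keeps this relation with \<open>l\<close> replaced by its conjugate \<open>p l p\<^sup>-\<^sup>1\<close>, so the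
  mixed difference becomes an area on a line of that structure. Integration over \<open>y\<close> averages over the lines
  and summation over \<open>p\<close> over the structures.
\<close>
lemma averages_mixed_diff:
  "\<exists>b. averages (\<lambda>K p y. mixed_diff K (quat_mult p (right_sim y u)) (quat_mult p (right_sim y v))) b"
proof (cases "u = 0")
  case True
  have "mixed_diff K 0 w = 0" for K :: "c2 set" and w :: c2
  proof -
    have "seg (0 :: c2) = {0}" by (simp add: seg_def)
    moreover have "K + {0} = K" by (simp add: set_plus_def)
    ultimately show ?thesis by (simp add: mixed_diff_def)
  qed
  then have "(\<lambda>K p y. mixed_diff K (quat_mult p (right_sim y u)) (quat_mult p (right_sim y v))) = (\<lambda>_ _ _. 0)"
    using True by (simp add: linear_0[OF linear_quat_mult] linear_0[OF linear_right_sim_right])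
  then show ?thesis using averages_zero by metis
next
  case False
  obtain \<alpha> \<beta> l where l: "unit3 l" and v: "v = \<alpha> *\<^sub>R u + \<beta> *\<^sub>R imag3 l u"
    using c2_decomposition[OF False] by metis
  define r where "r = norm u"
  have r: "r > 0" using False by (simp add: r_def)
  define X where "X p y = quat_mult p (right_sim y u)" for p y
  have Xlin: "linear (X p)" for p
    using linear_compose[OF linear_right_sim_left[of u] linear_quat_mult[of p]] by (simp add: X_def[abs_def] o_def)
  have Xv: "quat_mult p (right_sim y v) = \<alpha> *\<^sub>R X p y + \<beta> *\<^sub>R imag3 (quat_rot p l) (X p y)" if "p \<in> set tetrahedral" for p y
    by (simp add: v X_def linear_add[OF linear_right_sim_right] linear_scale[OF linear_right_sim_right]
      linear_add[OF linear_quat_mult] linear_scale[OF linear_quat_mult] imag3_right_sim[symmetric] quat_mult_imag3[OF that])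
  define b where "b = 4 * (\<bar>\<beta>\<bar> * r\<^sup>2)"
  have "averages (\<lambda>K p y. mixed_diff K (quat_mult p (right_sim y u)) (quat_mult p (right_sim y v))) b"
    unfolding averages_def
  proof (intro conjI allI impI)
    show "b \<ge> 0" by (simp add: b_def)
    fix K :: "c2 set" assume K: "compact K" "convex K" "K \<noteq> {}"
    have main: "(\<forall>y. mixed_diff K (quat_mult p (right_sim y u)) (quat_mult p (right_sim y v)) \<ge> 0) \<and>
        (\<lambda>y. mixed_diff K (quat_mult p (right_sim y u)) (quat_mult p (right_sim y v))) \<in> borel_measurable borel \<and>
        (\<integral>\<^sup>+y. indicator (cball 0 1) y * ennreal (mixed_diff K (quat_mult p (right_sim y u)) (quat_mult p (right_sim y v))) \<partial>lborel)
          = ennreal (\<bar>\<beta>\<bar> * r\<^sup>2) * line_avg (quat_rot p l) K" if p: "p \<in> set tetrahedral" for p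
    proof -
      let ?l = "quat_rot p l"
      obtain m where m: "unit3 m"
        "\<And>x \<alpha> \<beta>. mixed_diff K x (\<alpha> *\<^sub>R x + \<beta> *\<^sub>R imag3 ?l x) = \<bar>\<beta>\<bar> * shadow K (imag3 m x) (imag3 ?l (imag3 m x))"
        using mixed_diff_imag3[OF K(1,2) unit3_quat_rot[OF p l]] by metis
      define S where "S y = imag3 m (X p y)" for y
      have S: "linear S"
        using linear_compose[OF Xlin[of p] linear_imag3[of m]] by (simp add: S_def[abs_def] o_def)
      have nS: "norm (S y) = r * norm y" for y
        using m(1) p norm_imag by (cases m) (auto simp: S_def X_def imag3_def unit3_def norm_quat_mult norm_right_sim r_def)
      have eq: "mixed_diff K (quat_mult p (right_sim y u)) (quat_mult p (right_sim y v)) = \<bar>\<beta>\<bar> * shadow K (S y) (imag3 ?l (S y))" for y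
        unfolding Xv[OF p] by (simp add: X_def[symmetric] m(2) S_def)
      have meas: "(\<lambda>y. shadow K (S y) (imag3 ?l (S y))) \<in> borel_measurable borel"
        using measurable_compose[OF linear_borel_measurable[OF S] measurable_shadow_imag3[OF K(1,2)]] by simp
      have "(\<integral>\<^sup>+y. indicator (cball 0 1) y * ennreal (\<bar>\<beta>\<bar> * shadow K (S y) (imag3 ?l (S y))) \<partial>lborel)
        = (\<integral>\<^sup>+y. ennreal \<bar>\<beta>\<bar> * (indicator (cball 0 1) y * ennreal (shadow K (S y) (imag3 ?l (S y)))) \<partial>lborel)"
        by (intro nn_integral_cong) (simp add: ennreal_mult shadow_nonneg mult_ac)
      also have "\<dots> = ennreal \<bar>\<beta>\<bar> * (ennreal (r\<^sup>2) * line_avg ?l K)"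
        by (subst nn_integral_cmult[OF measurable_ball_ennreal[OF meas]]) (simp add: line_avg_transport[OF K(1,2) S nS r])
      also have "\<dots> = ennreal (\<bar>\<beta>\<bar> * r\<^sup>2) * line_avg ?l K" by (simp add: ennreal_mult mult.assoc)
      finally show ?thesis using meas by (simp add: eq shadow_nonneg)
    qed
    show "\<forall>p\<in>set tetrahedral. (\<forall>y. mixed_diff K (quat_mult p (right_sim y u)) (quat_mult p (right_sim y v)) \<ge> 0) \<and>
        (\<lambda>y. mixed_diff K (quat_mult p (right_sim y u)) (quat_mult p (right_sim y v))) \<in> borel_measurable borel"
      using main by blast
    have "(\<Sum>p\<leftarrow>tetrahedral. (\<integral>\<^sup>+y. indicator (cball 0 1) y * ennreal (mixed_diff K (quat_mult p (right_sim y u)) (quat_mult p (right_sim y v))) \<partial>lborel))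
      = (\<Sum>p\<leftarrow>tetrahedral. ennreal (\<bar>\<beta>\<bar> * r\<^sup>2) * line_avg (quat_rot p l) K)"
      using main by (intro arg_cong[of _ _ sum_list] map_cong refl) blast
    also have "\<dots> = ennreal (\<bar>\<beta>\<bar> * r\<^sup>2) * (4 * Theta K)"
      by (simp only: sum_list_const_mult sum_tetrahedral_line_avg[OF K l])
    also have "\<dots> = ennreal b * Theta K"
      by (simp add: b_def ennreal_mult mult_ac)
    finally show "(\<Sum>p\<leftarrow>tetrahedral. (\<integral>\<^sup>+y. indicator (cball 0 1) y * ennreal (mixed_diff K (quat_mult p (right_sim y u)) (quat_mult p (right_sim y v))) \<partial>lborel)) = ennreal b * Theta K" .
  qed
  then show ?thesis by blast
qed

lemma averages_sum_pairs:
  "\<exists>b. averages (\<lambda>K p y. sum_pairs (mixed_diff K) (map (\<lambda>x. quat_mult p (right_sim y x)) vs)) b"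
proof (induction vs)
  case Nil
  then show ?case using averages_zero by auto
next
  case (Cons v vs)
  have "\<exists>b. averages (\<lambda>K p y. \<Sum>w\<leftarrow>ws. mixed_diff K (quat_mult p (right_sim y v)) (quat_mult p (right_sim y w))) b" for ws
  proof (induction ws)
    case Nil
    then show ?case using averages_zero by auto
  next
    case (Cons w ws)
    then show ?case using averages_mixed_diff[of v w] averages_add by fastforce
  qed
  from this[of vs] Cons obtain b c where
    "averages (\<lambda>K p y. \<Sum>w\<leftarrow>vs. mixed_diff K (quat_mult p (right_sim y v)) (quat_mult p (right_sim y w))) b"
    "averages (\<lambda>K p y. sum_pairs (mixed_diff K) (map (\<lambda>x. quat_mult p (right_sim y x)) vs)) c" by blast
  from averages_add[OF this] show ?case by (auto simp: o_def)
qed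

text \<open>
  The total weight \<open>\<integral>|y|\<^sup>2\<close> over the unit ball with which lines are averaged.
\<close>
definition ball_moment :: real where
  "ball_moment = enn2real (\<integral>\<^sup>+y. indicator (cball 0 1) (y :: c2) * ennreal ((norm y)\<^sup>2) \<partial>lborel)"

lemma ball_moment:
  shows ball_moment_eq: "(\<integral>\<^sup>+y. indicator (cball 0 1) (y :: c2) * ennreal ((norm y)\<^sup>2) \<partial>lborel) = ennreal ball_moment"
    and ball_moment_pos: "ball_moment > 0"
proof -
  let ?I = "\<integral>\<^sup>+y. indicator (cball 0 1) (y :: c2) * ennreal ((norm y)\<^sup>2) \<partial>lborel"
  have "?I \<le> (\<integral>\<^sup>+y. indicator (cball 0 1) (y :: c2) \<partial>lborel)"
    by (intro nn_integral_mono) (auto simp: indicator_def power_le_one)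
  also have "\<dots> < \<infinity>" by (simp add: emeasure_cball)
  finally have fin: "?I < \<infinity>" .
  then show eq: "?I = ennreal ball_moment" by (simp add: ball_moment_def less_top)
  have "?I \<noteq> 0"
  proof
    assume "?I = 0"
    then have "AE y in lborel. indicator (cball 0 1) (y :: c2) * ennreal ((norm y)\<^sup>2) = 0"
      using nn_integral_0_iff_AE[OF measurable_ball_ennreal[of "\<lambda>y. (norm y)\<^sup>2"]] by simp
    then have "AE y in lborel. (y::c2) \<notin> cball 0 1"
      using AE_lborel_singleton[of "0::c2"]
      by eventually_elim (auto simp: indicator_def)
    then have "emeasure lborel (cball (0::c2) 1) = 0"
      by (subst (asm) AE_iff_measurable[of "cball 0 1"]) auto
    then show False using unit_ball_vol_pos[of 4] by (simp add: emeasure_cball)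
  qed
  then show "ball_moment > 0" using eq by (cases "ball_moment > 0") (auto simp: ennreal_neg)
qed

lemma line_avg_finite:
  assumes K: "compact K" and l: "unit3 l"
  shows "line_avg l K < \<infinity>"
proof -
  obtain R where R: "R > 0" "K \<subseteq> cball 0 R"
    using compact_imp_bounded[OF K(1)] unfolding bounded_pos by (metis mem_cball_0 subsetI)
  have "line_avg l K \<le> (\<integral>\<^sup>+y. ennreal (4 * R\<^sup>2) * indicator (cball 0 1) (y :: c2) \<partial>lborel)"
    unfolding line_avg_eq
  proof (intro nn_integral_mono)
    fix y :: c2
    have "shadow K y (imag3 l y) \<le> 4 * R\<^sup>2" if "norm y \<le> 1"
    proof -
      have "norm (imag3 l y) = norm y"
        using l norm_imag by (cases l) (auto simp: imag3_def unit3_def)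
      then have "shadow K y (imag3 l y) \<le> 4 * R\<^sup>2 * (norm y * norm y)"
        using shadow_bound[OF K R(2), of y "imag3 l y"] R by simp
      also have "\<dots> \<le> 4 * R\<^sup>2 * 1" using that by (intro mult_left_mono) (auto simp: mult_le_one)
      finally show ?thesis by simp
    qed
    then show "indicator (cball 0 1) y * ennreal (shadow K y (imag3 l y)) \<le> ennreal (4 * R\<^sup>2) * indicator (cball 0 1) y"
      by (auto simp: indicator_def intro: ennreal_leI)
  qed
  also have "\<dots> < \<infinity>"
    by (simp add: nn_integral_cmult_indicator emeasure_cball ennreal_mult_less_top)
  finally show ?thesis .
qed

lemma Theta_finite: "compact K \<Longrightarrow> Theta K < \<infinity>"
  using line_avg_finite by (simp add: Theta_def unit3_def)

lemma tendsto_sum_list: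
  fixes f :: "'l \<Rightarrow> nat \<Rightarrow> ennreal"
  assumes "\<And>l. l \<in> set ls \<Longrightarrow> f l \<longlonglongrightarrow> c"
  shows "(\<lambda>n. \<Sum>l\<leftarrow>ls. f l n) \<longlonglongrightarrow> of_nat (length ls) * c"
  using assms
proof (induction ls)
  case (Cons l ls)
  then show ?case using tendsto_add[of "f l" c sequentially "\<lambda>n. \<Sum>l\<leftarrow>ls. f l n" "of_nat (length ls) * c"]
    by (simp add: distrib_right)
qed simp

text \<open>
  Every rotated zonotope gives the limit \<open>coeff p 2 |y|\<^sup>2\<close>; dominated convergence allows to integrate it over \<open>y\<close>,
  and the twelve rotations \<open>p\<close> contribute equally.
\<close>
lemma tendsto_average:
  assumes K: "compact K" "convex K" "K \<noteq> {}"
    and vs: "\<And>n. near_ball (ball_err n) (vs n)"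
    and b: "\<And>n. averages (\<lambda>K p y. sum_pairs (mixed_diff K) (map (\<lambda>x. quat_mult p (right_sim y x)) (vs n))) (b n)"
    and p: "degree p \<le> 4" "\<And>t. t \<ge> 0 \<Longrightarrow> vol (K + cball 0 t) = poly p t"
  shows "coeff p 2 \<ge> 0" "(\<lambda>n. ennreal (b n) * Theta K) \<longlonglongrightarrow> ennreal (12 * (coeff p 2 * ball_moment))"
proof -
  define f where "f q n y = sum_pairs (mixed_diff K) (map (\<lambda>x. quat_mult q (right_sim y x)) (vs n))" for q n y
  have f: "f q n y \<ge> 0" "f q n \<in> borel_measurable borel" if "q \<in> set tetrahedral" for q n y
    unfolding f_def using averagesD(2,3)[OF b K that] .
  have sum: "(\<Sum>q\<leftarrow>tetrahedral. (\<integral>\<^sup>+y. indicator (cball 0 1) y * ennreal (f q n y) \<partial>lborel)) = ennreal (b n) * Theta K" for n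
    unfolding f_def by (rule averagesD(4)[OF b K])
  define T where "T q y x = quat_mult q (right_sim y x)" for q y x
  have T: "linear (T q y)" for q y
    using linear_compose[OF linear_right_sim_right[of y] linear_quat_mult[of q]] by (simp add: T_def[abs_def] o_def)
  have nT: "norm (T q y x) = norm y * norm x" if "q \<in> set tetrahedral" for q y x
    using that by (simp add: T_def norm_quat_mult norm_right_sim)
  have fT: "f q n y = sum_pairs (mixed_diff K) (map (T q y) (vs n))" for q n y
    by (simp add: f_def T_def[abs_def])
  have lim: "(\<lambda>n. f q n y) \<longlonglongrightarrow> coeff p 2 * (norm y)\<^sup>2" if "q \<in> set tetrahedral" "y \<noteq> 0" for q y
    unfolding fT
    by (rule tendsto_sum_pairs_mixed_diff[OF DIM_c2 K T nT[OF that(1)] _ vs p]) (use that in auto)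
  have tet1: "(1,0,0,0) \<in> set tetrahedral" by (simp add: tetrahedral_def)
  obtain e :: c2 where e: "e \<in> Basis" using nonempty_Basis by blast
  show c2: "coeff p 2 \<ge> 0"
    using LIMSEQ_le_const[OF lim[OF tet1, of e], of 0] f(1)[OF tet1] e nonzero_Basis[OF e] by auto
  have "(\<lambda>n. \<integral>\<^sup>+y. indicator (cball 0 1) y * ennreal (f q n y) \<partial>lborel) \<longlonglongrightarrow>
     (\<integral>\<^sup>+y. indicator (cball 0 1) y * ennreal (coeff p 2 * (norm y)\<^sup>2) \<partial>(lborel :: c2 measure))" if q: "q \<in> set tetrahedral" for q
  proof (rule nn_integral_dominated_convergence)
    let ?C = "320 * vol (K + cball 0 4)"
    show "(\<lambda>y. indicator (cball 0 1) y * ennreal (f q n y)) \<in> borel_measurable lborel" for n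
      by (rule measurable_ball_ennreal[OF f(2)[OF q]])
    show "(\<lambda>y. indicator (cball 0 1) y * ennreal (coeff p 2 * (norm y)\<^sup>2)) \<in> borel_measurable (lborel :: c2 measure)"
      by (rule measurable_ball_ennreal) simp
    show "(\<lambda>y. indicator (cball 0 1) y * ennreal ?C) \<in> borel_measurable (lborel :: c2 measure)"
      by (rule measurable_ball_ennreal) simp
    have "(\<integral>\<^sup>+y. indicator (cball 0 1) (y::c2) * ennreal ?C \<partial>lborel) = (\<integral>\<^sup>+y. ennreal ?C * indicator (cball 0 1) (y::c2) \<partial>lborel)"
      by (intro nn_integral_cong mult.commute)
    also have "\<dots> = ennreal ?C * emeasure lborel (cball (0::c2) 1)"
      by (rule nn_integral_cmult_indicator) simp
    also have "\<dots> < \<infinity>" by (simp add: emeasure_cball ennreal_mult_less_top)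
    finally show "(\<integral>\<^sup>+y. indicator (cball 0 1) (y::c2) * ennreal ?C \<partial>lborel) < \<infinity>" .
    show "AE y in lborel. indicator (cball 0 1) y * ennreal (f q n y) \<le> indicator (cball 0 1) y * ennreal ?C" for n
      using AE_lborel_singleton[of "0::c2"]
    proof eventually_elim
      fix y :: c2 assume y: "y \<noteq> 0"
      have "f q n y \<le> ?C" if "norm y \<le> 1"
        using sum_pairs_mixed_diff_bound[OF DIM_c2 K T[of q y] nT[OF q] _ that vs[of n]] y unfolding fT by simp
      then show "indicator (cball 0 1) y * ennreal (f q n y) \<le> indicator (cball 0 1) y * ennreal ?C"
        by (auto simp: indicator_def intro: ennreal_leI)
    qed
    show "AE y in lborel. (\<lambda>n. indicator (cball 0 1) y * ennreal (f q n y)) \<longlonglongrightarrow> indicator (cball 0 1) y * ennreal (coeff p 2 * (norm y)\<^sup>2)"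
      using AE_lborel_singleton[of "0::c2"]
    proof eventually_elim
      fix y :: c2 assume y: "y \<noteq> 0"
      show "(\<lambda>n. indicator (cball 0 1) y * ennreal (f q n y)) \<longlonglongrightarrow> indicator (cball 0 1) y * ennreal (coeff p 2 * (norm y)\<^sup>2)"
        using lim[OF q y] by (cases "y \<in> cball 0 1") (auto simp: indicator_def intro: tendsto_ennrealI)
    qed
  qed
  moreover have "(\<integral>\<^sup>+y. indicator (cball 0 1) y * ennreal (coeff p 2 * (norm y)\<^sup>2) \<partial>(lborel :: c2 measure)) = ennreal (coeff p 2 * ball_moment)"
  proof -
    have "(\<integral>\<^sup>+y. indicator (cball 0 1) y * ennreal (coeff p 2 * (norm y)\<^sup>2) \<partial>(lborel :: c2 measure))
      = (\<integral>\<^sup>+y. ennreal (coeff p 2) * (indicator (cball 0 1) y * ennreal ((norm y)\<^sup>2)) \<partial>(lborel :: c2 measure))"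
      using c2 by (intro nn_integral_cong) (simp add: ennreal_mult mult_ac)
    also have "\<dots> = ennreal (coeff p 2) * ennreal ball_moment"
      unfolding ball_moment_eq[symmetric] by (rule nn_integral_cmult[OF measurable_ball_ennreal]) simp
    finally show ?thesis using c2 ball_moment_pos by (simp add: ennreal_mult)
  qed
  ultimately have "(\<lambda>n. \<Sum>q\<leftarrow>tetrahedral. \<integral>\<^sup>+y. indicator (cball 0 1) y * ennreal (f q n y) \<partial>lborel) \<longlonglongrightarrow>
     of_nat (length tetrahedral) * ennreal (coeff p 2 * ball_moment)"
    by (intro tendsto_sum_list) simp
  moreover have "of_nat (length tetrahedral) * ennreal (coeff p 2 * ball_moment) = ennreal (12 * (coeff p 2 * ball_moment))"
    using c2 ball_moment_pos by (subst ennreal_mult) (simp_all add: tetrahedral_def)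
  ultimately show "(\<lambda>n. ennreal (b n) * Theta K) \<longlonglongrightarrow> ennreal (12 * (coeff p 2 * ball_moment))"
    unfolding sum by simp
qed

lemma shadow_unit_ball:
  assumes l: "unit3 l"
  shows "shadow (cball 0 1) y (imag3 l y) = pi * (norm y)\<^sup>2"
proof (cases "y = 0")
  case True
  then show ?thesis using shadow_scale[OF compact_cball, of 0 1 0 0 0] by (simp add: linear_0[OF linear_imag3])
next
  case False
  obtain a b c where abc: "l = (a, b, c)" by (cases l)
  define u where "u = (1 / norm y) *\<^sub>R y"
  define j where "j = imag3 l u"
  have uu: "u \<bullet> u = 1" using False by (simp add: u_def power2_norm_eq_inner[symmetric] power2_eq_square)
  have jj: "j \<bullet> j = 1" "u \<bullet> j = 0" "j \<bullet> u = 0"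
    using l uu by (simp_all add: j_def abc imag3_def inner_imag unit3_def power2_eq_square)
  have "coords u j ` cball 0 1 = cball 0 1"
  proof (intro equalityI subsetI)
    fix z assume "z \<in> coords u j ` cball 0 1"
    then obtain x where x: "norm x \<le> 1" "z = coords u j x" by auto
    have "0 \<le> (x - ((x \<bullet> u) *\<^sub>R u + (x \<bullet> j) *\<^sub>R j)) \<bullet> (x - ((x \<bullet> u) *\<^sub>R u + (x \<bullet> j) *\<^sub>R j))" by simp
    also have "\<dots> = x \<bullet> x - ((x \<bullet> u)\<^sup>2 + (x \<bullet> j)\<^sup>2)"
      by (simp add: inner_diff_left inner_diff_right inner_add_left inner_add_right uu jj inner_commute[of u x] inner_commute[of j x] power2_eq_square)
    also have "x \<bullet> x \<le> 1" using x(1) by (simp add: power2_norm_eq_inner[symmetric] power_le_one)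
    finally have "(x \<bullet> u)\<^sup>2 + (x \<bullet> j)\<^sup>2 \<le> 1" by simp
    then show "z \<in> cball 0 1" by (simp add: x norm_real2)
  next
    fix z :: "real^2" assume z: "z \<in> cball 0 1"
    let ?x = "z $ 1 *\<^sub>R u + z $ 2 *\<^sub>R j"
    have "norm ?x = norm z"
      unfolding norm_eq_sqrt_inner[of ?x] norm_real2
      by (simp add: inner_add_left inner_add_right uu jj power2_eq_square)
    moreover have "coords u j ?x = z" by (simp add: vec_eq_iff forall_2 inner_add_left uu jj)
    ultimately show "z \<in> coords u j ` cball 0 1" using z by (intro image_eqI[of _ _ ?x]) auto
  qed
  then have "shadow (cball 0 1) u j = pi"
    unfolding shadow_def by (simp add: vol_cball unit_ball_vol_2 del: measure_completion)
  moreover have "y = norm y *\<^sub>R u" "imag3 l y = norm y *\<^sub>R j"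
    using False by (simp_all add: u_def j_def linear_scale[OF linear_imag3])
  ultimately show ?thesis using shadow_scale[OF compact_cball, of 0 1 "norm y" u j] by simp
qed

lemma Theta_unit_ball: "Theta (cball 0 1) = ennreal (3 * (pi * ball_moment))"
proof -
  have "line_avg l (cball 0 1) = ennreal (pi * ball_moment)" if "unit3 l" for l
  proof -
    have "line_avg l (cball 0 1) = (\<integral>\<^sup>+y. ennreal pi * (indicator (cball 0 1) y * ennreal ((norm y)\<^sup>2)) \<partial>(lborel :: c2 measure))"
      unfolding line_avg_eq shadow_unit_ball[OF that] by (intro nn_integral_cong) (simp add: ennreal_mult mult_ac)
    also have "\<dots> = ennreal pi * ennreal ball_moment"
      unfolding ball_moment_eq[symmetric] by (rule nn_integral_cmult[OF measurable_ball_ennreal]) simp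
    finally show ?thesis using ball_moment_pos by (simp add: ennreal_mult)
  qed
  then show ?thesis using ball_moment_pos
    by (simp add: Theta_def unit3_def ennreal_plus[symmetric] del: ennreal_plus)
qed

lemma steiner_unit_ball:
  obtains p where "degree p \<le> 4" "\<And>t. t \<ge> 0 \<Longrightarrow> vol (cball (0::c2) 1 + cball 0 t) = poly p t" "coeff p 2 = 3 * pi\<^sup>2"
proof -
  define p :: "real poly" where "p = smult (pi\<^sup>2 / 2) [:1, 4, 6, 4, 1:]"
  have "vol (cball (0::c2) 1 + cball 0 t) = poly p t" if t: "t \<ge> 0" for t
  proof -
    have "cball (0::c2) 1 + cball 0 t = cball 0 (1 + t)"
    proof (intro equalityI subsetI)
      fix x assume "x \<in> cball (0::c2) 1 + cball 0 t"
      then obtain a b where "x = a + b" "norm a \<le> 1" "norm b \<le> t" by (auto simp: set_plus_def)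
      then show "x \<in> cball 0 (1 + t)" using norm_triangle_ineq[of a b] by simp
    next
      fix x :: c2 assume x: "x \<in> cball 0 (1 + t)"
      have "(1 / (1 + t)) *\<^sub>R x \<in> cball 0 1" "(t / (1 + t)) *\<^sub>R x \<in> cball 0 t"
        using x t mult_left_mono[of "norm x" "1 + t" t] by (auto simp: field_simps)
      moreover have "x = (1 / (1 + t)) *\<^sub>R x + (t / (1 + t)) *\<^sub>R x"
        using t by (simp add: scaleR_add_left[symmetric] add_divide_distrib[symmetric])
      ultimately show "x \<in> cball 0 1 + cball 0 t" by (metis set_plus_intro)
    qed
    then have "vol (cball (0::c2) 1 + cball 0 t) = unit_ball_vol 4 * (1 + t) ^ 4"
      using t by (simp add: vol_cball del: measure_completion)
    also have "unit_ball_vol 4 = pi\<^sup>2 / 2"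
      using unit_ball_vol_even[of 2] by (simp add: eval_nat_numeral)
    also have "(pi\<^sup>2 / 2) * (1 + t) ^ 4 = poly p t"
      by (simp add: p_def eval_nat_numeral algebra_simps)
    finally show ?thesis .
  qed
  moreover have "degree p \<le> 4" "coeff p 2 = 3 * pi\<^sup>2"
    by (simp_all add: p_def numeral_2_eq_2)
  ultimately show ?thesis using that by blast
qed

text \<open>
  The constant relating the two sides does not depend on \<open>K\<close>, and the unit ball determines it.
\<close>
lemma intrinsic_volume_2_eq_Theta:
  assumes K: "compact K" "convex K" "K \<noteq> {}"
  shows "intrinsic_volumes K 2 * ball_moment = enn2real (Theta K)"
proof -
  obtain vs :: "nat \<Rightarrow> c2 list" where vs: "\<And>n. near_ball (ball_err n) (vs n)"
    using exists_ball_zonotopes[OF DIM_c2] by metis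
  have "\<forall>n. \<exists>c. averages (\<lambda>K p y. sum_pairs (mixed_diff K) (map (\<lambda>x. quat_mult p (right_sim y x)) (vs n))) c"
    by (intro allI averages_sum_pairs)
  from choice[OF this] obtain b
    where b: "\<And>n. averages (\<lambda>K p y. sum_pairs (mixed_diff K) (map (\<lambda>x. quat_mult p (right_sim y x)) (vs n))) (b n)" by blast
  have b0: "b n \<ge> 0" for n by (rule averagesD(1)[OF b])
  obtain p0 where p0: "degree p0 \<le> 4" "\<And>t. t \<ge> 0 \<Longrightarrow> vol (cball (0::c2) 1 + cball 0 t) = poly p0 t" "coeff p0 2 = 3 * pi\<^sup>2"
    using steiner_unit_ball by blast
  let ?m = ball_moment
  note m = ball_moment_pos
  have "(\<lambda>n. ennreal (b n * (3 * (pi * ?m)))) \<longlonglongrightarrow> ennreal (12 * (3 * pi\<^sup>2 * ?m))"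
    using tendsto_average(2)[OF compact_cball convex_cball _ vs b p0(1,2)] m b0
    by (simp add: Theta_unit_ball p0(3) ennreal_mult)
  then have "(\<lambda>n. b n * (3 * (pi * ?m))) \<longlonglongrightarrow> 12 * (3 * pi\<^sup>2 * ?m)"
    using m b0 by (subst (asm) tendsto_ennreal_iff) (auto intro!: always_eventually)
  then have "(\<lambda>n. b n * (3 * (pi * ?m)) / (3 * (pi * ?m))) \<longlonglongrightarrow> 12 * (3 * pi\<^sup>2 * ?m) / (3 * (pi * ?m))"
    using m by (intro tendsto_divide tendsto_const) auto
  then have lim_b: "b \<longlonglongrightarrow> 12 * pi"
    using m by (simp add: power2_eq_square)
  obtain p where p: "degree p \<le> 4" "\<And>t. t \<ge> 0 \<Longrightarrow> vol (K + cball 0 t) = poly p t"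
    using steiner_polynomial[OF DIM_c2 K] by metis
  define \<theta> where "\<theta> = enn2real (Theta K)"
  have \<theta>: "Theta K = ennreal \<theta>" "\<theta> \<ge> 0" using Theta_finite[OF K(1)] by (auto simp: \<theta>_def less_top)
  note avg = tendsto_average[OF K vs b p]
  have "(\<lambda>n. ennreal (b n * \<theta>)) \<longlonglongrightarrow> ennreal (12 * (coeff p 2 * ?m))"
    using avg(2) b0 \<theta> by (simp add: ennreal_mult)
  then have "(\<lambda>n. b n * \<theta>) \<longlonglongrightarrow> 12 * (coeff p 2 * ?m)"
    using m b0 \<theta> avg(1) by (subst (asm) tendsto_ennreal_iff) (auto intro!: always_eventually)
  moreover have "(\<lambda>n. b n * \<theta>) \<longlonglongrightarrow> 12 * pi * \<theta>" by (intro tendsto_intros lim_b)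
  ultimately have "12 * (coeff p 2 * ?m) = 12 * pi * \<theta>" by (rule LIMSEQ_unique)
  then have "coeff p 2 * ?m = pi * \<theta>" by simp
  moreover have "coeff p 2 = pi * intrinsic_volumes K 2"
    using intrinsic_volumes_2[OF DIM_c2 p] by simp
  ultimately have "pi * (intrinsic_volumes K 2 * ?m) = pi * \<theta>" by (simp only: mult_ac)
  then show ?thesis by (simp add: \<theta>_def)
qed

section \<open>Measures on spaces of planes\<close>

lemma mem_span_2: "x \<in> span {u, v} \<longleftrightarrow> (\<exists>s t. x = s *\<^sub>R u + t *\<^sub>R v)"
  by (auto simp: span_breakdown_eq[of x u "{v}"] span_singleton image_iff algebra_simps diff_eq_eq)

text \<open>
  The isometry chosen in the definition of the area sends the standard basis to some orthonormal basis of the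
  plane; its transition matrix to \<open>u, w\<close> has determinant \<open>\<plusminus>1\<close>.
\<close>
lemma vol2_in_orthonormal:
  fixes u w :: "'a::euclidean_space"
  assumes uw: "u \<bullet> u = 1" "w \<bullet> w = 1" "u \<bullet> w = 0" and K: "compact K"
  shows "vol2_in (span {u, w}) (orth_proj (span {u, w}) ` K) = shadow K u w"
proof -
  let ?E = "span {u, w}"
  have wu: "w \<bullet> u = 0" using uw by (simp add: inner_commute)
  define Q where "Q f \<longleftrightarrow> linear f \<and> (\<forall>x. norm (f x) = norm x) \<and> range f = ?E" for f :: "real^2 \<Rightarrow> 'a"
  define f where "f = (SOME f. Q f)"
  have "Q (\<lambda>t :: real^2. t $ 1 *\<^sub>R u + t $ 2 *\<^sub>R w)"
    unfolding Q_def
  proof (intro conjI allI)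
    show "linear (\<lambda>t :: real^2. t $ 1 *\<^sub>R u + t $ 2 *\<^sub>R w)"
      by (rule linearI) (simp_all add: algebra_simps)
    show "norm (t $ 1 *\<^sub>R u + t $ 2 *\<^sub>R w) = norm t" for t :: "real^2"
      unfolding norm_eq_sqrt_inner[of "_ + _"] norm_real2
      by (simp add: inner_add_left inner_add_right uw wu power2_eq_square)
    show "range (\<lambda>t :: real^2. t $ 1 *\<^sub>R u + t $ 2 *\<^sub>R w) = ?E"
    proof (intro equalityI subsetI)
      fix x assume "x \<in> ?E"
      then obtain s t where "x = s *\<^sub>R u + t *\<^sub>R w" by (auto simp: mem_span_2)
      then show "x \<in> range (\<lambda>t :: real^2. t $ 1 *\<^sub>R u + t $ 2 *\<^sub>R w)"
        by (intro image_eqI[of _ _ "vector [s, t]"]) auto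
    qed (auto simp: mem_span_2)
  qed
  then have "Q f" unfolding f_def by (rule someI[of Q])
  then have f: "linear f" "\<And>x. norm (f x) = norm x" "range f = ?E" by (auto simp: Q_def)
  have orthf: "f x \<bullet> f y = x \<bullet> y" for x y
    using f(2)[of "x + y"] f(2)[of x] f(2)[of y]
    by (simp add: linear_add[OF f(1)] norm_eq_sqrt_inner inner_add_left inner_add_right inner_commute)
  define p q where "p = f (axis 1 1)" and "q = f (axis 2 1)"
  have fpq: "f t = t $ 1 *\<^sub>R p + t $ 2 *\<^sub>R q" for t
  proof -
    have "t = t $ 1 *\<^sub>R axis 1 1 + t $ 2 *\<^sub>R axis 2 1" by (simp add: vec_eq_iff forall_2 axis_def)
    then have "f t = f (t $ 1 *\<^sub>R axis 1 1 + t $ 2 *\<^sub>R axis 2 1)" by simp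
    then show ?thesis by (simp only: linear_add[OF f(1)] linear_scale[OF f(1)] p_def q_def)
  qed
  have pq: "p \<bullet> p = 1" "q \<bullet> q = 1" "p \<bullet> q = 0" "q \<bullet> p = 0"
    unfolding p_def q_def orthf by (simp_all add: inner_axis_axis)
  have inj: "f s = f t \<longleftrightarrow> s = t" for s t
    using f(2)[of "s - t"] by (auto simp: linear_diff[OF f(1)])
  have proj: "orth_proj ?E x = f (coords p q x)" for x
  proof (rule orth_proj_eqI)
    show "f (coords p q x) \<in> ?E" using f(3) by blast
    fix z assume "z \<in> ?E"
    then obtain t where "z = f t" using f(3) by blast
    then show "orthogonal (x - f (coords p q x)) z"
      by (simp add: orthogonal_def fpq inner_diff_left inner_add_left inner_add_right pq algebra_simps)
  qed (rule subspace_span)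
  have "f -` (orth_proj ?E ` K) = coords p q ` K"
    by (auto simp: proj inj)
  then have "vol2_in ?E (orth_proj ?E ` K) = shadow K p q"
    unfolding vol2_in_def shadow_def f_def Q_def by simp
  moreover have "p \<in> ?E" "q \<in> ?E" using f(3) by (auto simp: p_def q_def)
  then obtain a b c d where abcd: "p = a *\<^sub>R u + b *\<^sub>R w" "q = c *\<^sub>R u + d *\<^sub>R w"
    by (auto simp: mem_span_2)
  have "a * a + b * b = 1" "c * c + d * d = 1" "a * c + b * d = 0"
    using pq unfolding abcd by (simp_all add: inner_add_left inner_add_right uw wu)
  then have "(a * d - b * c)\<^sup>2 = 1" by algebra
  then have "\<bar>a * d - b * c\<bar> = 1" using power2_eq_1_iff by fastforce
  ultimately show ?thesis
    using shadow_change_basis[OF K, of a u b w c d] by (simp add: abcd)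
qed

lemma subspace_dim_2_orthonormal:
  fixes E :: "'a::euclidean_space set"
  assumes "subspace E" "dim E = 2"
  obtains u w where "u \<bullet> u = 1" "w \<bullet> w = 1" "u \<bullet> w = 0" "E = span {u, w}"
proof -
  obtain B where B: "B \<subseteq> E" "pairwise orthogonal B" "\<And>x. x \<in> B \<Longrightarrow> norm x = 1" "card B = dim E" "span B = E"
    using orthonormal_basis_subspace[OF assms(1)] by metis
  then obtain u w where "B = {u, w}" "u \<noteq> w" using assms(2) by (metis card_2_iff)
  with B show ?thesis
    by (intro that[of u w]) (auto simp: pairwise_def orthogonal_def norm_eq_1)
qed

lemma orth_proj_orthonormal:
  fixes u w :: "'a::euclidean_space"
  assumes uw: "u \<bullet> u = 1" "w \<bullet> w = 1" "u \<bullet> w = 0"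
  shows "orth_proj (span {u, w}) x = (x \<bullet> u) *\<^sub>R u + (x \<bullet> w) *\<^sub>R w"
proof (rule orth_proj_eqI)
  show "(x \<bullet> u) *\<^sub>R u + (x \<bullet> w) *\<^sub>R w \<in> span {u, w}" by (auto simp: mem_span_2)
  fix z assume "z \<in> span {u, w}"
  then obtain s t where "z = s *\<^sub>R u + t *\<^sub>R w" by (auto simp: mem_span_2)
  then show "orthogonal (x - ((x \<bullet> u) *\<^sub>R u + (x \<bullet> w) *\<^sub>R w)) z"
    using uw by (simp add: orthogonal_def inner_diff_left inner_add_left inner_add_right inner_commute[of w u] algebra_simps)
qed (rule subspace_span)

text \<open>
  The area of the projection of \<open>K\<close> to \<open>E\<close> as a measurable function of the operator \<open>Pr\<^sub>E\<close>. A basis of \<open>E\<close> can be found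
  among the vectors \<open>Pr\<^sub>E i\<close> with \<open>i\<close> in the standard basis, but not the same for all \<open>E\<close>; summing over all pairs in numerator
  and denominator avoids the choice.
\<close>
definition proj_area :: "'a::euclidean_space set \<Rightarrow> ('a \<Rightarrow> 'a) \<Rightarrow> real" where
  "proj_area K F = (\<Sum>i\<in>Basis. \<Sum>j\<in>Basis. shadow K (F i) (F j)) /
     (\<Sum>i\<in>Basis. \<Sum>j\<in>Basis. sqrt ((F i \<bullet> F i) * (F j \<bullet> F j) - (F i \<bullet> F j)\<^sup>2))"

text \<open>
  Projected areas with respect to \<open>Pr i\<close> and \<open>Pr j\<close> are the true area times the area of the parallelogram they
  span, whose square is the Gram determinant. Not all these parallelograms degenerate, because the sum of the
  corresponding minors against \<open>(i \<bullet> u) (j \<bullet> w)\<close> is one.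
\<close>
lemma vol2_in_eq_proj_area:
  fixes E :: "'a::euclidean_space set"
  assumes E: "subspace E" "dim E = 2" and K: "compact K"
  shows "vol2_in E (orth_proj E ` K) = proj_area K (orth_proj E)"
proof -
  obtain u w where uw: "u \<bullet> u = 1" "w \<bullet> w = 1" "u \<bullet> w = 0" "E = span {u, w}"
    using subspace_dim_2_orthonormal[OF E] .
  have wu: "w \<bullet> u = 0" using uw by (simp add: inner_commute)
  let ?P = "orth_proj E"
  have P: "?P x = (x \<bullet> u) *\<^sub>R u + (x \<bullet> w) *\<^sub>R w" for x
    unfolding uw(4) by (rule orth_proj_orthonormal[OF uw(1-3)])
  define D where "D i j = (i \<bullet> u) * (j \<bullet> w) - (i \<bullet> w) * (j \<bullet> u)" for i j
  have 1: "shadow K (?P i) (?P j) = \<bar>D i j\<bar> * shadow K u w" for i j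
    unfolding P D_def by (rule shadow_change_basis[OF K])
  have "(?P i \<bullet> ?P i) * (?P j \<bullet> ?P j) - (?P i \<bullet> ?P j)\<^sup>2 = (D i j)\<^sup>2" for i j
    unfolding P D_def by (simp add: inner_add_left inner_add_right uw wu power2_eq_square algebra_simps)
  then have 2: "sqrt ((?P i \<bullet> ?P i) * (?P j \<bullet> ?P j) - (?P i \<bullet> ?P j)\<^sup>2) = \<bar>D i j\<bar>" for i j
    by simp
  have pos: "(\<Sum>i\<in>Basis. \<Sum>j\<in>Basis. \<bar>D i j\<bar>) \<noteq> 0"
  proof
    assume "(\<Sum>i\<in>Basis. \<Sum>j\<in>Basis. \<bar>D i j\<bar>) = 0"
    then have z: "D i j = 0" if "i \<in> Basis" "j \<in> Basis" for i j
      using that by (simp add: sum_nonneg_eq_0_iff sum_nonneg)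
    have "(u \<bullet> u) * (w \<bullet> w) - (u \<bullet> w) * (u \<bullet> w) = (\<Sum>i\<in>Basis. \<Sum>j\<in>Basis. ((i \<bullet> u) * (j \<bullet> w)) * D i j)"
      unfolding D_def euclidean_inner[of u u] euclidean_inner[of w w] euclidean_inner[of u w]
      by (simp add: sum_product right_diff_distrib sum_subtractf inner_commute mult_ac)
    also have "\<dots> = 0" by (simp add: z)
    finally show False by (simp add: uw)
  qed
  have "proj_area K ?P = shadow K u w"
    unfolding proj_area_def 1 2 sum_distrib_right[symmetric] using pos by simp
  then show ?thesis
    using vol2_in_orthonormal[OF uw(1-3) K] by (simp add: uw(4))
qed

lemma measurable_vol2_in:
  fixes K :: "'a::euclidean_space set"
  assumes K: "compact K" "convex K" and X: "\<And>E. E \<in> X \<Longrightarrow> subspace E \<and> dim E = 2"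
  shows "(\<lambda>E. vol2_in E (orth_proj E ` K)) \<in> borel_measurable (subspaces_borel X)"
proof -
  have ev: "(\<lambda>F. blinfun_apply F i) \<in> borel_measurable (borel :: ('a \<Rightarrow>\<^sub>L 'a) measure)" for i
    by (intro borel_measurable_continuous_onI continuous_intros)
  note [measurable] = ev
  have sh: "(\<lambda>F :: 'a \<Rightarrow>\<^sub>L 'a. shadow K (blinfun_apply F i) (blinfun_apply F j)) \<in> borel_measurable borel" for i j
  proof -
    have "(\<lambda>F :: 'a \<Rightarrow>\<^sub>L 'a. (blinfun_apply F i, blinfun_apply F j)) \<in> borel_measurable borel"
      unfolding borel_prod[symmetric] by measurable
    from measurable_compose[OF this measurable_shadow[OF K]] show ?thesis by simp
  qed
  note [measurable] = sh
  have 1: "(\<lambda>F :: 'a \<Rightarrow>\<^sub>L 'a. proj_area K (blinfun_apply F)) \<in> borel_measurable borel"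
    unfolding proj_area_def by measurable
  have 2: "(\<lambda>E. Blinfun (orth_proj E)) \<in> subspaces_borel X \<rightarrow>\<^sub>M borel"
    unfolding subspaces_borel_def by (rule measurable_vimage_algebra1) simp
  have "(\<lambda>E. proj_area K (blinfun_apply (Blinfun (orth_proj E)))) \<in> borel_measurable (subspaces_borel X)"
    by (rule measurable_compose[OF 2 1])
  also have "?this \<longleftrightarrow> (\<lambda>E. vol2_in E (orth_proj E ` K)) \<in> borel_measurable (subspaces_borel X)"
  proof (rule measurable_cong)
    fix E assume "E \<in> space (subspaces_borel X)"
    then have "E \<in> X" by (simp add: subspaces_borel_def)
    with X[OF this] K show "proj_area K (blinfun_apply (Blinfun (orth_proj E))) = vol2_in E (orth_proj E ` K)"
      by (simp add: bounded_linear_Blinfun_apply bounded_linear_orth_proj vol2_in_eq_proj_area)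
  qed
  finally show ?thesis .
qed

text \<open>
  An operator depends continuously on its finitely many matrix entries, so measurability can be checked on the
  images of the basis vectors.
\<close>
lemma borel_measurable_blinfun_componentwise:
  fixes h :: "'m \<Rightarrow> (c2 \<Rightarrow>\<^sub>L c2)"
  assumes "\<And>b. b \<in> Basis \<Longrightarrow> (\<lambda>x. blinfun_apply (h x) b) \<in> borel_measurable M"
  shows "h \<in> borel_measurable M"
proof -
  have "card (UNIV :: 4 set) = card (Basis :: c2 set)" by simp
  then obtain \<beta> :: "4 \<Rightarrow> c2" where \<beta>: "bij_betw \<beta> UNIV Basis"
    using finite_same_card_bij[of "UNIV :: 4 set" "Basis :: c2 set"] by auto
  define \<gamma> where "\<gamma> = inv_into UNIV \<beta>"
  have \<gamma>: "\<beta> (\<gamma> b) = b" if "b \<in> Basis" for b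
    unfolding \<gamma>_def by (rule bij_betw_inv_into_right[OF \<beta> that])
  define \<Psi> :: "c2^4 \<Rightarrow> (c2 \<Rightarrow>\<^sub>L c2)" where "\<Psi> v = blinfun_of_matrix (\<lambda>i j. (v $ \<gamma> j) \<bullet> i)" for v
  have \<Psi>: "\<Psi> \<in> borel_measurable borel"
    unfolding \<Psi>_def by (intro borel_measurable_continuous_onI continuous_intros)
  have "(\<lambda>x. \<chi> k. blinfun_apply (h x) (\<beta> k)) \<in> borel_measurable M"
  proof (subst borel_measurable_euclidean_space, intro ballI)
    fix e :: "c2^4" assume "e \<in> Basis"
    then obtain k b where e: "e = axis k b" "b \<in> Basis" by (auto simp: Basis_vec_def)
    have "(\<lambda>x. blinfun_apply (h x) (\<beta> k)) \<in> borel_measurable M"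
      using \<beta> by (intro assms) (auto simp: bij_betw_def)
    then show "(\<lambda>x. (\<chi> k. blinfun_apply (h x) (\<beta> k)) \<bullet> e) \<in> borel_measurable M"
      by (simp add: e inner_axis)
  qed
  from measurable_compose[OF this \<Psi>]
  have "(\<lambda>x. \<Psi> (\<chi> k. blinfun_apply (h x) (\<beta> k))) \<in> borel_measurable M" .
  moreover have "\<Psi> (\<chi> k. blinfun_apply (h x) (\<beta> k)) = h x" for x
  proof -
    have "\<Psi> (\<chi> k. blinfun_apply (h x) (\<beta> k)) = blinfun_of_matrix (\<lambda>i j. blinfun_apply (h x) j \<bullet> i)"
      by (intro blinfun_eqI) (simp add: \<Psi>_def blinfun_of_matrix_apply \<gamma>)
    then show ?thesis by (simp only: blinfun_of_matrix_works)
  qed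
  ultimately show ?thesis by simp
qed

lemma measurable_into_subspaces_borel:
  fixes h :: "'m \<Rightarrow> c2 set"
  assumes h: "\<And>x. x \<in> space M \<Longrightarrow> h x \<in> X" and X: "\<And>E. E \<in> X \<Longrightarrow> subspace E"
    and meas: "\<And>b. b \<in> Basis \<Longrightarrow> (\<lambda>x. orth_proj (h x) b) \<in> borel_measurable M"
  shows "h \<in> M \<rightarrow>\<^sub>M subspaces_borel X"
  unfolding subspaces_borel_def
proof (rule measurable_vimage_algebra2)
  show "h \<in> space M \<rightarrow> X" using h by auto
  show "(\<lambda>x. Blinfun (orth_proj (h x))) \<in> borel_measurable M"
  proof (rule borel_measurable_blinfun_componentwise)
    fix b :: c2 assume b: "b \<in> Basis"
    have "(\<lambda>x. blinfun_apply (Blinfun (orth_proj (h x))) b) \<in> borel_measurable M \<longleftrightarrow> (\<lambda>x. orth_proj (h x) b) \<in> borel_measurable M"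
      by (rule measurable_cong) (simp add: bounded_linear_Blinfun_apply bounded_linear_orth_proj X h)
    with meas[OF b] show "(\<lambda>x. blinfun_apply (Blinfun (orth_proj (h x))) b) \<in> borel_measurable M" by simp
  qed
qed

lemma measurable_orth_proj:
  fixes X :: "'a::euclidean_space set set"
  assumes X: "\<And>E. E \<in> X \<Longrightarrow> subspace E"
  shows "(\<lambda>E. orth_proj E k) \<in> borel_measurable (subspaces_borel X)"
proof -
  have 2: "(\<lambda>E. Blinfun (orth_proj E)) \<in> subspaces_borel X \<rightarrow>\<^sub>M borel"
    unfolding subspaces_borel_def by (rule measurable_vimage_algebra1) simp
  have ev: "(\<lambda>F. blinfun_apply F k) \<in> borel_measurable (borel :: ('a \<Rightarrow>\<^sub>L 'a) measure)"
    by (intro borel_measurable_continuous_onI continuous_intros)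
  have "(\<lambda>E. blinfun_apply (Blinfun (orth_proj E)) k) \<in> borel_measurable (subspaces_borel X)"
    by (rule measurable_compose[OF 2 ev])
  also have "?this \<longleftrightarrow> ?thesis"
    by (rule measurable_cong) (simp add: subspaces_borel_def bounded_linear_Blinfun_apply bounded_linear_orth_proj X)
  finally show ?thesis .
qed

lemma inner_eq_Re_hermitian: "x \<bullet> y = Re (hermitian x y)"
  by (simp add: hermitian_def c2_simps)

lemma U2_inner: "A \<in> U2 \<Longrightarrow> (A *v x) \<bullet> (A *v y) = x \<bullet> (y :: c2)"
  by (simp add: inner_eq_Re_hermitian U2_def)

lemma linear_mv: "linear ((*v) (A :: complex^2^2))"
  by (rule linearI) (simp_all add: c2_simps matrix_vector_mult_def algebra_simps)

text \<open>
  This is \<open>A \<circ> Pr\<^sub>E \<circ> A\<^sup>*\<close>, with the adjoint spelled out in coordinates to make measurability in \<open>A\<close> and \<open>E\<close> visible.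
\<close>
lemma orth_proj_U2_image:
  assumes A: "A \<in> U2" and E: "subspace E"
  shows "orth_proj ((*v) A ` E) b = (\<Sum>k\<in>Basis. (b \<bullet> (A *v k)) *\<^sub>R (A *v orth_proj E k))"
proof -
  define c where "c = (\<Sum>k\<in>Basis. (b \<bullet> (A *v k)) *\<^sub>R k)"
  have linP: "linear (orth_proj E)" using bounded_linear_orth_proj[OF E] by (rule bounded_linear.linear)
  have eq: "(\<Sum>k\<in>Basis. (b \<bullet> (A *v k)) *\<^sub>R (A *v orth_proj E k)) = A *v orth_proj E c"
    unfolding c_def linear_sum[OF linP] linear_sum[OF linear_mv] linear_scale[OF linP] linear_scale[OF linear_mv] ..
  have c: "b \<bullet> (A *v e) = c \<bullet> e" for e
  proof -
    have "A *v e = (\<Sum>k\<in>Basis. (e \<bullet> k) *\<^sub>R (A *v k))"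
      by (subst euclidean_representation[symmetric, of e])
         (simp only: linear_sum[OF linear_mv] linear_scale[OF linear_mv])
    then show ?thesis
      by (simp add: c_def inner_sum_right inner_sum_left inner_commute mult.commute)
  qed
  show ?thesis
    unfolding eq
  proof (rule orth_proj_eqI)
    show "subspace ((*v) A ` E)" using linear_mv E by (rule linear_subspace_image)
    show "A *v orth_proj E c \<in> (*v) A ` E" using orth_proj_props(1)[OF E] by blast
    fix z assume "z \<in> (*v) A ` E"
    then obtain e where e: "e \<in> E" "z = A *v e" by blast
    have "orthogonal (c - orth_proj E c) e" by (rule orth_proj_props(2)[OF E e(1)])
    then show "orthogonal (b - A *v orth_proj E c) z"
      by (simp add: orthogonal_def e(2) inner_diff_left U2_inner[OF A] c)
  qed
qed

lemma borel_measurable_c2I: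
  fixes f :: "'m \<Rightarrow> c2"
  assumes "(\<lambda>x. f x $ 1) \<in> borel_measurable M" "(\<lambda>x. f x $ 2) \<in> borel_measurable M"
  shows "f \<in> borel_measurable M"
proof -
  have ax: "(axis k :: complex \<Rightarrow> c2) \<in> borel_measurable borel" for k
    by (intro linear_borel_measurable linearI) (auto simp: vec_eq_iff axis_def)
  have "(\<lambda>x. axis 1 (f x $ 1) + axis 2 (f x $ 2) :: c2) \<in> borel_measurable M"
    by (intro borel_measurable_add measurable_compose[OF assms(1) ax] measurable_compose[OF assms(2) ax])
  moreover have "axis 1 (f x $ 1) + axis 2 (f x $ 2) = f x" for x
    by (simp add: vec_eq_iff forall_2 axis_def)
  ultimately show ?thesis by simp
qed

lemma borel_measurable_c2_nth: "f \<in> borel_measurable M \<Longrightarrow> (\<lambda>x. (f x :: c2) $ k) \<in> borel_measurable M"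
  by (rule measurable_compose[of f M borel "\<lambda>y. y $ k"])
     (auto intro!: borel_measurable_continuous_onI continuous_intros)

lemma borel_measurable_mv:
  fixes G :: "'m \<Rightarrow> complex^2^2" and f :: "'m \<Rightarrow> c2"
  assumes "\<And>i j. (\<lambda>x. G x $ i $ j) \<in> borel_measurable M" "f \<in> borel_measurable M"
  shows "(\<lambda>x. G x *v f x) \<in> borel_measurable M"
  by (rule borel_measurable_c2I)
     (auto simp: matrix_vector_mult_def sum_2 intro!: borel_measurable_add borel_measurable_times borel_measurable_c2_nth assms)

text \<open>
  An invariant probability measure \<open>M\<close> is averaged over a random \<open>G \<in> U(2)\<close>. If the law of \<open>G E\<close> does not depend
  on \<open>E\<close>, then Fubini's theorem identifies \<open>M\<close> with this law.
\<close>
lemma haar_eqI: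
  fixes G :: "'m \<Rightarrow> complex^2^2"
  assumes X: "\<And>E. E \<in> X \<Longrightarrow> subspace E" and act: "\<And>A E. A \<in> U2 \<Longrightarrow> E \<in> X \<Longrightarrow> (*v) A ` E \<in> X"
    and N: "prob_space N" and G: "\<And>\<omega>. \<omega> \<in> space N \<Longrightarrow> G \<omega> \<in> U2"
    and G_meas: "\<And>i j. (\<lambda>\<omega>. G \<omega> $ i $ j) \<in> borel_measurable N"
    and L: "sets L = sets (subspaces_borel X)" "prob_space L"
    and inv: "\<And>A B. A \<in> U2 \<Longrightarrow> B \<in> sets L \<Longrightarrow> emeasure L {E \<in> space L. (*v) A ` E \<in> B} = emeasure L B"
    and law: "\<And>E B. E \<in> X \<Longrightarrow> B \<in> sets L \<Longrightarrow> emeasure N {\<omega> \<in> space N. (*v) (G \<omega>) ` E \<in> B} = emeasure L B"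
  shows "haar X = L"
proof -
  interpret N: prob_space N by (rule N)
  have joint: "(\<lambda>(\<omega>, E). (*v) (G \<omega>) ` E) \<in> N \<Otimes>\<^sub>M M \<rightarrow>\<^sub>M M" if M: "sets M = sets (subspaces_borel X)" for M
  proof -
    have sp: "space M = X" using sets_eq_imp_space_eq[OF M] by (simp add: subspaces_borel_def)
    have "(\<lambda>p. (*v) (G (fst p)) ` snd p) \<in> N \<Otimes>\<^sub>M M \<rightarrow>\<^sub>M subspaces_borel X"
    proof (rule measurable_into_subspaces_borel)
      fix p assume "p \<in> space (N \<Otimes>\<^sub>M M)"
      then obtain \<omega> E where "p = (\<omega>, E)" "\<omega> \<in> space N" "E \<in> X" by (auto simp: space_pair_measure sp)
      then show "(*v) (G (fst p)) ` snd p \<in> X" using act[OF G] by simp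
    next
      fix b :: c2 assume "b \<in> Basis"
      have proj: "(\<lambda>E. orth_proj E k) \<in> borel_measurable M" for k
        unfolding measurable_cong_sets[OF M refl] by (rule measurable_orth_proj[OF X])
      have G1: "(\<lambda>p. G (fst p) $ i $ j) \<in> borel_measurable (N \<Otimes>\<^sub>M M)" for i j
        by (rule measurable_compose[OF measurable_fst G_meas])
      have P1: "(\<lambda>p. orth_proj (snd p) k) \<in> borel_measurable (N \<Otimes>\<^sub>M M)" for k
        by (rule measurable_compose[OF measurable_snd proj])
      have "(\<lambda>p. \<Sum>k\<in>Basis. (b \<bullet> (G (fst p) *v k)) *\<^sub>R (G (fst p) *v orth_proj (snd p) k)) \<in> borel_measurable (N \<Otimes>\<^sub>M M)"
        by (intro borel_measurable_sum borel_measurable_scaleR borel_measurable_inner borel_measurable_mv G1 P1 borel_measurable_const)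
      also have "?this \<longleftrightarrow> (\<lambda>p. orth_proj ((*v) (G (fst p)) ` snd p) b) \<in> borel_measurable (N \<Otimes>\<^sub>M M)"
        by (rule measurable_cong) (auto simp: space_pair_measure sp orth_proj_U2_image G X)
      finally show "(\<lambda>p. orth_proj ((*v) (G (fst p)) ` snd p) b) \<in> borel_measurable (N \<Otimes>\<^sub>M M)" .
    qed (rule X)
    then show ?thesis by (simp add: split_beta measurable_cong_sets[OF refl M])
  qed
  have act_meas: "(\<lambda>E. (*v) A ` E) \<in> M \<rightarrow>\<^sub>M M" if M: "sets M = sets (subspaces_borel X)" and A: "A \<in> U2" for M A
  proof -
    have sp: "space M = X" using sets_eq_imp_space_eq[OF M] by (simp add: subspaces_borel_def)
    have "(\<lambda>E. (*v) A ` E) \<in> M \<rightarrow>\<^sub>M subspaces_borel X"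
    proof (rule measurable_into_subspaces_borel)
      fix b :: c2 assume "b \<in> Basis"
      have proj: "(\<lambda>E. orth_proj E k) \<in> borel_measurable M" for k
        unfolding measurable_cong_sets[OF M refl] by (rule measurable_orth_proj[OF X])
      have "(\<lambda>E. \<Sum>k\<in>Basis. (b \<bullet> (A *v k)) *\<^sub>R (A *v orth_proj E k)) \<in> borel_measurable M"
        by (intro borel_measurable_sum borel_measurable_scaleR borel_measurable_mv proj borel_measurable_const)
      also have "?this \<longleftrightarrow> (\<lambda>E. orth_proj ((*v) A ` E) b) \<in> borel_measurable M"
        by (rule measurable_cong) (auto simp: sp orth_proj_U2_image A X)
      finally show "(\<lambda>E. orth_proj ((*v) A ` E) b) \<in> borel_measurable M" .
    qed (use X act[OF A] sp in auto)
    then show ?thesis by (simp add: measurable_cong_sets[OF refl M])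
  qed
  show ?thesis
    unfolding haar_def
  proof (rule the_equality)
    show "sets L = sets (subspaces_borel X) \<and> prob_space L \<and> (\<forall>A\<in>U2. distr L L (\<lambda>E. (*v) A ` E) = L)"
    proof (intro conjI ballI L)
      fix A assume A: "A \<in> U2"
      show "distr L L (\<lambda>E. (*v) A ` E) = L"
      proof (rule measure_eqI)
        fix B assume "B \<in> sets (distr L L (\<lambda>E. (*v) A ` E))"
        then have B: "B \<in> sets L" by simp
        show "emeasure (distr L L (\<lambda>E. (*v) A ` E)) B = emeasure L B"
          unfolding emeasure_distr[OF act_meas[OF L(1) A] B] using inv[OF A B]
          by (simp add: vimage_def Int_def conj_commute)
      qed simp
    qed
  next
    fix M assume M: "sets M = sets (subspaces_borel X) \<and> prob_space M \<and> (\<forall>A\<in>U2. distr M M (\<lambda>E. (*v) A ` E) = M)"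
    then have setsM: "sets M = sets (subspaces_borel X)" by blast
    interpret M: prob_space M using M by blast
    interpret NM: pair_sigma_finite N M ..
    have sp: "space M = X" using sets_eq_imp_space_eq[OF setsM] by (simp add: subspaces_borel_def)
    show "M = L"
    proof (rule measure_eqI)
      show "sets M = sets L" by (simp add: setsM L)
      fix B assume B: "B \<in> sets M"
      have BL: "B \<in> sets L" using B by (simp add: setsM L)
      define f where "f \<omega> E = (indicator B ((*v) (G \<omega>) ` E) :: ennreal)" for \<omega> E
      have f: "(\<lambda>(\<omega>, E). f \<omega> E) \<in> borel_measurable (N \<Otimes>\<^sub>M M)"
      proof -
        have "(\<lambda>p. indicator B (case p of (\<omega>, E) \<Rightarrow> (*v) (G \<omega>) ` E) :: ennreal) \<in> borel_measurable (N \<Otimes>\<^sub>M M)"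
          by (rule measurable_compose[OF joint[OF setsM] borel_measurable_indicator[OF B]])
        then show ?thesis by (simp add: f_def split_beta)
      qed
      have 1: "(\<integral>\<^sup>+E. f \<omega> E \<partial>M) = emeasure M B" if "\<omega> \<in> space N" for \<omega>
      proof -
        note am = act_meas[OF setsM G[OF that]]
        have "emeasure M B = emeasure (distr M M (\<lambda>E. (*v) (G \<omega>) ` E)) B"
          using M G[OF that] by simp
        also have "\<dots> = (\<integral>\<^sup>+E. indicator B E \<partial>(distr M M (\<lambda>E. (*v) (G \<omega>) ` E)))"
          using B by simp
        also have "\<dots> = (\<integral>\<^sup>+E. f \<omega> E \<partial>M)"
          unfolding f_def by (rule nn_integral_distr[OF am]) (use B in simp)
        finally show ?thesis ..
      qed
      have 2: "(\<integral>\<^sup>+\<omega>. f \<omega> E \<partial>N) = emeasure L B" if "E \<in> space M" for E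
      proof -
        have "(\<lambda>\<omega>. (*v) (G \<omega>) ` E) \<in> N \<rightarrow>\<^sub>M M"
          using measurable_Pair1[OF joint[OF setsM] that] by simp
        from measurable_sets[OF this B]
        have meas: "{\<omega> \<in> space N. (*v) (G \<omega>) ` E \<in> B} \<in> sets N"
          by (simp add: vimage_def Int_def conj_commute)
        have "(\<integral>\<^sup>+\<omega>. f \<omega> E \<partial>N) = (\<integral>\<^sup>+\<omega>. indicator {\<omega> \<in> space N. (*v) (G \<omega>) ` E \<in> B} \<omega> \<partial>N)"
          by (intro nn_integral_cong) (auto simp: f_def indicator_def)
        also have "\<dots> = emeasure N {\<omega> \<in> space N. (*v) (G \<omega>) ` E \<in> B}"
          by (rule nn_integral_indicator[OF meas])
        finally show ?thesis using law[OF _ BL] that sp by simp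
      qed
      have "emeasure M B = (\<integral>\<^sup>+\<omega>. (\<integral>\<^sup>+E. f \<omega> E \<partial>M) \<partial>N)"
        by (subst nn_integral_cong[OF 1]) (simp_all add: N.emeasure_space_1)
      also have "\<dots> = (\<integral>\<^sup>+E. (\<integral>\<^sup>+\<omega>. f \<omega> E \<partial>N) \<partial>M)"
        by (rule NM.Fubini'[OF f, symmetric])
      also have "\<dots> = emeasure L B"
        by (subst nn_integral_cong[OF 2]) (simp_all add: M.emeasure_space_1)
      finally show "emeasure M B = emeasure L B" .
    qed
  qed
qed

section \<open>A random unitary map\<close>

definition disc_measure :: "complex measure" where
  "disc_measure = density lborel (\<lambda>z. indicator (cball 0 1) z * ennreal (1 / pi))"

text \<open>
  The density \<open>|y|\<^sup>2\<close> cancels the factor \<open>|y|\<^sup>2\<close> between \<open>shadow K y (ly)\<close> and the projected area.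
\<close>
definition ball_measure :: "c2 measure" where
  "ball_measure = density lborel (\<lambda>y. indicator (cball 0 1) y * ennreal ((norm y)\<^sup>2 / ball_moment))"

text \<open>
  The values at the null set where there is no direction are chosen such that every plane built from them is
  two-dimensional.
\<close>
definition phase :: "complex \<Rightarrow> complex" where "phase z = (if z = 0 then 1 else sgn z)"
definition direction :: "c2 \<Rightarrow> c2" where "direction y = (if y = 0 then axis 1 1 else sgn y)"

lemma norm_phase [simp]: "norm (phase z) = 1"
  by (simp add: phase_def norm_sgn)

lemma norm_direction [simp]: "norm (direction y) = 1"
  by (simp add: direction_def norm_sgn)

lemma inner_direction [simp]: "direction y \<bullet> direction y = 1"
  using norm_direction[of y] unfolding norm_eq_1 .

lemma sets_disc [simp, measurable_cong]: "sets disc_measure = sets borel"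
  and sets_ball [simp, measurable_cong]: "sets ball_measure = sets borel"
  by (simp_all add: disc_measure_def ball_measure_def)

lemma space_disc [simp]: "space disc_measure = UNIV" and space_ball [simp]: "space ball_measure = UNIV"
  by (simp_all add: disc_measure_def ball_measure_def)

lemma measurable_phase [measurable]: "phase \<in> borel_measurable borel"
  unfolding phase_def by measurable

lemma measurable_direction [measurable]: "direction \<in> borel_measurable borel"
proof -
  have "(\<lambda>y :: c2. (1 / norm y) *\<^sub>R y) \<in> borel_measurable borel"
    by measurable
  then have [measurable]: "(sgn :: c2 \<Rightarrow> c2) \<in> borel_measurable borel"
    by (simp add: sgn_div_norm[abs_def] divide_inverse)
  have [measurable]: "{0 :: c2} \<in> sets borel" by simp
  have "direction = (\<lambda>y. if y \<in> {0} then axis 1 1 else sgn y)" by (auto simp: direction_def)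
  moreover have "(\<lambda>y :: c2. if y \<in> {0} then axis 1 1 else sgn y) \<in> borel_measurable borel" by measurable
  ultimately show ?thesis by (simp only:)
qed

lemma nn_integral_disc:
  "f \<in> borel_measurable borel \<Longrightarrow> (\<integral>\<^sup>+z. f z \<partial>disc_measure) = (\<integral>\<^sup>+z. indicator (cball 0 1) z * ennreal (1 / pi) * f z \<partial>lborel)"
  unfolding disc_measure_def by (rule nn_integral_density) (auto intro!: measurable_cball_ennreal)

lemma nn_integral_ball:
  "f \<in> borel_measurable borel \<Longrightarrow> (\<integral>\<^sup>+y. f y \<partial>ball_measure) = (\<integral>\<^sup>+y. indicator (cball 0 1) y * ennreal ((norm y)\<^sup>2 / ball_moment) * f y \<partial>lborel)"
  unfolding ball_measure_def by (rule nn_integral_density) (auto intro!: measurable_cball_ennreal)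

lemma disc_rotation:
  assumes f: "f \<in> borel_measurable borel" and b: "norm b = 1"
  shows "(\<integral>\<^sup>+z. f (b * z) \<partial>disc_measure) = (\<integral>\<^sup>+z. f z \<partial>disc_measure)"
proof -
  have lin: "linear ((*) b)" by (rule linearI) (simp_all add: algebra_simps)
  have d: "distr lborel borel ((*) b) = lborel"
    by (rule lborel_distr_isometry[where 'n = 2, OF lin]) (simp_all add: norm_mult b)
  note m = linear_borel_measurable[OF lin]
  have i: "indicator (cball 0 1) (b * z) = (indicator (cball 0 1) z :: ennreal)" for z
    by (simp add: indicator_def norm_mult b)
  have g: "(\<lambda>z. indicator (cball 0 1) z * ennreal (1 / pi) * f z) \<in> borel_measurable borel"
    using f by (intro borel_measurable_times_ennreal borel_measurable_indicator) auto
  have "(\<integral>\<^sup>+z. f z \<partial>disc_measure) = (\<integral>\<^sup>+z. indicator (cball 0 1) z * ennreal (1 / pi) * f z \<partial>distr lborel borel ((*) b))"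
    by (simp add: nn_integral_disc f d)
  also have "\<dots> = (\<integral>\<^sup>+z. indicator (cball 0 1) (b * z) * ennreal (1 / pi) * f (b * z) \<partial>lborel)"
    by (rule nn_integral_distr) (use m g in simp_all)
  also have "\<dots> = (\<integral>\<^sup>+z. f (b * z) \<partial>disc_measure)"
    unfolding i by (rule nn_integral_disc[symmetric]) (rule measurable_compose[OF m f])
  finally show ?thesis ..
qed

lemma ball_isometry:
  assumes f: "f \<in> borel_measurable borel" and T: "linear T" "\<And>y. norm (T y) = norm y"
  shows "(\<integral>\<^sup>+y. f (T y) \<partial>ball_measure) = (\<integral>\<^sup>+y. f y \<partial>ball_measure)"
proof -
  note m = linear_borel_measurable[OF T(1)]
  have g: "(\<lambda>y. indicator (cball 0 1) y * ennreal ((norm y)\<^sup>2 / ball_moment) * f y) \<in> borel_measurable borel"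
    using f by (intro borel_measurable_times_ennreal borel_measurable_indicator measurable_compose[OF _ measurable_ennreal]) auto
  have i: "indicator (cball 0 1) (T y) = (indicator (cball 0 1) y :: ennreal)" for y
    by (simp add: indicator_def T)
  have "(\<integral>\<^sup>+y. f y \<partial>ball_measure) = ennreal (1 ^ 4) * (\<integral>\<^sup>+y. indicator (cball 0 1) (T y) * ennreal ((norm (T y))\<^sup>2 / ball_moment) * f (T y) \<partial>lborel)"
    unfolding nn_integral_ball[OF f] by (rule nn_integral_similarity[OF T(1) _ _ _ _ g]) (simp_all add: T)
  also have "\<dots> = (\<integral>\<^sup>+y. f (T y) \<partial>ball_measure)"
    unfolding i T(2) by (simp add: nn_integral_ball[OF measurable_compose[OF m f]])
  finally show ?thesis ..
qed

lemma prob_disc: "prob_space disc_measure"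
proof
  have "emeasure disc_measure UNIV = (\<integral>\<^sup>+z. 1 \<partial>disc_measure)" by simp
  also have "\<dots> = (\<integral>\<^sup>+z. ennreal (1 / pi) * indicator (cball 0 1) (z :: complex) \<partial>lborel)"
    by (subst nn_integral_disc) (simp_all add: mult.commute)
  also have "\<dots> = ennreal (1 / pi) * emeasure lborel (cball (0 :: complex) 1)"
    by (rule nn_integral_cmult_indicator) simp
  also have "\<dots> = 1"
    by (simp add: emeasure_cball unit_ball_vol_2 ennreal_mult[symmetric])
  finally show "emeasure disc_measure (space disc_measure) = 1" by simp
qed

text \<open>
  Passing from normalised to homogeneous integrands.
\<close>
lemma nn_integral_ball_gen:
  assumes f: "f \<in> borel_measurable borel" and g: "\<And>y. y \<noteq> 0 \<Longrightarrow> f y = ennreal (g y / (norm y)\<^sup>2)"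
    and g0: "\<And>y. g y \<ge> 0"
  shows "(\<integral>\<^sup>+y. f y \<partial>ball_measure) = ennreal (1 / ball_moment) * (\<integral>\<^sup>+y. indicator (cball 0 1) y * ennreal (g y) \<partial>lborel)"
proof -
  note m = ball_moment_pos
  have fin: "AE y in lborel. indicator (cball 0 1) y * ennreal ((norm y)\<^sup>2 / ball_moment) * f y
     = ennreal (1 / ball_moment) * (indicator (cball 0 1) y * ennreal (g y))"
    using AE_lborel_singleton[of "0 :: c2"]
  proof eventually_elim
    fix y :: c2 assume y: "y \<noteq> 0"
    have "ennreal ((norm y)\<^sup>2 / ball_moment) * f y = ennreal ((norm y)\<^sup>2 / ball_moment * (g y / (norm y)\<^sup>2))"
      using m g0[of y] by (simp only: g[OF y]) (rule ennreal_mult[symmetric], auto)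
    also have "(norm y)\<^sup>2 / ball_moment * (g y / (norm y)\<^sup>2) = 1 / ball_moment * g y" using y by simp
    also have "ennreal (1 / ball_moment * g y) = ennreal (1 / ball_moment) * ennreal (g y)"
      using m g0[of y] by (intro ennreal_mult) auto
    finally have "ennreal ((norm y)\<^sup>2 / ball_moment) * f y = ennreal (1 / ball_moment) * ennreal (g y)" .
    then show "indicator (cball 0 1) y * ennreal ((norm y)\<^sup>2 / ball_moment) * f y
     = ennreal (1 / ball_moment) * (indicator (cball 0 1) y * ennreal (g y))"
      by (simp only: mult.assoc mult.left_commute[of "ennreal (1 / ball_moment)" "indicator (cball 0 1) y"])
  qed
  have f2: "(\<lambda>y. indicator (cball 0 1) y * ennreal (g y)) \<in> borel_measurable borel"
  proof -
    have [measurable]: "{0 :: c2} \<in> sets borel" "f \<in> borel_measurable borel" by (simp_all add: f)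
    have "(\<lambda>y. if y \<in> {0} then ennreal (g 0) else ennreal ((norm y)\<^sup>2) * f y) \<in> borel_measurable borel"
      by measurable
    also have "(\<lambda>y. if y \<in> {0} then ennreal (g 0) else ennreal ((norm y)\<^sup>2) * f y) = (\<lambda>y. ennreal (g y))"
      using g0 by (auto simp: fun_eq_iff g ennreal_mult[symmetric])
    finally show ?thesis by (intro borel_measurable_times_ennreal borel_measurable_indicator) auto
  qed
  show ?thesis
    unfolding nn_integral_ball[OF f] nn_integral_cong_AE[OF fin] using f2 by (intro nn_integral_cmult) simp
qed

lemma prob_ball: "prob_space ball_measure"
proof
  have "emeasure ball_measure UNIV = (\<integral>\<^sup>+y. 1 \<partial>ball_measure)" by simp
  also have "\<dots> = ennreal (1 / ball_moment) * ennreal ball_moment"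
    unfolding ball_moment_eq[symmetric] by (rule nn_integral_ball_gen) auto
  also have "\<dots> = 1" using ball_moment_pos by (simp add: ennreal_mult[symmetric])
  finally show "emeasure ball_measure (space ball_measure) = 1" by simp
qed

definition base_measure :: "(complex \<times> c2) measure" where
  "base_measure = disc_measure \<Otimes>\<^sub>M ball_measure"

lemma sets_base: "sets base_measure = sets (borel \<Otimes>\<^sub>M borel)"
  unfolding base_measure_def by (intro sets_pair_measure_cong) auto

lemma space_base [simp]: "space base_measure = UNIV"
  by (simp add: base_measure_def space_pair_measure)

lemma prob_base: "prob_space base_measure"
proof -
  interpret d: prob_space disc_measure by (rule prob_disc)
  interpret b: prob_space ball_measure by (rule prob_ball)
  interpret pair_prob_space disc_measure ball_measure ..
  show ?thesis unfolding base_measure_def by unfold_locales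
qed

lemma measurable_base_iff: "borel_measurable base_measure = borel_measurable (borel \<Otimes>\<^sub>M borel)"
  by (rule measurable_cong_sets[OF sets_base refl])

lemma nn_integral_base:
  fixes f :: "complex \<times> c2 \<Rightarrow> ennreal"
  assumes "f \<in> borel_measurable base_measure"
  shows "(\<integral>\<^sup>+p. f p \<partial>base_measure) = (\<integral>\<^sup>+z. (\<integral>\<^sup>+y. f (z, y) \<partial>ball_measure) \<partial>disc_measure)"
    and "(\<lambda>z. \<integral>\<^sup>+y. f (z, y) \<partial>ball_measure) \<in> borel_measurable borel"
proof -
  interpret b: prob_space ball_measure by (rule prob_ball)
  show "(\<integral>\<^sup>+p. f p \<partial>base_measure) = (\<integral>\<^sup>+z. (\<integral>\<^sup>+y. f (z, y) \<partial>ball_measure) \<partial>disc_measure)"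
    using b.nn_integral_fst[of f disc_measure] assms by (simp add: base_measure_def)
  have "(\<lambda>z. \<integral>\<^sup>+y. f (z, y) \<partial>ball_measure) \<in> borel_measurable disc_measure"
    using b.borel_measurable_nn_integral_fst[of f disc_measure] assms by (simp add: base_measure_def)
  then show "(\<lambda>z. \<integral>\<^sup>+y. f (z, y) \<partial>ball_measure) \<in> borel_measurable borel"
    by (simp add: measurable_cong_sets[OF sets_disc refl])
qed

text \<open>
  Fubini: for fixed \<open>z\<close> the ball measure absorbs the isometry \<open>T z\<close>, after which the disc absorbs the rotation by \<open>b\<close>.
\<close>
lemma base_invariant:
  fixes f :: "complex \<times> c2 \<Rightarrow> ennreal"
  assumes f: "f \<in> borel_measurable base_measure" and b: "norm b = 1"
    and T: "\<And>z. linear (T z)" "\<And>z y. norm (T z y) = norm y"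
    and fT: "(\<lambda>(z, y). f (b * z, T z y)) \<in> borel_measurable base_measure"
  shows "(\<integral>\<^sup>+(z, y). f (b * z, T z y) \<partial>base_measure) = (\<integral>\<^sup>+p. f p \<partial>base_measure)"
proof -
  have fz: "(\<lambda>y. f (z, y)) \<in> borel_measurable borel" for z
    using measurable_Pair2[of f borel borel borel z] f by (simp add: measurable_base_iff)
  have "(\<integral>\<^sup>+(z, y). f (b * z, T z y) \<partial>base_measure) = (\<integral>\<^sup>+z. (\<integral>\<^sup>+y. f (b * z, T z y) \<partial>ball_measure) \<partial>disc_measure)"
    using nn_integral_base(1)[OF fT] by simp
  also have "\<dots> = (\<integral>\<^sup>+z. (\<integral>\<^sup>+y. f (b * z, y) \<partial>ball_measure) \<partial>disc_measure)"
    by (intro nn_integral_cong ball_isometry[OF fz T])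
  also have "\<dots> = (\<integral>\<^sup>+z. (\<integral>\<^sup>+y. f (z, y) \<partial>ball_measure) \<partial>disc_measure)"
    by (rule disc_rotation[OF nn_integral_base(2)[OF f] b])
  finally show ?thesis by (simp add: nn_integral_base(1)[OF f])
qed

lemma AE_base_nonzero: "AE p in base_measure. fst p \<noteq> 0 \<and> snd p \<noteq> 0"
proof -
  interpret d: prob_space disc_measure by (rule prob_disc)
  interpret b: prob_space ball_measure by (rule prob_ball)
  interpret pair_prob_space disc_measure ball_measure ..
  have 1: "AE z in disc_measure. z \<noteq> 0"
    unfolding disc_measure_def using AE_lborel_singleton[of "0::complex"]
    by (subst AE_density) (auto elim: eventually_mono intro!: measurable_cball_ennreal)
  have 2: "AE y in ball_measure. y \<noteq> 0"
    unfolding ball_measure_def using AE_lborel_singleton[of "0::c2"]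
    by (subst AE_density) (auto elim: eventually_mono intro!: measurable_cball_ennreal)
  show ?thesis unfolding base_measure_def
  proof (rule AE_pair_measure)
    have "{p :: complex \<times> c2. fst p \<noteq> 0 \<and> snd p \<noteq> 0} \<in> sets (borel \<Otimes>\<^sub>M borel)"
      unfolding borel_prod by (intro borel_open open_Collect_conj open_Collect_neq continuous_intros)
    then show "{p \<in> space (disc_measure \<Otimes>\<^sub>M ball_measure). fst p \<noteq> 0 \<and> snd p \<noteq> 0} \<in> sets (disc_measure \<Otimes>\<^sub>M ball_measure)"
      using sets_base space_base by (simp add: base_measure_def)
    show "AE z in disc_measure. AE y in ball_measure. fst (z, y) \<noteq> 0 \<and> snd (z, y) \<noteq> 0"
      using 1 by eventually_elim (use 2 in simp)
  qed
qed

text \<open>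
  A random element of \<open>U(2)\<close>: a scalar times an element of \<open>SU(2)\<close> with first column a uniformly
  distributed unit vector.
\<close>
definition unitary_of :: "complex \<times> c2 \<Rightarrow> complex^2^2" where
  "unitary_of = (\<lambda>(z, y). let c = phase z; u = direction y in
     vector [vector [c * u $ 1, - c * cnj (u $ 2)], vector [c * u $ 2, c * cnj (u $ 1)]])"

lemma unitary_of_mv: "unitary_of (z, y) *v x = phase z *s right_sim (direction y) x"
  by (simp add: vec_eq_iff forall_2 unitary_of_def Let_def matrix_vector_mult_def sum_2 algebra_simps)

lemma hermitian_right_sim: "hermitian (right_sim y x) (right_sim y x') = of_real (y \<bullet> y) * hermitian x x'"
  by (simp add: hermitian_def sum_2 complex_eq_iff inner_vec_def inner_complex_def algebra_simps)

lemma hermitian_smult: "hermitian (c *s x) (d *s y) = c * cnj d * hermitian x y"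
  by (simp add: hermitian_def sum_2 algebra_simps)

lemma unitary_of_U2: "unitary_of p \<in> U2"
proof -
  obtain z y where p: "p = (z, y)" by (cases p)
  have "phase z * cnj (phase z) = 1"
    using complex_norm_square[of "phase z"] by simp
  then show ?thesis
    by (simp add: U2_def p unitary_of_mv hermitian_smult hermitian_right_sim)
qed

lemma phase_right_sim_isometry:
  assumes "norm x = 1"
  shows "linear (\<lambda>y. phase z *s right_sim y x)" "norm (phase z *s right_sim y x) = norm y"
proof -
  show "linear (\<lambda>y. phase z *s right_sim y x)"
    by (rule linearI) (simp_all add: c2_simps algebra_simps)
  have "(c *s v) \<bullet> (c *s v) = (norm c)\<^sup>2 * (v \<bullet> v)" for c and v :: c2
    unfolding cmod_power2 by (simp add: c2_simps power2_eq_square algebra_simps)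
  then have "(phase z *s right_sim y x) \<bullet> (phase z *s right_sim y x) = y \<bullet> y"
    using assms by (simp add: inner_right_sim norm_eq_1)
  then show "norm (phase z *s right_sim y x) = norm y" by (simp only: norm_eq_sqrt_inner)
qed

lemma measurable_phase_fst: "(\<lambda>p. phase (fst p)) \<in> borel_measurable base_measure"
  and measurable_direction_snd: "(\<lambda>p. direction (snd p)) \<in> borel_measurable base_measure"
  unfolding measurable_base_iff
  by (rule measurable_compose[OF measurable_fst measurable_phase], rule measurable_compose[OF measurable_snd measurable_direction])

lemma borel_measurable_cnj: "f \<in> borel_measurable M \<Longrightarrow> (\<lambda>x. cnj (f x)) \<in> borel_measurable M"
  by (rule measurable_compose[of f M borel cnj]) (auto intro!: borel_measurable_continuous_onI continuous_intros)

lemma measurable_unitary_of: "(\<lambda>p. unitary_of p $ i $ j) \<in> borel_measurable base_measure"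
proof -
  note d = borel_measurable_c2_nth[OF measurable_direction_snd]
  have e: "(\<lambda>p. phase (fst p) * direction (snd p) $ k) \<in> borel_measurable base_measure"
    "(\<lambda>p. - phase (fst p) * cnj (direction (snd p) $ k)) \<in> borel_measurable base_measure"
    "(\<lambda>p. phase (fst p) * cnj (direction (snd p) $ k)) \<in> borel_measurable base_measure" for k
    by (intro borel_measurable_times borel_measurable_uminus borel_measurable_cnj measurable_phase_fst d)+
  have "\<forall>i j. (\<lambda>p. unitary_of p $ i $ j) \<in> borel_measurable base_measure"
    using e by (simp add: forall_2 unitary_of_def split_beta Let_def)
  then show ?thesis by blast
qed

text \<open>
  Both the invariance of the law of \<open>h\<close> under \<open>U(2)\<close> and its agreement with the law of a randomly moved fixed plane
  come down to a substitution \<open>(z, y) \<mapsto> (bz, T\<^sub>z y)\<close>, which preserves the base measure.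
\<close>
lemma haar_eq_law:
  fixes h :: "complex \<times> c2 \<Rightarrow> c2 set"
  assumes X: "\<And>E. E \<in> X \<Longrightarrow> subspace E" and act: "\<And>A E. A \<in> U2 \<Longrightarrow> E \<in> X \<Longrightarrow> (*v) A ` E \<in> X"
    and h: "h \<in> base_measure \<rightarrow>\<^sub>M subspaces_borel X"
    and equiv: "\<And>A. A \<in> U2 \<Longrightarrow> \<exists>b. norm b = 1 \<and> (\<forall>z y. z \<noteq> 0 \<longrightarrow> y \<noteq> 0 \<longrightarrow> (*v) A ` h (z, y) = h (b * z, A *v y))"
    and orbit: "\<And>E. E \<in> X \<Longrightarrow> \<exists>b x. norm b = 1 \<and> norm x = 1 \<and>
       (\<forall>z y. z \<noteq> 0 \<longrightarrow> y \<noteq> 0 \<longrightarrow> (*v) (unitary_of (z, y)) ` E = h (b * z, phase z *s right_sim y x))"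
  shows "haar X = distr base_measure (subspaces_borel X) h"
proof -
  let ?L = "distr base_measure (subspaces_borel X) h"
  interpret base: prob_space base_measure by (rule prob_base)
  have emeasure_eq: "(\<integral>\<^sup>+p. indicator B (g p) \<partial>base_measure) = emeasure ?L B"
    if B: "B \<in> sets (subspaces_borel X)" and b: "norm b = 1" and T: "\<And>z. linear (T z)" "\<And>z y. norm (T z y) = norm y"
      and Tm: "(\<lambda>p. T (fst p) (snd p)) \<in> borel_measurable base_measure"
      and g: "\<And>z y. z \<noteq> 0 \<Longrightarrow> y \<noteq> 0 \<Longrightarrow> g (z, y) = h (b * z, T z y)" for B b T g
  proof -
    define f where "f p = (indicator B (h p) :: ennreal)" for p
    have f: "f \<in> borel_measurable base_measure"
      unfolding f_def by (rule measurable_compose[OF h borel_measurable_indicator[OF B]])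
    have "(\<lambda>p. (b * fst p, T (fst p) (snd p))) \<in> base_measure \<rightarrow>\<^sub>M borel \<Otimes>\<^sub>M borel"
    proof (rule measurable_Pair)
      show "(\<lambda>p. b * fst p) \<in> borel_measurable base_measure"
        unfolding measurable_base_iff by measurable
    qed (rule Tm)
    then have "(\<lambda>p. (b * fst p, T (fst p) (snd p))) \<in> base_measure \<rightarrow>\<^sub>M base_measure"
      by (simp add: measurable_cong_sets[OF refl sets_base])
    from measurable_compose[OF this f] have fT: "(\<lambda>(z, y). f (b * z, T z y)) \<in> borel_measurable base_measure"
      by (simp add: split_beta)
    have "(\<integral>\<^sup>+p. indicator B (g p) \<partial>base_measure) = (\<integral>\<^sup>+(z, y). f (b * z, T z y) \<partial>base_measure)"
    proof (rule nn_integral_cong_AE)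
      show "AE p in base_measure. indicator B (g p) = (case p of (z, y) \<Rightarrow> f (b * z, T z y))"
        using AE_base_nonzero by eventually_elim (auto simp: f_def g)
    qed
    also have "\<dots> = (\<integral>\<^sup>+p. f p \<partial>base_measure)"
      by (rule base_invariant[OF f b T fT])
    also have "\<dots> = emeasure ?L B"
      unfolding f_def using nn_integral_distr[OF h, of "indicator B"] B by simp
    finally show ?thesis .
  qed
  have sX: "space (subspaces_borel X) = X" by (simp add: subspaces_borel_def)
  show ?thesis
  proof (rule haar_eqI[OF X act prob_base unitary_of_U2 measurable_unitary_of])
    show "sets ?L = sets (subspaces_borel X)" by simp
    show "prob_space ?L" by (rule base.prob_space_distr[OF h])
  next
    fix A B assume A: "A \<in> U2" and B: "B \<in> sets ?L"
    obtain b where b: "norm b = 1" "\<And>z y. z \<noteq> 0 \<Longrightarrow> y \<noteq> 0 \<Longrightarrow> (*v) A ` h (z, y) = h (b * z, A *v y)"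
      using equiv[OF A] by blast
    have am: "(\<lambda>E. (*v) A ` E) \<in> subspaces_borel X \<rightarrow>\<^sub>M subspaces_borel X"
    proof (rule measurable_into_subspaces_borel)
      fix k :: c2
      have proj: "(\<lambda>E. orth_proj E k) \<in> borel_measurable (subspaces_borel X)" for k
        by (rule measurable_orth_proj[OF X])
      have "(\<lambda>E. \<Sum>j\<in>Basis. (k \<bullet> (A *v j)) *\<^sub>R (A *v orth_proj E j)) \<in> borel_measurable (subspaces_borel X)"
        by (intro borel_measurable_sum borel_measurable_scaleR borel_measurable_mv proj borel_measurable_const)
      also have "?this \<longleftrightarrow> (\<lambda>E. orth_proj ((*v) A ` E) k) \<in> borel_measurable (subspaces_borel X)"
        by (rule measurable_cong) (auto simp: sX orth_proj_U2_image A X)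
      finally show "(\<lambda>E. orth_proj ((*v) A ` E) k) \<in> borel_measurable (subspaces_borel X)" .
    qed (use X act[OF A] sX in auto)
    have setE: "{E \<in> space ?L. (*v) A ` E \<in> B} \<in> sets (subspaces_borel X)"
      using measurable_sets[OF am, of B] B by (simp add: vimage_def Int_def conj_commute)
    have "emeasure ?L {E \<in> space ?L. (*v) A ` E \<in> B} = (\<integral>\<^sup>+E. indicator {E \<in> space ?L. (*v) A ` E \<in> B} E \<partial>?L)"
      using setE by simp
    also have "\<dots> = (\<integral>\<^sup>+p. indicator {E \<in> space ?L. (*v) A ` E \<in> B} (h p) \<partial>base_measure)"
      by (rule nn_integral_distr[OF h]) (use setE in simp)
    also have "\<dots> = (\<integral>\<^sup>+p. indicator B ((*v) A ` h p) \<partial>base_measure)"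
      using measurable_space[OF h] by (intro nn_integral_cong) (auto simp: indicator_def)
    also have "\<dots> = emeasure ?L B"
    proof (rule emeasure_eq[of B b "\<lambda>_. (*v) A", OF _ b(1)])
      show "norm (A *v y) = norm y" for y by (simp add: norm_eq_sqrt_inner U2_inner[OF A])
      have "snd \<in> borel_measurable base_measure" unfolding measurable_base_iff by measurable
      then show "(\<lambda>p. A *v snd p) \<in> borel_measurable base_measure"
        by (intro borel_measurable_mv) auto
    qed (use B b in \<open>auto simp: linear_mv\<close>)
    finally show "emeasure ?L {E \<in> space ?L. (*v) A ` E \<in> B} = emeasure ?L B" .
  next
    fix E B assume E: "E \<in> X" and B: "B \<in> sets ?L"
    obtain b x where b: "norm b = 1" "norm x = 1"
       "\<And>z y. z \<noteq> 0 \<Longrightarrow> y \<noteq> 0 \<Longrightarrow> (*v) (unitary_of (z, y)) ` E = h (b * z, phase z *s right_sim y x)"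
      using orbit[OF E] by metis
    have um: "(\<lambda>p. (*v) (unitary_of p) ` E) \<in> base_measure \<rightarrow>\<^sub>M subspaces_borel X"
    proof (rule measurable_into_subspaces_borel)
      fix k :: c2
      have "(\<lambda>p. \<Sum>j\<in>Basis. (k \<bullet> (unitary_of p *v j)) *\<^sub>R (unitary_of p *v orth_proj E j)) \<in> borel_measurable base_measure"
        by (intro borel_measurable_sum borel_measurable_scaleR borel_measurable_inner borel_measurable_mv
            measurable_unitary_of borel_measurable_const)
      then show "(\<lambda>p. orth_proj ((*v) (unitary_of p) ` E) k) \<in> borel_measurable base_measure"
        by (simp add: orth_proj_U2_image[OF unitary_of_U2 X[OF E]])
    qed (use X act[OF unitary_of_U2 E] in auto)
    have "{p \<in> space base_measure. (*v) (unitary_of p) ` E \<in> B} \<in> sets base_measure"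
      using measurable_sets[OF um, of B] B by (simp add: vimage_def)
    then have "emeasure base_measure {p \<in> space base_measure. (*v) (unitary_of p) ` E \<in> B}
      = (\<integral>\<^sup>+p. indicator {p \<in> space base_measure. (*v) (unitary_of p) ` E \<in> B} p \<partial>base_measure)" by simp
    also have "\<dots> = (\<integral>\<^sup>+p. indicator B ((*v) (unitary_of p) ` E) \<partial>base_measure)"
      by (intro nn_integral_cong) (auto simp: indicator_def)
    also have "\<dots> = emeasure ?L B"
    proof (rule emeasure_eq[of B b "\<lambda>z y. phase z *s right_sim y x", OF _ b(1)])
      show "linear (\<lambda>y. phase z *s right_sim y x)" for z by (rule phase_right_sim_isometry(1)[OF b(2)])
      show "norm (phase z *s right_sim y x) = norm y" for z y by (rule phase_right_sim_isometry(2)[OF b(2)])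
      have s: "snd \<in> borel_measurable base_measure" unfolding measurable_base_iff by measurable
      show "(\<lambda>p. phase (fst p) *s right_sim (snd p) x) \<in> borel_measurable base_measure"
        by (rule borel_measurable_c2I)
           (auto intro!: borel_measurable_times borel_measurable_add borel_measurable_diff measurable_phase_fst
              borel_measurable_cnj borel_measurable_c2_nth s)
    qed (use B b in auto)
    finally show "emeasure base_measure {p \<in> space base_measure. (*v) (unitary_of p) ` E \<in> B} = emeasure ?L B" .
  qed
qed

section \<open>Complex lines and Lagrangian planes\<close>

definition plane :: "real \<times> real \<times> real \<Rightarrow> c2 \<Rightarrow> c2 set" where
  "plane l y = span {y, imag3 l y}"

text \<open>
  For \<open>|c| = 1\<close> this is the complex structure \<open>y \<mapsto> c \<cdot> Jy\<close>; these are the structures orthogonal to \<open>I\<close>.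
\<close>
definition lagr_structure :: "complex \<Rightarrow> real \<times> real \<times> real" where
  "lagr_structure c = (0, Re c, Im c)"

lemma unit3_lagr_structure: "unit3 (lagr_structure c) \<longleftrightarrow> norm c = 1"
  by (simp add: unit3_def lagr_structure_def cmod_def)

lemma imag3_I: "imag3 (1, 0, 0) y = \<i> *s y"
  by (simp add: imag3_def imag_def qI_def)

lemma imag3_lagr_structure: "imag3 (lagr_structure c) y = c *s qJ y"
  unfolding vec_eq_iff forall_2 complex_eq_iff by (simp add: imag3_def lagr_structure_def qJ_def algebra_simps)

lemma inner_imag3_self: "imag3 l y \<bullet> imag3 l y = y \<bullet> y" if "unit3 l"
  using that by (cases l) (auto simp: imag3_def inner_imag unit3_def power2_eq_square)

lemma inner_imag3_orth [simp]: "y \<bullet> imag3 l y = 0"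
  by (cases l) (simp add: imag3_def)

lemma plane_dim:
  assumes l: "unit3 l" and y: "y \<noteq> 0"
  shows "subspace (plane l y)" "dim (plane l y) = 2"
proof -
  show "subspace (plane l y)" by (simp add: plane_def)
  have "y \<noteq> imag3 l y"
  proof
    assume "y = imag3 l y"
    then have "y \<bullet> y = 0" using inner_imag3_orth[of y l] by simp
    then show False using y by simp
  qed
  moreover have "imag3 l y \<noteq> 0" using inner_imag3_self[OF l, of y] y by auto
  moreover have card: "card {y, imag3 l y} = 2" using \<open>y \<noteq> imag3 l y\<close> by simp
  moreover have "pairwise orthogonal {y, imag3 l y}"
    by (simp add: pairwise_insert orthogonal_def inner_commute)
  ultimately have "independent {y, imag3 l y}"
    using y by (intro pairwise_orthogonal_independent) auto
  then show "dim (plane l y) = 2" using card by (simp add: plane_def dim_eq_card_independent)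
qed

lemma mv_smult: "(A :: complex^2^2) *v (c *s x) = c *s (A *v x)"
  by (simp add: vec_eq_iff forall_2 matrix_vector_mult_def sum_2 algebra_simps)

lemma mv_plane: "(*v) A ` plane l y = span {A *v y, A *v imag3 l y}" for A :: "complex^2^2"
  unfolding plane_def using linear_span_image[OF linear_mv, of A "{y, imag3 l y}"] by simp

lemma mv_plane_I: "(*v) A ` plane (1, 0, 0) y = plane (1, 0, 0) (A *v y)" for A :: "complex^2^2"
  unfolding mv_plane unfolding plane_def imag3_I mv_smult ..

lemma direction_isometry:
  assumes "linear T" "\<And>y. norm (T y) = norm y" "y \<noteq> 0"
  shows "direction (T y) = T (direction y)"
proof -
  have "T y \<noteq> 0" using assms(2)[of y] assms(3) by auto
  then show ?thesis using assms by (simp add: direction_def sgn_div_norm linear_scale)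
qed

lemma norm_mv_U2: "A \<in> U2 \<Longrightarrow> norm (A *v y) = norm (y :: c2)"
  by (simp add: norm_eq_sqrt_inner U2_inner)

lemma norm_eq_1_of_square: "(norm x)\<^sup>2 = 1 \<Longrightarrow> norm x = 1"
  using norm_ge_zero[of x] unfolding power2_eq_1_iff by linarith

lemma unit_square_root:
  assumes "norm d = 1" obtains b :: complex where "norm b = 1" "b\<^sup>2 = d"
proof -
  have "(norm (csqrt d))\<^sup>2 = 1" by (simp add: norm_power[symmetric] assms)
  then have "norm (csqrt d) = 1" by (rule norm_eq_1_of_square)
  then show ?thesis using that[of "csqrt d"] by simp
qed

lemma phase_mult: "norm b = 1 \<Longrightarrow> z \<noteq> 0 \<Longrightarrow> phase (b * z) = b * phase z"
  by (auto simp: phase_def sgn_mult) (simp add: sgn_div_norm)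

lemma unitary_of_direction:
  assumes "norm x = 1" "y \<noteq> 0"
  shows "unitary_of (z, y) *v x = direction (phase z *s right_sim y x)"
  using direction_isometry[OF phase_right_sim_isometry[OF assms(1)] assms(2)] by (simp add: unitary_of_mv)

lemma measurable_plane:
  assumes l: "\<And>p. unit3 (l p)" and X: "\<And>p. plane (l p) (direction (snd p)) \<in> X" "\<And>E. E \<in> X \<Longrightarrow> subspace E"
    and meas: "(\<lambda>p. imag3 (l p) (direction (snd p))) \<in> borel_measurable base_measure"
  shows "(\<lambda>p. plane (l p) (direction (snd p))) \<in> base_measure \<rightarrow>\<^sub>M subspaces_borel X"
proof (rule measurable_into_subspaces_borel)
  fix b :: c2
  have "orth_proj (plane (l p) (direction (snd p))) b =
     (b \<bullet> direction (snd p)) *\<^sub>R direction (snd p) + (b \<bullet> imag3 (l p) (direction (snd p))) *\<^sub>R imag3 (l p) (direction (snd p))" for p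
    unfolding plane_def by (rule orth_proj_orthonormal) (simp_all add: inner_imag3_self[OF l])
  moreover have "(\<lambda>p. (b \<bullet> direction (snd p)) *\<^sub>R direction (snd p) + (b \<bullet> imag3 (l p) (direction (snd p))) *\<^sub>R imag3 (l p) (direction (snd p))) \<in> borel_measurable base_measure"
    by (intro borel_measurable_add borel_measurable_scaleR borel_measurable_inner meas measurable_direction_snd borel_measurable_const)
  ultimately show "(\<lambda>p. orth_proj (plane (l p) (direction (snd p))) b) \<in> borel_measurable base_measure" by simp
qed (use X in auto)

lemma plane_I_eq: "plane (1, 0, 0) y = vec.span {y}"
proof -
  have "x \<in> plane (1, 0, 0) y \<longleftrightarrow> (\<exists>c. x = c *s y)" for x
  proof
    assume "x \<in> plane (1, 0, 0) y"
    then obtain s t where "x = s *\<^sub>R y + t *\<^sub>R (\<i> *s y)" by (auto simp: plane_def mem_span_2 imag3_I)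
    then have "x = Complex s t *s y" by (simp add: c2_simps)
    then show "\<exists>c. x = c *s y" by blast
  next
    assume "\<exists>c. x = c *s y"
    then obtain c where "x = c *s y" by blast
    then have "x = Re c *\<^sub>R y + Im c *\<^sub>R (\<i> *s y)" by (simp add: c2_simps)
    then show "x \<in> plane (1, 0, 0) y" by (auto simp: plane_def mem_span_2 imag3_I)
  qed
  then show ?thesis by (auto simp: vec.span_singleton)
qed

lemma plane_I_in_CP1: "y \<noteq> 0 \<Longrightarrow> plane (1, 0, 0) y \<in> CP1"
  by (simp add: CP1_def plane_I_eq vec.dim_span_eq_card_independent)

text \<open>
  A complex line is the complex span of a unit vector \<open>y\<close>, that is the real span of \<open>y\<close> and \<open>Iy\<close>.
\<close>
lemma CP1_cases:
  assumes "E \<in> CP1" obtains y where "norm y = 1" "E = plane (1, 0, 0) y"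
proof -
  obtain B where B: "B \<subseteq> E" "vec.independent B" "E \<subseteq> vec.span B" "card B = vec.dim E"
    using vec.basis_exists[of E] by blast
  then obtain x where x: "B = {x}" using assms by (auto simp: CP1_def card_1_singleton_iff)
  have "E = vec.span {x}"
    using B assms x vec.span_minimal[of B E] by (auto simp: CP1_def)
  moreover have x0: "x \<noteq> 0" using B(2) x vec.dependent_zero by blast
  moreover have "vec.span {x} = vec.span {sgn x}"
  proof -
    have scale: "r *\<^sub>R v = of_real r *s v" for r and v :: c2 by (simp add: c2_simps)
    have "sgn x = of_real (1 / norm x) *s x" unfolding scale[symmetric] by (simp add: sgn_div_norm divide_inverse)
    moreover have "x = of_real (norm x) *s sgn x" unfolding scale[symmetric] using x0 by (simp add: sgn_div_norm)
    moreover have "k *s v \<in> vec.span {v}" for k and v :: c2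
      by (intro vec.span_scale vec.span_base) simp
    ultimately have "sgn x \<in> vec.span {x}" "x \<in> vec.span {sgn x}" by metis+
    then show ?thesis by (intro equalityI vec.span_minimal vec.subspace_span) auto
  qed
  ultimately show ?thesis using that[of "sgn x"] by (simp add: norm_sgn plane_I_eq)
qed

lemma CP1_dim: "E \<in> CP1 \<Longrightarrow> subspace E \<and> dim E = 2"
proof -
  assume "E \<in> CP1"
  then obtain y where y: "norm y = 1" "E = plane (1, 0, 0) y" by (rule CP1_cases)
  then have "y \<noteq> 0" by auto
  then show ?thesis using plane_dim[of "(1, 0, 0)" y] y by (simp add: unit3_def)
qed

lemma direction_nonzero [simp]: "direction y \<noteq> 0"
  using norm_direction[of y] by (metis norm_zero zero_neq_one)

lemma haar_CP1: "haar CP1 = distr base_measure (subspaces_borel CP1) (\<lambda>p. plane (1, 0, 0) (direction (snd p)))"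
    and measurable_CP1: "(\<lambda>p. plane (1, 0, 0) (direction (snd p))) \<in> base_measure \<rightarrow>\<^sub>M subspaces_borel CP1"
proof -
  show meas: "(\<lambda>p. plane (1, 0, 0) (direction (snd p))) \<in> base_measure \<rightarrow>\<^sub>M subspaces_borel CP1"
  proof (rule measurable_plane)
    show "(\<lambda>p. imag3 (1, 0, 0) (direction (snd p))) \<in> borel_measurable base_measure"
      by (rule measurable_compose[OF measurable_direction_snd linear_borel_measurable[OF linear_imag3]])
  qed (use CP1_dim plane_I_in_CP1 in \<open>auto simp: unit3_def\<close>)
  show "haar CP1 = distr base_measure (subspaces_borel CP1) (\<lambda>p. plane (1, 0, 0) (direction (snd p)))"
  proof (rule haar_eq_law[OF _ _ meas])
    show "subspace E" if "E \<in> CP1" for E using CP1_dim[OF that] by simp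
    show "(*v) A ` E \<in> CP1" if A: "A \<in> U2" and E: "E \<in> CP1" for A E
    proof -
      obtain y where y: "norm y = 1" "E = plane (1, 0, 0) y" using CP1_cases[OF E] .
      have "A *v y \<noteq> 0" using norm_mv_U2[OF A, of y] y by auto
      then show ?thesis by (simp add: y mv_plane_I plane_I_in_CP1)
    qed
  next
    fix A assume A: "A \<in> U2"
    show "\<exists>b :: complex. norm b = 1 \<and> (\<forall>z y. z \<noteq> 0 \<longrightarrow> y \<noteq> 0 \<longrightarrow>
      (*v) A ` plane (1, 0, 0) (direction (snd (z, y))) = plane (1, 0, 0) (direction (snd (b * z, A *v y))))"
      by (intro exI[of _ 1]) (simp add: mv_plane_I direction_isometry[OF linear_mv norm_mv_U2[OF A]])
  next
    fix E assume "E \<in> CP1"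
    then obtain x where x: "norm x = 1" "E = plane (1, 0, 0) x" by (rule CP1_cases)
    show "\<exists>b x. norm b = 1 \<and> norm x = 1 \<and> (\<forall>z y. z \<noteq> 0 \<longrightarrow> y \<noteq> 0 \<longrightarrow>
       (*v) (unitary_of (z, y)) ` E = plane (1, 0, 0) (direction (snd (b * z, phase z *s right_sim y x))))"
    proof (rule exI[of _ 1], rule exI[of _ x], intro conjI allI impI)
      fix z :: complex and y :: c2 assume y: "y \<noteq> 0"
      show "(*v) (unitary_of (z, y)) ` E = plane (1, 0, 0) (direction (snd (1 * z, phase z *s right_sim y x)))"
        unfolding x(2) mv_plane_I unitary_of_direction[OF x(1) y] by simp
    qed (use x in auto)
  qed
qed

lemma plane_lagr_structure_in_LGr2:
  assumes c: "norm c = 1" and y: "y \<noteq> 0" shows "plane (lagr_structure c) y \<in> LGr2"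
proof -
  have "Im (hermitian u v) = 0" if uv: "u \<in> plane (lagr_structure c) y" "v \<in> plane (lagr_structure c) y" for u v
  proof -
    obtain s t where u: "u = s *\<^sub>R y + t *\<^sub>R imag3 (lagr_structure c) y"
      using uv(1) unfolding plane_def mem_span_2 by blast
    obtain s' t' where v: "v = s' *\<^sub>R y + t' *\<^sub>R imag3 (lagr_structure c) y"
      using uv(2) unfolding plane_def mem_span_2 by blast
    show ?thesis unfolding u v hermitian_def
      by (simp add: sum_2 imag3_def lagr_structure_def algebra_simps)
  qed
  then show ?thesis using plane_dim[of "lagr_structure c" y] c y by (simp add: LGr2_def unit3_lagr_structure)
qed

text \<open>
  The hermitian complement of \<open>u\<close> is the complex line through \<open>Ju\<close>.
\<close>
lemma hermitian_orthogonal: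
  assumes "u \<bullet> u = 1" "hermitian w u = 0"
  shows "w = hermitian w (qJ u) *s qJ u"
proof -
  define a b a' b' x y where "a = u $ 1" and "b = u $ 2" and "a' = cnj (u $ 1)" and "b' = cnj (u $ 2)"
    and "x = w $ 1" and "y = w $ 2"
  have "hermitian u u = 1"
    using assms(1) by (simp add: hermitian_def sum_2 complex_eq_iff inner_vec_def inner_complex_def)
  then have n: "a * a' + b * b' = 1" by (simp add: hermitian_def sum_2 a_def b_def a'_def b'_def)
  have h: "x * a' + y * b' = 0" using assms(2) by (simp add: hermitian_def sum_2 a'_def b'_def x_def y_def)
  have xe: "x = (x * (- b) + y * a) * (- b')" and ye: "y = (x * (- b) + y * a) * a'"
    using n h by algebra+
  have hq: "hermitian w (qJ u) = x * (- b) + y * a"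
    by (simp add: hermitian_def sum_2 qJ_def a_def b_def x_def y_def)
  have q: "qJ u $ 1 = - b'" "qJ u $ 2 = a'" by (simp_all add: qJ_def a'_def b'_def)
  show ?thesis
    unfolding vec_eq_iff forall_2 vector_smult_component hq q x_def[symmetric] y_def[symmetric]
    using xe ye by (rule conjI)
qed

text \<open>
  For an orthonormal basis \<open>u, w\<close> of a Lagrangian plane the real and the imaginary part of the hermitian product
  vanish, so \<open>w\<close> is a unit multiple of \<open>Ju\<close>.
\<close>
lemma LGr2_cases:
  assumes "F \<in> LGr2" obtains c y where "norm c = 1" "norm y = 1" "F = plane (lagr_structure c) y"
proof -
  have F: "subspace F" "dim F = 2" "\<And>x y. x \<in> F \<Longrightarrow> y \<in> F \<Longrightarrow> Im (hermitian x y) = 0"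
    using assms by (auto simp: LGr2_def)
  obtain u w where uw: "u \<bullet> u = 1" "w \<bullet> w = 1" "u \<bullet> w = 0" "F = span {u, w}"
    using subspace_dim_2_orthonormal[OF F(1,2)] .
  have "Re (hermitian w u) = 0" using uw(3) inner_eq_Re_hermitian[of w u] by (simp add: inner_commute)
  moreover have "Im (hermitian w u) = 0" using F(3)[of w u] by (simp add: uw(4) span_base)
  ultimately have "hermitian w u = 0" by (simp add: complex_eq_iff)
  then have w: "w = hermitian w (qJ u) *s qJ u" by (rule hermitian_orthogonal[OF uw(1)])
  define c where "c = hermitian w (qJ u)"
  have wc: "w = imag3 (lagr_structure c) u" using w by (simp add: c_def imag3_lagr_structure)
  have "w \<bullet> w = (norm c)\<^sup>2 * (u \<bullet> u)"
    unfolding wc cmod_power2 by (simp add: imag3_def lagr_structure_def inner_imag power2_eq_square)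
  then have "(norm c)\<^sup>2 = 1" using uw by simp
  then have "norm c = 1" by (rule norm_eq_1_of_square)
  then show ?thesis using that[of c u] uw by (simp add: plane_def wc norm_eq_1)
qed

lemma LGr2_dim: "E \<in> LGr2 \<Longrightarrow> subspace E \<and> dim E = 2"
  by (simp add: LGr2_def)

text \<open>
  The factor \<open>d\<close> is the determinant of \<open>A\<close>, and the identity expresses Cramer's rule \<open>A\<^sup>* = A\<^sup>-\<^sup>1\<close>.
\<close>
lemma U2_qJ:
  assumes A: "A \<in> U2"
  obtains d where "norm d = 1" "\<And>x. A *v qJ x = d *s qJ (A *v x)"
proof -
  define p q r s where "p = A $ 1 $ 1" and "q = A $ 1 $ 2" and "r = A $ 2 $ 1" and "s = A $ 2 $ 2"
  define p' q' r' s' where "p' = cnj p" and "q' = cnj q" and "r' = cnj r" and "s' = cnj s"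
  have col: "(A *v axis 1 1) $ 1 = p" "(A *v axis 1 1) $ 2 = r" "(A *v axis 2 1) $ 1 = q" "(A *v axis 2 1) $ 2 = s"
    by (simp_all add: p_def q_def r_def s_def matrix_vector_mult_def sum_2 axis_def)
  have h: "hermitian (A *v x) (A *v y) = hermitian x y" for x y using A by (simp add: U2_def)
  have 1: "p * p' + r * r' = 1" "q * q' + s * s' = 1" "p * q' + r * s' = 0" "q * p' + s * r' = 0"
    using h[of "axis 1 1" "axis 1 1"] h[of "axis 2 1" "axis 2 1"] h[of "axis 1 1" "axis 2 1"] h[of "axis 2 1" "axis 1 1"]
    by (simp_all add: hermitian_def sum_2 col p'_def q'_def r'_def s'_def) (simp_all add: axis_def)
  define d where "d = p * s - q * r"
  define d' where "d' = p' * s' - q' * r'"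
  have e: "q = - d * r'" "p = d * s'" "s = d * p'" "r = - d * q'"
    using 1 unfolding d_def by algebra+
  have "d * d' = 1" using 1 unfolding d_def d'_def by algebra
  moreover have "d' = cnj d" by (simp add: d_def d'_def p'_def q'_def r'_def s'_def)
  ultimately have "(norm d)\<^sup>2 = 1" by (metis complex_norm_square of_real_eq_1_iff)
  then have "norm d = 1" by (rule norm_eq_1_of_square)
  moreover have "A *v qJ x = d *s qJ (A *v x)" for x
  proof -
    define x1 x2 where "x1 = cnj (x $ 1)" and "x2 = cnj (x $ 2)"
    have "p * (- x2) + q * x1 = d * (- (r' * x1 + s' * x2))" "r * (- x2) + s * x1 = d * (p' * x1 + q' * x2)"
      using e by algebra+
    then show ?thesis
      by (simp add: vec_eq_iff forall_2 qJ_def matrix_vector_mult_def sum_2 p_def q_def r_def s_def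
          p'_def q'_def r'_def s'_def x1_def x2_def)
  qed
  ultimately show ?thesis using that by blast
qed

lemma mv_plane_lagr_structure:
  assumes "\<And>x. A *v qJ x = d *s qJ (A *v x)"
  shows "(*v) A ` plane (lagr_structure c) y = plane (lagr_structure (d * c)) (A *v y)"
  unfolding mv_plane unfolding plane_def imag3_lagr_structure mv_smult assms
  by (simp add: vector_smult_assoc mult.commute)

lemma unitary_of_qJ: "unitary_of (z, y) *v qJ x = (phase z)\<^sup>2 *s qJ (unitary_of (z, y) *v x)"
proof -
  define c where "c = phase z"
  have c: "c * cnj c = 1" using complex_norm_square[of c] by (simp add: c_def)
  have J: "right_sim u (qJ x) = qJ (right_sim u x)" for u
    by (simp add: vec_eq_iff forall_2 qJ_def)
  have "(phase z)\<^sup>2 *s qJ (unitary_of (z, y) *v x) = (c * (c * cnj c)) *s qJ (right_sim (direction y) x)"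
    unfolding unitary_of_mv c_def[symmetric]
    by (simp add: vec_eq_iff forall_2 qJ_def power2_eq_square algebra_simps)
  then show ?thesis by (simp add: c unitary_of_mv c_def[symmetric] J)
qed

text \<open>
  A unitary \<open>A\<close> maps the lines of \<open>cJ\<close> to those of \<open>det(A) cJ\<close>, and a scalar \<open>z\<close> has determinant \<open>z\<^sup>2\<close>. This is why the
  square of the phase appears: it lets a square root of \<open>det(A)\<close> be absorbed by a rotation of \<open>z\<close>.
\<close>
lemma haar_LGr2: "haar LGr2 = distr base_measure (subspaces_borel LGr2) (\<lambda>p. plane (lagr_structure ((phase (fst p))\<^sup>2)) (direction (snd p)))"
    and measurable_LGr2: "(\<lambda>p. plane (lagr_structure ((phase (fst p))\<^sup>2)) (direction (snd p))) \<in> base_measure \<rightarrow>\<^sub>M subspaces_borel LGr2"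
proof -
  show meas: "(\<lambda>p. plane (lagr_structure ((phase (fst p))\<^sup>2)) (direction (snd p))) \<in> base_measure \<rightarrow>\<^sub>M subspaces_borel LGr2"
  proof (rule measurable_plane)
    show "(\<lambda>p. imag3 (lagr_structure ((phase (fst p))\<^sup>2)) (direction (snd p))) \<in> borel_measurable base_measure"
      unfolding imag3_lagr_structure
      by (rule borel_measurable_c2I)
         (auto simp: qJ_def intro!: borel_measurable_times borel_measurable_power borel_measurable_uminus measurable_phase_fst
           borel_measurable_cnj borel_measurable_c2_nth measurable_direction_snd)
  qed (auto simp: unit3_lagr_structure norm_power LGr2_dim intro: plane_lagr_structure_in_LGr2)
  show "haar LGr2 = distr base_measure (subspaces_borel LGr2) (\<lambda>p. plane (lagr_structure ((phase (fst p))\<^sup>2)) (direction (snd p)))"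
  proof (rule haar_eq_law[OF _ _ meas])
    show "subspace E" if "E \<in> LGr2" for E using LGr2_dim[OF that] by simp
    show "(*v) A ` E \<in> LGr2" if A: "A \<in> U2" and E: "E \<in> LGr2" for A E
    proof -
      obtain c y where y: "norm c = 1" "norm y = 1" "E = plane (lagr_structure c) y" using LGr2_cases[OF E] .
      obtain d where d: "norm d = 1" "\<And>x. A *v qJ x = d *s qJ (A *v x)" using U2_qJ[OF A] by blast
      have "A *v y \<noteq> 0" using norm_mv_U2[OF A, of y] y by auto
      then show ?thesis by (simp add: y mv_plane_lagr_structure[OF d(2)] plane_lagr_structure_in_LGr2 norm_mult d)
    qed
  next
    fix A assume A: "A \<in> U2"
    obtain d where d: "norm d = 1" "\<And>x. A *v qJ x = d *s qJ (A *v x)" using U2_qJ[OF A] by blast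
    obtain b where b: "norm b = 1" "b\<^sup>2 = d" using unit_square_root[OF d(1)] .
    have "(*v) A ` plane (lagr_structure ((phase (fst (z, y)))\<^sup>2)) (direction (snd (z, y))) =
        plane (lagr_structure ((phase (fst (b * z, A *v y)))\<^sup>2)) (direction (snd (b * z, A *v y)))" if "z \<noteq> 0" "y \<noteq> 0" for z y
      using that by (simp add: mv_plane_lagr_structure[OF d(2)] phase_mult[OF b(1)] power_mult_distrib b(2)
        direction_isometry[OF linear_mv norm_mv_U2[OF A]])
    with b(1) show "\<exists>b. norm b = 1 \<and> (\<forall>z y. z \<noteq> 0 \<longrightarrow> y \<noteq> 0 \<longrightarrow>
      (*v) A ` plane (lagr_structure ((phase (fst (z, y)))\<^sup>2)) (direction (snd (z, y))) =
        plane (lagr_structure ((phase (fst (b * z, A *v y)))\<^sup>2)) (direction (snd (b * z, A *v y))))"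
      by blast
  next
    fix E assume "E \<in> LGr2"
    then obtain c x where x: "norm c = 1" "norm x = 1" "E = plane (lagr_structure c) x" by (rule LGr2_cases)
    obtain b where b: "norm b = 1" "b\<^sup>2 = c" using unit_square_root[OF x(1)] .
    have "(*v) (unitary_of (z, y)) ` E =
        plane (lagr_structure ((phase (fst (b * z, phase z *s right_sim y x)))\<^sup>2)) (direction (snd (b * z, phase z *s right_sim y x)))"
      if "z \<noteq> 0" "y \<noteq> 0" for z y
      unfolding x(3) mv_plane_lagr_structure[OF unitary_of_qJ] unitary_of_direction[OF x(2) that(2)] fst_conv snd_conv
        phase_mult[OF b(1) that(1)] power_mult_distrib b(2) by (simp only: mult.commute)
    with b(1) x(2) show "\<exists>b x. norm b = 1 \<and> norm x = 1 \<and> (\<forall>z y. z \<noteq> 0 \<longrightarrow> y \<noteq> 0 \<longrightarrow>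
       (*v) (unitary_of (z, y)) ` E =
        plane (lagr_structure ((phase (fst (b * z, phase z *s right_sim y x)))\<^sup>2)) (direction (snd (b * z, phase z *s right_sim y x))))"
      by blast
  qed
qed

lemma vol2_in_plane:
  assumes l: "unit3 l" and K: "compact K"
  shows "vol2_in (plane l (direction y)) (orth_proj (plane l (direction y)) ` K) = shadow K (direction y) (imag3 l (direction y))"
  unfolding plane_def by (rule vol2_in_orthonormal[OF _ _ _ K]) (simp_all add: inner_imag3_self[OF l])

lemma haar_integral_planes:
  assumes K: "compact K" "convex K" and X: "\<And>E. E \<in> X \<Longrightarrow> subspace E \<and> dim E = 2"
    and l: "\<And>z. unit3 (l z)"
    and h: "(\<lambda>p. plane (l (fst p)) (direction (snd p))) \<in> base_measure \<rightarrow>\<^sub>M subspaces_borel X"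
  shows "(\<integral>E. vol2_in E (orth_proj E ` K) \<partial>distr base_measure (subspaces_borel X) (\<lambda>p. plane (l (fst p)) (direction (snd p))))
     = enn2real (\<integral>\<^sup>+z. ennreal (1 / ball_moment) * line_avg (l z) K \<partial>disc_measure)"
    and "(\<lambda>z. ennreal (1 / ball_moment) * line_avg (l z) K) \<in> borel_measurable borel"
proof -
  let ?v = "\<lambda>E. vol2_in E (orth_proj E ` K)" and ?h = "\<lambda>p. plane (l (fst p)) (direction (snd p))"
  note v = measurable_vol2_in[OF K X]
  have vh: "(\<lambda>p. ?v (?h p)) \<in> borel_measurable base_measure"
    by (rule measurable_compose[OF h v])
  then have vhe: "(\<lambda>p. ennreal (?v (?h p))) \<in> borel_measurable base_measure" by measurable
  have inner: "(\<integral>\<^sup>+y. ennreal (?v (?h (z, y))) \<partial>ball_measure) = ennreal (1 / ball_moment) * line_avg (l z) K" for z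
    unfolding line_avg_eq
  proof (rule nn_integral_ball_gen)
    show "(\<lambda>y. ennreal (?v (?h (z, y)))) \<in> borel_measurable borel"
      using measurable_Pair2[OF vhe[unfolded measurable_base_iff], of z] by simp
    fix y :: c2 assume y: "y \<noteq> 0"
    have "direction y = (1 / norm y) *\<^sub>R y" using y by (simp add: direction_def sgn_div_norm divide_inverse)
    moreover have "?v (?h (z, y)) = shadow K (direction y) (imag3 (l z) (direction y))"
      by (simp only: fst_conv snd_conv vol2_in_plane[OF l K(1)])
    ultimately have "?v (?h (z, y)) = shadow K ((1 / norm y) *\<^sub>R y) ((1 / norm y) *\<^sub>R imag3 (l z) y)"
      by (simp only: linear_scale[OF linear_imag3])
    also have "\<dots> = shadow K y (imag3 (l z) y) / (norm y)\<^sup>2"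
      unfolding shadow_scale[OF K(1)] by (simp add: power_divide)
    finally show "ennreal (?v (?h (z, y))) = ennreal (shadow K y (imag3 (l z) y) / (norm y)\<^sup>2)" by simp
  qed (rule shadow_nonneg)
  have "(\<integral>E. ?v E \<partial>distr base_measure (subspaces_borel X) ?h) = (\<integral>p. ?v (?h p) \<partial>base_measure)"
    by (rule integral_distr[OF h v])
  also have "\<dots> = enn2real (\<integral>\<^sup>+p. ennreal (?v (?h p)) \<partial>base_measure)"
    by (rule integral_eq_nn_integral[OF vh]) (simp add: vol2_in_def)
  also have "(\<integral>\<^sup>+p. ennreal (?v (?h p)) \<partial>base_measure) = (\<integral>\<^sup>+z. ennreal (1 / ball_moment) * line_avg (l z) K \<partial>disc_measure)"
    by (subst nn_integral_base(1)[OF vhe]) (simp only: inner)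
  finally show "(\<integral>E. ?v E \<partial>distr base_measure (subspaces_borel X) ?h)
     = enn2real (\<integral>\<^sup>+z. ennreal (1 / ball_moment) * line_avg (l z) K \<partial>disc_measure)" .
  show "(\<lambda>z. ennreal (1 / ball_moment) * line_avg (l z) K) \<in> borel_measurable borel"
    using nn_integral_base(2)[OF vhe] unfolding inner .
qed

lemma phi_eq:
  assumes K: "compact K" "convex K"
  shows "phi K = enn2real (line_avg (1, 0, 0) K) / ball_moment"
proof -
  interpret d: prob_space disc_measure by (rule prob_disc)
  have "phi K = enn2real (\<integral>\<^sup>+z. ennreal (1 / ball_moment) * line_avg (1, 0, 0) K \<partial>disc_measure)"
    unfolding phi_def haar_CP1
    by (rule haar_integral_planes(1)[OF K CP1_dim _ measurable_CP1]) (simp_all add: unit3_def)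
  also have "\<dots> = enn2real (ennreal (1 / ball_moment) * line_avg (1, 0, 0) K)"
    by (simp add: d.emeasure_space_1[simplified])
  finally show ?thesis using ball_moment_pos by (simp add: enn2real_mult)
qed

text \<open>
  Rotating \<open>z\<close> by an eighth of a turn multiplies \<open>(phase z)\<^sup>2\<close> by \<open>\<i>\<close>. The structures \<open>cJ\<close> and \<open>\<i>cJ\<close> are orthogonal to each
  other and to \<open>I\<close>, so the two values of \<open>\<Gamma>\<close> add up to \<open>\<Gamma>\<^sub>J + \<Gamma>\<^sub>K\<close> for every \<open>z\<close>, before any integration.
\<close>
lemma psi_eq:
  assumes K: "compact K" "convex K" "K \<noteq> {}"
  shows "2 * psi K = (enn2real (line_avg (0, 1, 0) K) + enn2real (line_avg (0, 0, 1) K)) / ball_moment"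
proof -
  interpret d: prob_space disc_measure by (rule prob_disc)
  define F where "F z = ennreal (1 / ball_moment) * line_avg (lagr_structure ((phase z)\<^sup>2)) K" for z
  have psi: "psi K = enn2real (\<integral>\<^sup>+z. F z \<partial>disc_measure)"
    unfolding psi_def haar_LGr2 F_def
    by (rule haar_integral_planes(1)[OF K(1,2) LGr2_dim _ measurable_LGr2]) (simp_all add: unit3_lagr_structure norm_power)
  have F: "F \<in> borel_measurable borel"
    unfolding F_def
    by (rule haar_integral_planes(2)[OF K(1,2) LGr2_dim _ measurable_LGr2]) (simp_all add: unit3_lagr_structure norm_power)
  obtain b where b: "norm b = 1" "b\<^sup>2 = \<i>" using unit_square_root[of \<i>] by auto
  let ?C = "ennreal (1 / ball_moment) * (line_avg (0, 1, 0) K + line_avg (0, 0, 1) K)"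
  have pair: "F z + F (b * z) = ?C" if "z \<noteq> 0" for z
  proof -
    define c where "c = (phase z)\<^sup>2"
    have c: "norm c = 1" by (simp add: c_def norm_power)
    then have c2: "(Re c)\<^sup>2 + (Im c)\<^sup>2 = 1" by (simp add: cmod_def)
    have "(phase (b * z))\<^sup>2 = \<i> * c" by (simp add: phase_mult[OF b(1) that] power_mult_distrib b(2) c_def)
    then have "F z + F (b * z) = ennreal (1 / ball_moment) * (\<Sum>l\<leftarrow>[lagr_structure c, lagr_structure (\<i> * c)]. line_avg l K)"
      by (simp add: F_def c_def[symmetric] distrib_left)
    also have "(\<Sum>l\<leftarrow>[lagr_structure c, lagr_structure (\<i> * c)]. line_avg l K) = (\<Sum>l\<leftarrow>[(0, 1, 0), (0, 0, 1)]. line_avg l K)"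
    proof (rule sum_line_avg_cong[OF K])
      fix A B C D E F'
      have "(\<Sum>l\<leftarrow>[lagr_structure c, lagr_structure (\<i> * c)]. quad A B C D E F' l) = (B + C) * ((Re c)\<^sup>2 + (Im c)\<^sup>2)"
        by (simp add: lagr_structure_def quad_def algebra_simps)
      also have "\<dots> = (\<Sum>l\<leftarrow>[(0, 1, 0), (0, 0, 1)]. quad A B C D E F' l)"
        by (simp add: c2 quad_def)
      finally show "(\<Sum>l\<leftarrow>[lagr_structure c, lagr_structure (\<i> * c)]. quad A B C D E F' l) = (\<Sum>l\<leftarrow>[(0, 1, 0), (0, 0, 1)]. quad A B C D E F' l)" .
    next
      show "unit3 l" if "l \<in> set [lagr_structure c, lagr_structure (\<i> * c)]" for l using that c by (auto simp: unit3_lagr_structure norm_mult)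
      show "unit3 l" if "l \<in> set [(0, 1, 0), (0, 0, 1)]" for l using that by (auto simp: unit3_def)
    qed
    finally show ?thesis by simp
  qed
  have Fb: "(\<lambda>z. F (b * z)) \<in> borel_measurable borel"
    by (rule measurable_compose[OF _ F]) simp
  have AE: "AE z in disc_measure. z \<noteq> 0"
    unfolding disc_measure_def using AE_lborel_singleton[of "0::complex"]
    by (subst AE_density) (auto elim: eventually_mono intro!: measurable_cball_ennreal)
  have "(\<integral>\<^sup>+z. F z \<partial>disc_measure) + (\<integral>\<^sup>+z. F z \<partial>disc_measure)
     = (\<integral>\<^sup>+z. F z \<partial>disc_measure) + (\<integral>\<^sup>+z. F (b * z) \<partial>disc_measure)"
    by (simp only: disc_rotation[OF F b(1)])
  also have "\<dots> = (\<integral>\<^sup>+z. F z + F (b * z) \<partial>disc_measure)"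
    using F Fb by (intro nn_integral_add[symmetric]) (simp_all add: measurable_cong_sets[OF sets_disc refl])
  also have "\<dots> = (\<integral>\<^sup>+z. ?C \<partial>disc_measure)"
    using AE by (intro nn_integral_cong_AE) (auto elim: eventually_mono simp: pair)
  also have "\<dots> = ?C" by (simp add: d.emeasure_space_1[simplified])
  finally have sum: "(\<integral>\<^sup>+z. F z \<partial>disc_measure) + (\<integral>\<^sup>+z. F z \<partial>disc_measure) = ?C" .
  have g: "line_avg (0, 1, 0) K < \<infinity>" "line_avg (0, 0, 1) K < \<infinity>"
    by (rule line_avg_finite[OF K(1)], simp add: unit3_def)+
  then have "?C < \<infinity>" by (simp add: ennreal_mult_less_top)
  then have fin: "(\<integral>\<^sup>+z. F z \<partial>disc_measure) < \<infinity>" unfolding sum[symmetric] by simp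
  have "2 * psi K = enn2real ((\<integral>\<^sup>+z. F z \<partial>disc_measure) + (\<integral>\<^sup>+z. F z \<partial>disc_measure))"
    unfolding psi using fin by (subst enn2real_plus) auto
  also have "\<dots> = (1 / ball_moment) * (enn2real (line_avg (0, 1, 0) K) + enn2real (line_avg (0, 0, 1) K))"
    unfolding sum using g ball_moment_pos by (simp add: enn2real_mult enn2real_plus)
  finally show ?thesis by simp
qed

theorem theorem3p2p4:
  fixes K :: "(complex^2) set"
  assumes "compact K" and "convex K"
  shows "phi K + 2 * psi K = intrinsic_volumes K 2"
proof (cases "K = {}")
  case True
  have "intrinsic_volumes K 2 = coeff (0 :: real poly) 2 / pi"
    by (rule intrinsic_volumes_2) (simp_all add: True set_plus_def)
  moreover have "phi K = 0" "psi K = 0"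
    by (simp_all add: True phi_def psi_def vol2_in_def)
  ultimately show ?thesis by simp
next
  case False
  note K = assms False
  have g: "line_avg (1, 0, 0) K < \<infinity>" "line_avg (0, 1, 0) K < \<infinity>" "line_avg (0, 0, 1) K < \<infinity>"
    by (rule line_avg_finite[OF assms(1)], simp add: unit3_def)+
  have "(phi K + 2 * psi K) * ball_moment = enn2real (Theta K)"
    unfolding phi_eq[OF assms] psi_eq[OF K] Theta_def
    using g ball_moment_pos by (simp add: enn2real_plus add_divide_distrib[symmetric])
  also have "\<dots> = intrinsic_volumes K 2 * ball_moment"
    by (rule intrinsic_volume_2_eq_Theta[OF K, symmetric])
  finally show ?thesis using ball_moment_pos by simp
qed

end
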